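(* Let $V$ be a vector superspace over $\mathbb R$ of dimension $n|m$. For (homogeneous) $u,v\in V$ and $\alpha,\beta\in V^*$, the operators $e(u)$, $e(\alpha)$ on the spaces of mixed forms $\Lambda^{r|s}_{p|q}(V)$ obey the following relations: $$e(u)e(v)+(-1)^{\tilde u\tilde v}e(v)e(u)=0,$$ $$e(\alpha)e(\beta)+(-1)^{\tilde\alpha\tilde\beta}e(\beta)e(\alpha)=0,$$ $$e(u)e(\alpha)+(-1)^{\tilde\alpha\tilde u}e(\alpha)e(u)=\langle u,\alpha\rangle\,\sigma,$$ where $\sigma=\sigma_{1|0}:\Lambda^{r|s}_{p|q}(V)\to\Lambda^{r+1|s}_{p+1|q}(V)$ is the stability isomorphism.
   Context: Conventions. $V$ is a vector superspace over $\mathbb R$, $\dim V=n|m$, identified with the corresponding supermanifold; $(e_A)$ is a basis and $(e^A)$ the dual basis of $V^*$; $\tilde{\ }$ denotes parity; repeated indices are summed; derivatives act from the left; $\Pi$ is parity reversion; $\mathrm{Ber}$ is the Berezinian. $\langle u,\alpha\rangle=u^A\alpha_A$ for $u=u^Ae_A$, $\alpha=e^A\alpha_A$. $\mathrm{Vol}\,V=\mathrm{Ber}\,V^*$ is the space of volume forms, whose elements are written by their coefficient in the chosen basis. All matrices below are even, i.e. an entry has parity equal to the sum of the parities of its two indices. Mixed forms. $\Lambda^{r|s}_{p|q}(V)$ is the space of smooth $\mathrm{Vol}\,V$-valued maps $\mathcal L(p,w)$ of $p$ even and $q$ odd covectors on $V\oplus\mathbb R^{r|s}$ (points of $((V\oplus\mathbb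 R^{r|s})^* )^p\times((V\oplus\mathbb R^{r|s})^*\Pi)^q$), defined at arguments for which the Berezinian conditions make sense (odd covectors, and odd rows of $w$, linearly independent). The matrices are $p=(p_A{}^K)$, $w=(w_F{}^K)$, where $K$ runs over $p|q$ values and numbers the covectors (columns), $F$ runs over $r|s$ values, and $p$ is placed over $w$. The conditions are: $\mathcal L(ph,wh)=\mathcal L(p,w)\,\mathrm{Ber}\,h$ for $h\in GL(p|q)$; $\mathcal L(p+aw,gw)=\mathcal L(p,w)\,\mathrm{Ber}\,g$ for $g\in GL(r|s)$ and all matrices $a=(a_A{}^F)$ with $n|m$ rows and $r|s$ columns; and $$\frac{\partial^2\mathcal L}{\partial p_A{}^K\partial p_B{}^L}+(-1)^{\tilde A\tilde B+(\tilde A+\tilde B)\tilde L}\frac{\partial^2\mathcal L}{\partial p_B{}^K\partial p_A{}^L}=0,$$ $$\frac{\partial^2\mathcal L}{\partial p_A{}^K\partial w_F{}^L}+(-1)^{\tilde A\tilde F+(\tilde A+\tilde F)\tilde L}\frac{\partial^2\mathcal L}{\partial w_F{}^K\partial p_A{}^L}=0,$$ $$\frac{\partial^2\mathcal L}{\partial w_F{}^K\partial w_G{}^L}+(-1)^{\tilde F\tilde G+(\tilde F+\tilde G)\tilde L}\frac{\partial^2\mathcal L}{\partial w_G{}^K\partial w_F{}^L}=0 .$$ (So $s\leqslant q\leqslant m+s$.) Stability isomorphisms (known to be well-defined isomorphisms). $\sigma_{k|l}:\Lambda^{r|s}_{p|q}\to\Lambda^{r+k|s+l}_{p+k|q+l}$,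 $$(\sigma_{k|l}\mathcal L)\begin{pmatrix}p_1&p_2\\ w_{11}&w_{12}\\ w_{21}&w_{22}\end{pmatrix}=\mathcal L\begin{pmatrix}p_1-p_2w_{22}^{-1}w_{21}\\ w_{11}-w_{12}w_{22}^{-1}w_{21}\end{pmatrix}\cdot\mathrm{Ber}\,w_{22},$$ where the new $k|l$ columns and rows are the last ones (last among even, respectively odd), extended uniquely to all admissible arguments. Operators. For $\alpha=e^A\alpha_A\in V^*$, $u=u^Ae_A\in V$, define $e(\alpha):\Lambda^{r|s}_{p|q}(V)\to\Lambda^{r+1|s}_{p|q}(V)$ and $e(u):\Lambda^{r|s}_{p|q}(V)\to\Lambda^{r|s}_{p+1|q}(V)$ by $$e(\alpha)\mathcal L=(-1)^r\alpha_A\,w_{r+1}{}^K(-1)^{\tilde\alpha\tilde A}\frac{\partial\mathcal L}{\partial p_A{}^K},$$ $$e(u)\mathcal L=(-1)^ru^A\left(p_A{}^{p+1}-(-1)^{\tilde B\tilde K}p_A{}^Kp_B{}^{p+1}\frac{\partial}{\partial p_B{}^K}-(-1)^{\tilde F\tilde K}p_A{}^Kw_F{}^{p+1}\frac{\partial}{\partial w_F{}^K}\right)\mathcal L.$$ Here $w_{r+1}$ is the additional (last even) row, $p+1$ labels the additional (last even) column, and $K$, $F$ run over the original $p|q$ columns and $r|s$ rows of the argument of $\mathcal L$. These operators map forms to forms and do not depend on the choice of bases. *)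

theory Defs
  imports "HOL-Analysis.Analysis" "HOL-Library.Nat_Bijection"
begin

section \<open>Grassmann algebras\<close>

text \<open>
  Real Grassmann algebra on anticommuting generators indexed by a linearly ordered type.
  The coefficient at a finite set \<open>I\<close> is the one of the product of the generators in \<open>I\<close>
  taken in increasing order.  Elements involve finitely many generators only.
\<close>

typedef 'g grass = "{f :: 'g set \<Rightarrow> real. finite {I. f I \<noteq> 0} \<and> (\<forall>I. f I \<noteq> 0 \<longrightarrow> finite I)}"
  morphisms gcoeff Grass
  by (rule exI[of _ "\<lambda>_. 0"]) simp

setup_lifting type_definition_grass

text \<open>Reordering sign of \<open>\<xi>\<^sup>I \<xi>\<^sup>J = \<plusminus> \<xi>\<^sup>I\<^sup>\<union>\<^sup>J\<close> for disjoint \<open>I\<close>, \<open>J\<close>.\<close>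

definition gsign :: "'g::linorder set \<Rightarrow> 'g set \<Rightarrow> real" where
  "gsign I J = (- 1) ^ card {(i, j). i \<in> I \<and> j \<in> J \<and> j < i}"

lemma gsign_Un_left:
  assumes "finite I" "finite J" "finite K" "I \<inter> J = {}"
  shows "gsign (I \<union> J) K = gsign I K * gsign J K"
proof -
  let ?S = "\<lambda>I. {(i, j). i \<in> I \<and> j \<in> K \<and> j < i}"
  have fin: "finite (?S I)" if "finite I" for I
    by (rule finite_subset[of _ "I \<times> K"]) (use that assms in auto)
  have "card (?S I \<union> ?S J) = card (?S I) + card (?S J)"
    by (rule card_Un_disjoint) (use fin assms in auto)
  moreover have "?S (I \<union> J) = ?S I \<union> ?S J" by auto
  ultimately show ?thesis by (simp add: gsign_def power_add)
qed

lemma gsign_Un_right: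
  assumes "finite I" "finite J" "finite K" "J \<inter> K = {}"
  shows "gsign I (J \<union> K) = gsign I J * gsign I K"
proof -
  let ?S = "\<lambda>J. {(i, j). i \<in> I \<and> j \<in> J \<and> j < i}"
  have fin: "finite (?S J)" if "finite J" for J
    by (rule finite_subset[of _ "I \<times> J"]) (use that assms in auto)
  have "card (?S J \<union> ?S K) = card (?S J) + card (?S K)"
    by (rule card_Un_disjoint) (use fin assms in auto)
  moreover have "?S (J \<union> K) = ?S J \<union> ?S K" by auto
  ultimately show ?thesis by (simp add: gsign_def power_add)
qed

lemma gsign_empty [simp]: "gsign {} J = 1" "gsign I {} = 1"
  by (simp_all add: gsign_def)

instantiation grass :: (type) real_vector
begin

lift_definition zero_grass :: "'a grass" is "\<lambda>_. 0" by simp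

lift_definition plus_grass :: "'a grass \<Rightarrow> 'a grass \<Rightarrow> 'a grass" is "\<lambda>f g I. f I + g I"
proof -
  fix f g :: "'a set \<Rightarrow> real"
  assume f: "finite {I. f I \<noteq> 0} \<and> (\<forall>I. f I \<noteq> 0 \<longrightarrow> finite I)"
    and g: "finite {I. g I \<noteq> 0} \<and> (\<forall>I. g I \<noteq> 0 \<longrightarrow> finite I)"
  have "finite {I. f I + g I \<noteq> 0}"
    by (rule finite_subset[of _ "{I. f I \<noteq> 0} \<union> {I. g I \<noteq> 0}"]) (use f g in auto)
  moreover have "finite I" if "f I + g I \<noteq> 0" for I
    using that f g by (cases "f I = 0") auto
  ultimately show "finite {I. f I + g I \<noteq> 0} \<and> (\<forall>I. f I + g I \<noteq> 0 \<longrightarrow> finite I)" by blast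
qed

lift_definition uminus_grass :: "'a grass \<Rightarrow> 'a grass" is "\<lambda>f I. - f I" by simp

definition minus_grass :: "'a grass \<Rightarrow> 'a grass \<Rightarrow> 'a grass" where
  "minus_grass x y = x + - y"

lift_definition scaleR_grass :: "real \<Rightarrow> 'a grass \<Rightarrow> 'a grass" is "\<lambda>c f I. c * f I"
  by (auto elim: rev_finite_subset)

instance
  by standard (unfold minus_grass_def, (transfer; simp add: fun_eq_iff algebra_simps)+)

end

instantiation grass :: (linorder) real_algebra_1
begin

lift_definition one_grass :: "'a grass" is "\<lambda>I. if I = {} then 1 else 0" by simp

lift_definition times_grass :: "'a grass \<Rightarrow> 'a grass \<Rightarrow> 'a grass"
  is "\<lambda>f g K. \<Sum>I\<in>Pow K. gsign I (K - I) * f I * g (K - I)"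
proof -
  fix f g :: "'a set \<Rightarrow> real"
  let ?h = "\<lambda>K. \<Sum>I\<in>Pow K. gsign I (K - I) * f I * g (K - I)"
  assume f: "finite {I. f I \<noteq> 0} \<and> (\<forall>I. f I \<noteq> 0 \<longrightarrow> finite I)"
    and g: "finite {I. g I \<noteq> 0} \<and> (\<forall>I. g I \<noteq> 0 \<longrightarrow> finite I)"
  have "K \<in> (\<lambda>(I, J). I \<union> J) ` ({I. f I \<noteq> 0} \<times> {I. g I \<noteq> 0})" if "?h K \<noteq> 0" for K
  proof -
    from that obtain I where "I \<in> Pow K" "gsign I (K - I) * f I * g (K - I) \<noteq> 0"
      by (meson sum.neutral)
    then show ?thesis by (intro image_eqI[of _ _ "(I, K - I)"]) auto
  qed
  then have "{K. ?h K \<noteq> 0} \<subseteq> (\<lambda>(I, J). I \<union> J) ` ({I. f I \<noteq> 0} \<times> {I. g I \<noteq> 0})" by blast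
  then have "finite {K. ?h K \<noteq> 0}" using f g by (meson finite_SigmaI finite_imageI finite_subset)
  moreover have "finite K" if "?h K \<noteq> 0" for K
    using that by (metis finite_Pow_iff sum.infinite)
  ultimately show "finite {K. ?h K \<noteq> 0} \<and> (\<forall>K. ?h K \<noteq> 0 \<longrightarrow> finite K)" by blast
qed

instance
proof
  fix a b c :: "'a grass" and r :: real
  show "a * b * c = a * (b * c)"
  proof (transfer, rule ext)
    fix a b c :: "'a set \<Rightarrow> real" and K :: "'a set"
    let ?l = "\<Sum>I\<in>Pow K. gsign I (K - I) *
        (\<Sum>J\<in>Pow I. gsign J (I - J) * a J * b (I - J)) * c (K - I)"
    let ?r = "\<Sum>J\<in>Pow K. gsign J (K - J) * a J *
        (\<Sum>M\<in>Pow (K - J). gsign M (K - J - M) * b M * c (K - J - M))"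
    show "?l = ?r"
    proof (cases "finite K")
      case False
      then show ?thesis by simp
    next
      case True
      have fin: "finite I" if "I \<subseteq> K" for I using that True finite_subset by blast
      have "?l = (\<Sum>I\<in>Pow K. \<Sum>J\<in>Pow I.
          gsign I (K - I) * gsign J (I - J) * a J * b (I - J) * c (K - I))"
        by (simp add: sum_distrib_left sum_distrib_right mult_ac)
      also have "\<dots> = (\<Sum>(I, J)\<in>(SIGMA I:Pow K. Pow I).
          gsign I (K - I) * gsign J (I - J) * a J * b (I - J) * c (K - I))"
        by (rule sum.Sigma) (use True fin in auto)
      also have "\<dots> = (\<Sum>(J, M)\<in>(SIGMA J:Pow K. Pow (K - J)).
          gsign J (K - J) * gsign M (K - J - M) * a J * b M * c (K - J - M))"
      proof (rule sum.reindex_bij_witness[of _ "\<lambda>(J, M). (J \<union> M, J)" "\<lambda>(I, J). (J, I - J)"],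
          goal_cases)
        case (5 x)
        obtain I J where x: "x = (I, J)" by (cases x)
        with 5 have IK: "I \<subseteq> K" and JI: "J \<subseteq> I" by auto
        let ?M = "I - J" and ?R = "K - I"
        have e: "K - J - ?M = ?R" "K - J = ?M \<union> ?R" "I = J \<union> ?M" using IK JI by auto
        have f: "finite J" "finite ?M" "finite ?R" using IK JI True fin by blast+
        have "gsign J (K - J) = gsign J ?M * gsign J ?R"
          unfolding e(2) by (rule gsign_Un_right) (use f in auto)
        moreover have "gsign I ?R = gsign J ?R * gsign ?M ?R"
          by (subst e(3), rule gsign_Un_left) (use f in auto)
        ultimately show ?case by (simp add: x e(1))
      qed auto
      also have "\<dots> = (\<Sum>J\<in>Pow K. \<Sum>M\<in>Pow (K - J).
          gsign J (K - J) * gsign M (K - J - M) * a J * b M * c (K - J - M))"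
        by (rule sum.Sigma[symmetric]) (use True fin in auto)
      also have "\<dots> = ?r"
        by (simp add: sum_distrib_left mult_ac)
      finally show ?thesis .
    qed
  qed
  show "(a + b) * c = a * c + b * c" "a * (b + c) = a * b + a * c"
    by (transfer, simp add: algebra_simps sum.distrib)+
  show "r *\<^sub>R a * b = r *\<^sub>R (a * b)" "a * r *\<^sub>R b = r *\<^sub>R (a * b)"
    by (transfer, simp add: sum_distrib_left mult_ac)+
  show "(0::'a grass) \<noteq> 1" by transfer (simp add: fun_eq_iff)
  show "1 * a = a"
  proof (transfer, rule ext)
    fix a :: "'a set \<Rightarrow> real" and K
    assume a: "finite {I. a I \<noteq> 0} \<and> (\<forall>I. a I \<noteq> 0 \<longrightarrow> finite I)"
    show "(\<Sum>I\<in>Pow K. gsign I (K - I) * (if I = {} then 1 else 0) * a (K - I)) = a K"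
    proof (cases "finite K")
      case True
      have "(\<Sum>I\<in>Pow K. gsign I (K - I) * (if I = {} then 1 else 0) * a (K - I))
          = (\<Sum>I\<in>{{}}. gsign I (K - I) * (if I = {} then 1 else 0) * a (K - I))"
        by (rule sum.mono_neutral_right) (use True in auto)
      then show ?thesis by simp
    qed (use a in auto)
  qed
  show "a * 1 = a"
  proof (transfer, rule ext)
    fix a :: "'a set \<Rightarrow> real" and K
    assume a: "finite {I. a I \<noteq> 0} \<and> (\<forall>I. a I \<noteq> 0 \<longrightarrow> finite I)"
    show "(\<Sum>I\<in>Pow K. gsign I (K - I) * a I * (if K - I = {} then 1 else 0)) = a K"
    proof (cases "finite K")
      case True
      have "(\<Sum>I\<in>Pow K. gsign I (K - I) * a I * (if K - I = {} then 1 else 0))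
          = (\<Sum>I\<in>{K}. gsign I (K - I) * a I * (if K - I = {} then 1 else 0))"
        by (rule sum.mono_neutral_right) (use True in auto)
      then show ?thesis by simp
    qed (use a in auto)
  qed
qed

end

lift_definition ggen :: "'g \<Rightarrow> 'g grass" is "\<lambda>i I. if I = {i} then 1 else 0" by simp

text \<open>Left derivative with respect to a generator.\<close>

lift_definition gderiv :: "'g::linorder \<Rightarrow> 'g grass \<Rightarrow> 'g grass"
  is "\<lambda>c f J. if c \<in> J then 0 else gsign {c} J * f (insert c J)"
proof -
  fix c :: 'g and f :: "'g set \<Rightarrow> real"
  let ?h = "\<lambda>J. if c \<in> J then 0 else gsign {c} J * f (insert c J)"
  assume f: "finite {I. f I \<noteq> 0} \<and> (\<forall>I. f I \<noteq> 0 \<longrightarrow> finite I)"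
  have "J \<in> (\<lambda>I. I - {c}) ` {I. f I \<noteq> 0}" if "?h J \<noteq> 0" for J
    by (rule image_eqI[of _ _ "insert c J"]) (use that in \<open>auto split: if_splits\<close>)
  then have "{J. ?h J \<noteq> 0} \<subseteq> (\<lambda>I. I - {c}) ` {I. f I \<noteq> 0}" by blast
  then have "finite {J. ?h J \<noteq> 0}" using f by (meson finite_imageI finite_subset)
  moreover have "finite J" if "?h J \<noteq> 0" for J
    using that f by (metis finite_insert mult_zero_right)
  ultimately show "finite {J. ?h J \<noteq> 0} \<and> (\<forall>J. ?h J \<noteq> 0 \<longrightarrow> finite J)" by blast
qed

definition gbody :: "'g grass \<Rightarrow> real" where
  "gbody a = gcoeff a {}"

definition gsoul :: "'g::linorder grass \<Rightarrow> 'g grass" where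
  "gsoul a = a - of_real (gbody a)"

definition ghomogeneous :: "nat \<Rightarrow> 'g grass \<Rightarrow> bool" where
  "ghomogeneous k a \<longleftrightarrow> (\<forall>I. gcoeff a I \<noteq> 0 \<longrightarrow> card I mod 2 = k mod 2)"

definition ginv :: "'g::linorder grass \<Rightarrow> 'g grass" where
  "ginv a = (THE b. a * b = 1 \<and> b * a = 1)"

section \<open>Supermatrices and the Berezinian\<close>

text \<open>Indices running over \<open>k|l\<close> values, numbered from 0 in each parity.\<close>

datatype idx = Even nat | Odd nat

fun par :: "idx \<Rightarrow> nat" where
  "par (Even i) = 0"
| "par (Odd i) = 1"

definition dimset :: "nat \<Rightarrow> nat \<Rightarrow> idx set" where
  "dimset k l = Even ` {..<k} \<union> Odd ` {..<l}"

text \<open>\<open>shift k l\<close> maps the index range of \<open>k'|l'\<close> to the last \<open>k'|l'\<close> indices of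
  \<open>k+k'|l+l'\<close>.\<close>

fun shift :: "nat \<Rightarrow> nat \<Rightarrow> idx \<Rightarrow> idx" where
  "shift k l (Even i) = Even (k + i)"
| "shift k l (Odd j) = Odd (l + j)"

text \<open>Supermatrices are functions of two indices; only the entries in the relevant index
  ranges matter.  Entries lie in the Grassmann algebra with countably many generators, so
  that these are the points of the supermanifolds of matrices over all finite-dimensional
  Grassmann algebras at once.\<close>

type_synonym smat = "idx \<Rightarrow> idx \<Rightarrow> nat grass"

definition even_mat :: "idx set \<Rightarrow> idx set \<Rightarrow> smat \<Rightarrow> bool" where
  "even_mat R S M \<longleftrightarrow> (\<forall>i\<in>R. \<forall>j\<in>S. ghomogeneous (par i + par j) (M i j))"

definition mat_mult ::
  "'k set \<Rightarrow> ('i \<Rightarrow> 'k \<Rightarrow> 'a::ring_1) \<Rightarrow> ('k \<Rightarrow> 'j \<Rightarrow> 'a) \<Rightarrow> 'i \<Rightarrow> 'j \<Rightarrow> 'a" where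
  "mat_mult S M N i j = (\<Sum>k\<in>S. M i k * N k j)"

definition is_mat_inverse ::
  "'i set \<Rightarrow> ('i \<Rightarrow> 'i \<Rightarrow> 'a::ring_1) \<Rightarrow> ('i \<Rightarrow> 'i \<Rightarrow> 'a) \<Rightarrow> bool" where
  "is_mat_inverse S M N \<longleftrightarrow> (\<forall>i\<in>S. \<forall>j\<in>S.
     mat_mult S M N i j = (if i = j then 1 else 0) \<and>
     mat_mult S N M i j = (if i = j then 1 else 0))"

definition mat_inverse :: "'i set \<Rightarrow> ('i \<Rightarrow> 'i \<Rightarrow> 'a::ring_1) \<Rightarrow> 'i \<Rightarrow> 'i \<Rightarrow> 'a" where
  "mat_inverse S M = (SOME N. is_mat_inverse S M N)"

definition GL :: "nat \<Rightarrow> nat \<Rightarrow> smat set" where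
  "GL k l = {h. even_mat (dimset k l) (dimset k l) h \<and> (\<exists>N. is_mat_inverse (dimset k l) h N)}"

text \<open>Only used for matrices with (commuting) even entries.\<close>

definition gdet :: "nat \<Rightarrow> (nat \<Rightarrow> nat \<Rightarrow> 'g::linorder grass) \<Rightarrow> 'g grass" where
  "gdet k M = (\<Sum>\<pi> | \<pi> permutes {..<k}.
     of_int (sign \<pi>) * prod_list (map (\<lambda>i. M i (\<pi> i)) [0..<k]))"

definition Ber :: "nat \<Rightarrow> nat \<Rightarrow> smat \<Rightarrow> nat grass" where
  "Ber k l h =
    (let h00 = (\<lambda>i j. h (Even i) (Even j)); h01 = (\<lambda>i j. h (Even i) (Odd j));
         h10 = (\<lambda>i j. h (Odd i) (Even j)); h11 = (\<lambda>i j. h (Odd i) (Odd j));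
         X = mat_mult {..<l} (mat_mult {..<l} h01 (mat_inverse {..<l} h11)) h10
     in gdet k (\<lambda>i j. h00 i j - X i j) * ginv (gdet l h11))"

section \<open>Superfunctions\<close>

text \<open>Coordinates: \<open>Pc A K\<close> is \<open>p\<^sub>A\<^sup>K\<close> and \<open>Wc F K\<close> is \<open>w\<^sub>F\<^sup>K\<close>.
  The linear order only serves to write down monomials in the odd coordinates;
  which order is taken is immaterial.\<close>

datatype coord = Pc idx idx | Wc idx idx

fun idx_code :: "idx \<Rightarrow> nat" where
  "idx_code (Even i) = 2 * i"
| "idx_code (Odd i) = 2 * i + 1"

fun coord_code :: "coord \<Rightarrow> nat" where
  "coord_code (Pc A K) = 2 * prod_encode (idx_code A, idx_code K)"
| "coord_code (Wc F K) = 2 * prod_encode (idx_code F, idx_code K) + 1"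

lemma idx_code_eq [simp]: "idx_code A = idx_code B \<longleftrightarrow> A = B"
  by (cases A; cases B) (simp_all, presburger+)

lemma coord_code_eq [simp]: "coord_code c = coord_code d \<longleftrightarrow> c = d"
proof (cases c; cases d)
qed (simp_all, presburger+)

instantiation coord :: linorder
begin

definition less_eq_coord :: "coord \<Rightarrow> coord \<Rightarrow> bool" where
  "less_eq_coord c d \<longleftrightarrow> coord_code c \<le> coord_code d"

definition less_coord :: "coord \<Rightarrow> coord \<Rightarrow> bool" where
  "less_coord c d \<longleftrightarrow> coord_code c < coord_code d"

instance
  by standard (auto simp: less_eq_coord_def less_coord_def)

end

fun cpar :: "coord \<Rightarrow> nat" where
  "cpar (Pc A K) = (par A + par K) mod 2"
| "cpar (Wc F K) = (par F + par K) mod 2"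

text \<open>The coordinates on \<open>p|q\<close>-tuples of covectors on \<open>V \<oplus> \<real>\<^bsup>r|s\<^esup>\<close>, \<open>dim V = n|m\<close>.\<close>

definition coords :: "nat \<Rightarrow> nat \<Rightarrow> nat \<Rightarrow> nat \<Rightarrow> nat \<Rightarrow> nat \<Rightarrow> coord set" where
  "coords n m p q r s =
     {Pc A K | A K. A \<in> dimset n m \<and> K \<in> dimset p q} \<union>
     {Wc F K | F K. F \<in> dimset r s \<and> K \<in> dimset p q}"

definition evens :: "coord set \<Rightarrow> coord set" where "evens C = {c \<in> C. cpar c = 0}"
definition odds :: "coord set \<Rightarrow> coord set" where "odds C = {c \<in> C. cpar c = 1}"

text \<open>A superfunction maps the values of the even coordinates to a Grassmann polynomial in the
  odd coordinates.  On a superdomain with coordinates \<open>C\<close>, values at coordinates outside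
  \<open>evens C\<close> are ignored; thus a superfunction is literally also a superfunction of
  more coordinates.\<close>

type_synonym sfun = "(coord \<Rightarrow> real) \<Rightarrow> coord grass"

definition pdiff :: "coord \<Rightarrow> ((coord \<Rightarrow> real) \<Rightarrow> real) \<Rightarrow> (coord \<Rightarrow> real) \<Rightarrow> real" where
  "pdiff c \<phi> x = deriv (\<lambda>t. \<phi> (x(c := t))) (x c)"

text \<open>All iterated partial derivatives exist and are continuous (product topology).\<close>

definition smooth_fun ::
  "coord set \<Rightarrow> (coord \<Rightarrow> real) set \<Rightarrow> ((coord \<Rightarrow> real) \<Rightarrow> real) \<Rightarrow> bool" where
  "smooth_fun E U \<phi> \<longleftrightarrow> (\<forall>cs\<in>lists E.
     continuous_on U (foldr pdiff cs \<phi>) \<and>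
     (\<forall>c\<in>E. \<forall>x\<in>U. (\<lambda>t. foldr pdiff cs \<phi> (x(c := t))) differentiable (at (x c))))"

text \<open>Smooth superfunctions on the superdomain over \<open>U\<close> with coordinates \<open>C\<close>, extended by 0
  outside \<open>U\<close> so that equality of superfunctions is equality of HOL functions.\<close>

definition sfuns :: "coord set \<Rightarrow> (coord \<Rightarrow> real) set \<Rightarrow> sfun set" where
  "sfuns C U = {f.
     (\<forall>x. x \<notin> U \<longrightarrow> f x = 0) \<and>
     (\<forall>x y. (\<forall>c\<in>evens C. x c = y c) \<longrightarrow> f x = f y) \<and>
     (\<forall>x I. gcoeff (f x) I \<noteq> 0 \<longrightarrow> I \<subseteq> odds C) \<and>
     (\<forall>I. smooth_fun (evens C) U (\<lambda>x. gcoeff (f x) I))}"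

definition restr :: "(coord \<Rightarrow> real) set \<Rightarrow> sfun \<Rightarrow> sfun" where
  "restr U f = (\<lambda>x. if x \<in> U then f x else 0)"

definition cfun :: "coord \<Rightarrow> sfun" where
  "cfun c = (\<lambda>x. if cpar c = 0 then of_real (x c) else ggen c)"

definition sderiv :: "coord \<Rightarrow> sfun \<Rightarrow> sfun" where
  "sderiv c f = (\<lambda>x. if cpar c = 0 then Grass (\<lambda>I. pdiff c (\<lambda>y. gcoeff (f y) I) x)
                     else gderiv c (f x))"

text \<open>Value of a superfunction at a point with Grassmann-valued coordinates \<open>z\<close>: Taylor expansion
  of the coefficients at the body of \<open>z\<close> in the (nilpotent) souls of the even coordinates.  The
  degree-\<open>N\<close> term is \<open>1/N! (\<Sum>\<^sub>c soul(z\<^sub>c) \<partial>\<^sub>c)\<^sup>N \<phi>\<close>; it is nonzero for finitely many \<open>N\<close> only.\<close>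

definition taylor_term ::
  "coord set \<Rightarrow> ((coord \<Rightarrow> real) \<Rightarrow> real) \<Rightarrow> (coord \<Rightarrow> nat grass) \<Rightarrow> nat \<Rightarrow> nat grass" where
  "taylor_term E \<phi> z N = (1 / fact N) *\<^sub>R
     (\<Sum>cs | cs \<in> lists E \<and> length cs = N.
        foldr pdiff cs \<phi> (\<lambda>c. gbody (z c)) *\<^sub>R prod_list (map (\<lambda>c. gsoul (z c)) cs))"

definition taylor ::
  "coord set \<Rightarrow> ((coord \<Rightarrow> real) \<Rightarrow> real) \<Rightarrow> (coord \<Rightarrow> nat grass) \<Rightarrow> nat grass" where
  "taylor E \<phi> z = (\<Sum>N | taylor_term E \<phi> z N \<noteq> 0. taylor_term E \<phi> z N)"

definition seval :: "coord set \<Rightarrow> sfun \<Rightarrow> (coord \<Rightarrow> nat grass) \<Rightarrow> nat grass" where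
  "seval C f z = (\<Sum>I\<in>Pow (odds C).
     taylor (evens C) (\<lambda>x. gcoeff (f x) I) z * prod_list (map z (sorted_list_of_set I)))"

section \<open>Mixed forms\<close>

text \<open>The underlying domain: the odd covectors (columns of the odd-odd blocks of \<open>p\<close> over \<open>w\<close>) and
  the odd rows of \<open>w\<close> are linearly independent.\<close>

definition form_dom :: "nat \<Rightarrow> nat \<Rightarrow> nat \<Rightarrow> (coord \<Rightarrow> real) set" where
  "form_dom m q s = {x.
     (\<forall>c::nat \<Rightarrow> real.
        (\<forall>a<m. (\<Sum>j<q. x (Pc (Odd a) (Odd j)) * c j) = 0) \<and>
        (\<forall>i<s. (\<Sum>j<q. x (Wc (Odd i) (Odd j)) * c j) = 0)
        \<longrightarrow> (\<forall>j<q. c j = 0)) \<and>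
     (\<forall>d::nat \<Rightarrow> real.
        (\<forall>j<q. (\<Sum>i<s. d i * x (Wc (Odd i) (Odd j))) = 0) \<longrightarrow> (\<forall>i<s. d i = 0))}"

fun point :: "smat \<Rightarrow> smat \<Rightarrow> coord \<Rightarrow> nat grass" where
  "point P W (Pc A K) = P A K"
| "point P W (Wc F K) = W F K"

definition admissible ::
  "nat \<Rightarrow> nat \<Rightarrow> nat \<Rightarrow> nat \<Rightarrow> nat \<Rightarrow> nat \<Rightarrow> smat \<Rightarrow> smat \<Rightarrow> bool" where
  "admissible n m p q r s P W \<longleftrightarrow>
     even_mat (dimset n m) (dimset p q) P \<and> even_mat (dimset r s) (dimset p q) W \<and>
     (\<lambda>c. gbody (point P W c)) \<in> form_dom m q s"

definition form_at ::
  "nat \<Rightarrow> nat \<Rightarrow> nat \<Rightarrow> nat \<Rightarrow> nat \<Rightarrow> nat \<Rightarrow> sfun \<Rightarrow> smat \<Rightarrow> smat \<Rightarrow> nat grass" where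
  "form_at n m p q r s L P W = seval (coords n m p q r s) L (point P W)"

text \<open>The space \<open>\<Lambda>\<^bsup>r|s\<^esup>\<^bsub>p|q\<^esub>(V)\<close> for \<open>dim V = n|m\<close>; covectors are given by their components, and
  volume-form values by their coefficients, in a basis of \<open>V\<close>.\<close>

definition mixed_forms :: "nat \<Rightarrow> nat \<Rightarrow> nat \<Rightarrow> nat \<Rightarrow> nat \<Rightarrow> nat \<Rightarrow> sfun set" where
  "mixed_forms n m p q r s = {L \<in> sfuns (coords n m p q r s) (form_dom m q s).
     (\<forall>P W h. admissible n m p q r s P W \<and> h \<in> GL p q \<longrightarrow>
        form_at n m p q r s L (mat_mult (dimset p q) P h) (mat_mult (dimset p q) W h)
        = form_at n m p q r s L P W * Ber p q h) \<and>
     (\<forall>P W a g. admissible n m p q r s P W \<and> even_mat (dimset n m) (dimset r s) a \<and> g \<in> GL r s \<longrightarrow>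
        form_at n m p q r s L (\<lambda>A K. P A K + mat_mult (dimset r s) a W A K)
                              (mat_mult (dimset r s) g W)
        = form_at n m p q r s L P W * Ber r s g) \<and>
     (\<forall>A\<in>dimset n m. \<forall>B\<in>dimset n m. \<forall>K\<in>dimset p q. \<forall>J\<in>dimset p q. \<forall>x\<in>form_dom m q s.
        sderiv (Pc A K) (sderiv (Pc B J) L) x
        + (- 1) ^ (par A * par B + (par A + par B) * par J)
          *\<^sub>R sderiv (Pc B K) (sderiv (Pc A J) L) x = 0) \<and>
     (\<forall>A\<in>dimset n m. \<forall>F\<in>dimset r s. \<forall>K\<in>dimset p q. \<forall>J\<in>dimset p q. \<forall>x\<in>form_dom m q s.
        sderiv (Pc A K) (sderiv (Wc F J) L) x
        + (- 1) ^ (par A * par F + (par A + par F) * par J)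
          *\<^sub>R sderiv (Wc F K) (sderiv (Pc A J) L) x = 0) \<and>
     (\<forall>F\<in>dimset r s. \<forall>G\<in>dimset r s. \<forall>K\<in>dimset p q. \<forall>J\<in>dimset p q. \<forall>x\<in>form_dom m q s.
        sderiv (Wc F K) (sderiv (Wc G J) L) x
        + (- 1) ^ (par F * par G + (par F + par G) * par J)
          *\<^sub>R sderiv (Wc G K) (sderiv (Wc F J) L) x = 0)}"

text \<open>The stability isomorphism \<open>\<sigma>\<^bsub>k|l\<^esub>\<close>.  The arguments with invertible \<open>w\<^sub>2\<^sub>2\<close> form a dense open
  part of all admissible ones, hence the extension is already unique among smooth
  superfunctions; being the unique form extending the given values, \<open>\<sigma>\<^bsub>k|l\<^esub> L\<close> is this one.\<close>

definition stab ::
  "nat \<Rightarrow> nat \<Rightarrow> nat \<Rightarrow> nat \<Rightarrow> nat \<Rightarrow> nat \<Rightarrow> nat \<Rightarrow> nat \<Rightarrow> sfun \<Rightarrow> sfun" where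
  "stab k l n m p q r s L =
    (THE M. M \<in> sfuns (coords n m (p + k) (q + l) (r + k) (s + l)) (form_dom m (q + l) (s + l)) \<and>
      (\<forall>P W. let S = dimset k l;
                 P2 = (\<lambda>A j. P A (shift p q j));
                 W12 = (\<lambda>F j. W F (shift p q j));
                 W21 = (\<lambda>i K. W (shift r s i) K);
                 W22 = (\<lambda>i j. W (shift r s i) (shift p q j));
                 Z = mat_mult S (mat_inverse S W22) W21
             in admissible n m (p + k) (q + l) (r + k) (s + l) P W \<and> W22 \<in> GL k l \<longrightarrow>
               form_at n m (p + k) (q + l) (r + k) (s + l) M P W
               = form_at n m p q r s L (\<lambda>A K. P A K - mat_mult S P2 Z A K)
                                       (\<lambda>F K. W F K - mat_mult S W12 Z F K) * Ber k l W22))"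

section \<open>Vector superspaces and the operators\<close>

definition superspace :: "(nat \<Rightarrow> 'v::real_vector set) \<Rightarrow> bool" where
  "superspace V \<longleftrightarrow> subspace (V 0) \<and> subspace (V 1) \<and> V 0 \<inter> V 1 = {0} \<and>
     (\<forall>v. \<exists>x\<in>V 0. \<exists>y\<in>V 1. v = x + y)"

text \<open>A homogeneous basis \<open>(e\<^sub>A)\<close> with \<open>n\<close> even and \<open>m\<close> odd vectors.\<close>

definition super_basis ::
  "nat \<Rightarrow> nat \<Rightarrow> (nat \<Rightarrow> 'v::real_vector set) \<Rightarrow> (idx \<Rightarrow> 'v) \<Rightarrow> bool" where
  "super_basis n m V e \<longleftrightarrow> inj_on e (dimset n m) \<and> independent (e ` dimset n m) \<and>
     span (e ` dimset n m) = UNIV \<and> (\<forall>A\<in>dimset n m. e A \<in> V (par A))"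

definition vcomp :: "nat \<Rightarrow> nat \<Rightarrow> (idx \<Rightarrow> 'v::real_vector) \<Rightarrow> 'v \<Rightarrow> idx \<Rightarrow> real" where
  "vcomp n m e u A = representation (e ` dimset n m) u (e A)"

text \<open>Covectors of parity \<open>b\<close>; the pairing \<open>\<langle>u, \<alpha>\<rangle> = u\<^sup>A \<alpha>\<^sub>A\<close> is \<open>\<alpha> u\<close>, and \<open>\<alpha>\<^sub>A = \<alpha> (e\<^sub>A)\<close>.\<close>

definition covectors :: "(nat \<Rightarrow> 'v::real_vector set) \<Rightarrow> nat \<Rightarrow> ('v \<Rightarrow> real) set" where
  "covectors V b = {\<alpha>. linear \<alpha> \<and> (\<forall>v\<in>V (1 - b). \<alpha> v = 0)}"

text \<open>\<open>e(\<alpha>)\<close> on \<open>\<Lambda>\<^bsup>r|s\<^esup>\<^bsub>p|q\<^esub>(V)\<close> for \<open>\<alpha>\<close> of parity \<open>b\<close>; the additional row has index \<open>Even r\<close>.\<close>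

definition e_covec ::
  "nat \<Rightarrow> nat \<Rightarrow> nat \<Rightarrow> nat \<Rightarrow> nat \<Rightarrow> nat \<Rightarrow> (idx \<Rightarrow> 'v::real_vector) \<Rightarrow> nat \<Rightarrow> ('v \<Rightarrow> real) \<Rightarrow> sfun \<Rightarrow> sfun"
  where
  "e_covec n m p q r s e b \<alpha> L = restr (form_dom m q s) (\<lambda>x.
     (- 1) ^ r *\<^sub>R (\<Sum>A\<in>dimset n m. \<Sum>K\<in>dimset p q.
       (\<alpha> (e A) * (- 1) ^ (b * par A)) *\<^sub>R (cfun (Wc (Even r) K) x * sderiv (Pc A K) L x)))"

text \<open>\<open>e(u)\<close> on \<open>\<Lambda>\<^bsup>r|s\<^esup>\<^bsub>p|q\<^esub>(V)\<close>; the additional column has index \<open>Even p\<close>.\<close>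

definition e_vec ::
  "nat \<Rightarrow> nat \<Rightarrow> nat \<Rightarrow> nat \<Rightarrow> nat \<Rightarrow> nat \<Rightarrow> (idx \<Rightarrow> 'v::real_vector) \<Rightarrow> 'v \<Rightarrow> sfun \<Rightarrow> sfun"
  where
  "e_vec n m p q r s e u L = restr (form_dom m q s) (\<lambda>x.
     (- 1) ^ r *\<^sub>R (\<Sum>A\<in>dimset n m. vcomp n m e u A *\<^sub>R
       (cfun (Pc A (Even p)) x * L x
        - (\<Sum>B\<in>dimset n m. \<Sum>K\<in>dimset p q. (- 1) ^ (par B * par K) *\<^sub>R
             (cfun (Pc A K) x * cfun (Pc B (Even p)) x * sderiv (Pc B K) L x))
        - (\<Sum>F\<in>dimset r s. \<Sum>K\<in>dimset p q. (- 1) ^ (par F * par K) *\<^sub>R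
             (cfun (Pc A K) x * cfun (Wc F (Even p)) x * sderiv (Wc F K) L x)))))"

end

theory Submission
  imports Defs "HOL-Combinatorics.Permutations"
begin

text \<open>
  The three relations are verified by differentiating one operator through the other.  Terms of first
  order in \<open>L\<close> cancel in pairs; the remaining second order terms vanish by the differential equations of
  forms in the first two relations, and by supercommutativity of derivatives in the third.  There the
  terms in which the derivative of one operator hits a coefficient of the other leave
  \<open>\<langle>u, \<alpha>\<rangle>\<close> times the function
  \<open>w\<^sub>2\<^sub>2 L - (-1)\<^bsup>BK\<^esup> w\<^sub>2\<^sub>1\<^sup>K p\<^sub>2\<^sub>B \<partial>L/\<partial>p\<^sub>B\<^sup>K - (-1)\<^bsup>FK\<^esup> w\<^sub>2\<^sub>1\<^sup>K w\<^sub>1\<^sub>2\<^sub>F \<partial>L/\<partial>w\<^sub>F\<^sup>K\<close>.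

  This function is \<open>\<sigma> L\<close>: the argument shift \<open>- p\<^sub>2 w\<^sub>2\<^sub>2\<^sup>-\<^sup>1 w\<^sub>2\<^sub>1\<close> in the definition
  of \<open>\<sigma>\<close> has rank one, so by the differential equations the Taylor expansion of \<open>L\<close> along it ends after
  the linear term.  The shift is carried out column by column.  An even column occurs at most linearly
  in \<open>L\<close>, and the shift of an odd column has a factor of square zero; this matters because the shift need
  be neither small nor nilpotent.  The products of the shifts of two different columns are antisymmetric
  in the rows, and cancel.
\<close>

section \<open>Grassmann algebras\<close>

text \<open>The operators are compared at real points, with generators as odd coordinates, but
  \<open>stab\<close> is a definite description in terms of values at Grassmann-valued points. The
  third relation therefore needs an explicit candidate for \<sigma> L, its values, and a uniqueness
  argument. The bridge is \<open>seval\<close>: on smooth superfunctions it is linear and turns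
  multiplication by a coordinate into multiplication by its value. The obstacle is that the shift of
  the argument may move the body of the point arbitrarily far, where a Taylor expansion at the old
  point says nothing. This happens only for entries in even rows and even columns. The domain
  restricts odd-odd entries alone, so the line in such a direction stays inside it, and L is affine
  on the whole line. Uniqueness goes the opposite way: independent generators in place of the odd
  coordinates let the coefficients be read off from a single value, and points where the body of
  \<open>w_22\<close> vanishes are limits along the line of that coordinate.\<close>

lemma gcoeff_0 [simp]: "gcoeff 0 I = 0" by transfer simp
lemma gcoeff_add [simp]: "gcoeff (a + b) I = gcoeff a I + gcoeff b I" by transfer simp
lemma gcoeff_uminus [simp]: "gcoeff (- a) I = - gcoeff a I" by transfer simp
lemma gcoeff_diff [simp]: "gcoeff (a - b) I = gcoeff a I - gcoeff b I"
  unfolding minus_grass_def by (simp only: gcoeff_add gcoeff_uminus)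
lemma gcoeff_scaleR [simp]: "gcoeff (k *\<^sub>R a) I = k * gcoeff a I" by transfer simp
lemma gcoeff_sum: "gcoeff (sum f S) I = (\<Sum>i\<in>S. gcoeff (f i) I)"
  by (induction S rule: infinite_finite_induct) auto
lemma gcoeff_1: "gcoeff 1 I = (if I = {} then 1 else 0)" by transfer simp
lemma gcoeff_mult: "gcoeff (a * b) K = (\<Sum>I\<in>Pow K. gsign I (K - I) * gcoeff a I * gcoeff b (K - I))"
  by transfer simp
lemma gcoeff_of_real: "gcoeff (of_real k) I = (if I = {} then k else 0)"
  by (simp add: of_real_def gcoeff_1)
lemma gcoeff_finite: "gcoeff a I \<noteq> 0 \<Longrightarrow> finite I" by transfer auto
lemma finite_gcoeff: "finite {I. gcoeff a I \<noteq> 0}" by transfer auto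
lemma grass_eqI: "(\<And>I. finite I \<Longrightarrow> gcoeff a I = gcoeff b I) \<Longrightarrow> a = b"
proof -
  assume *: "\<And>I. finite I \<Longrightarrow> gcoeff a I = gcoeff b I"
  have "gcoeff a I = gcoeff b I" for I
    using * gcoeff_finite by metis
  then show "a = b" by (simp add: gcoeff_inject[symmetric] fun_eq_iff)
qed

lemma gsign_sq [simp]: "gsign I J * gsign I J = 1"
  by (simp add: gsign_def flip: power_add)
lemma gsign_sq_mult [simp]: "gsign I J * (gsign I J * x) = x"
  by (simp flip: mult.assoc)

lemma gsign_singleton: "gsign {c} J = (- 1) ^ card {j \<in> J. j < c}"
proof -
  have "{(i, j). i \<in> {c} \<and> j \<in> J \<and> j < i} = Pair c ` {j \<in> J. j < c}" by auto
  then show ?thesis by (simp add: gsign_def card_image inj_on_def)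
qed

text \<open>The pairs in \<open>I \<times> J\<close> are either inversions or not, and exchanging
  the two factors exchanges these two kinds. Disjointness excludes ties.\<close>

lemma gsign_swap:
  assumes "finite I" "finite J" "I \<inter> J = {}"
  shows "gsign J I = (- 1) ^ (card I * card J) * gsign I J"
proof -
  let ?P = "{(i, j). i \<in> I \<and> j \<in> J \<and> j < i}" and ?Q = "{(i, j). i \<in> I \<and> j \<in> J \<and> i < j}"
  have fin: "finite ?P" "finite ?Q"
    by (rule finite_subset[of _ "I \<times> J"]; use assms in auto)+
  have "I \<times> J = ?P \<union> ?Q" using assms(3) by (auto simp: not_less_iff_gr_or_eq)
  then have "card I * card J = card ?P + card ?Q"
  proof -
    have "?P \<inter> ?Q = {}" by auto
    then show ?thesis
      using fin \<open>I \<times> J = ?P \<union> ?Q\<close> card_Un_disjoint[of ?P ?Q] by (simp flip: card_cartesian_product)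
  qed
  moreover have "card {(i, j). i \<in> J \<and> j \<in> I \<and> j < i} = card ?Q"
    by (rule bij_betw_same_card[of prod.swap])
       (auto simp: bij_betw_def inj_on_def image_def)
  ultimately show ?thesis by (simp add: gsign_def power_add)
qed

lemma gcoeff_ggen_mult:
  "gcoeff (ggen c * a) J = (if c \<in> J then gsign {c} (J - {c}) * gcoeff a (J - {c}) else 0)"
proof (cases "finite J")
  case True
  have g: "gcoeff (ggen c) I = (if I = {c} then 1 else 0)" for I :: "'a set" by transfer simp
  have "gcoeff (ggen c * a) J = (\<Sum>I\<in>Pow J. if I = {c} then gsign {c} (J - {c}) * gcoeff a (J - {c}) else 0)"
    unfolding gcoeff_mult g by (intro sum.cong) auto
  also have "\<dots> = (if c \<in> J then gsign {c} (J - {c}) * gcoeff a (J - {c}) else 0)"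
    using True by (subst sum.delta) auto
  finally show ?thesis .
next
  case False
  then have "gcoeff (ggen c * a) J = 0" "gcoeff a (J - {c}) = 0" using gcoeff_finite by (blast, metis finite_Diff2 finite.emptyI finite.insertI)
  then show ?thesis by simp
qed

section \<open>Left derivatives with respect to generators\<close>

lemma gcoeff_gderiv: "gcoeff (gderiv c a) J = (if c \<in> J then 0 else gsign {c} J * gcoeff a (insert c J))"
  by transfer simp

lemma gderiv_add: "gderiv c (a + b) = gderiv c a + gderiv c b"
  by (rule grass_eqI) (simp add: gcoeff_gderiv algebra_simps)
lemma gderiv_scaleR: "gderiv c (k *\<^sub>R a) = k *\<^sub>R gderiv c a"
  by (rule grass_eqI) (simp add: gcoeff_gderiv)
lemma gderiv_0 [simp]: "gderiv c 0 = 0"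
  by (rule grass_eqI) (simp add: gcoeff_gderiv)

lemma gsign_insert_right:
  "finite J \<Longrightarrow> d \<notin> J \<Longrightarrow> gsign {c} (insert d J) = gsign {c} {d} * gsign {c} J"
  using gsign_Un_right[of "{c}" "{d}" J] by simp

lemma gsign_anti: "c \<noteq> d \<Longrightarrow> gsign {c} {d} * gsign {d} {c} = - 1"
  using gsign_swap[of "{c}" "{d}"] by simp

lemma sign_swap_aux: "a * b = - 1 \<Longrightarrow> (a * x) * (b * y) = - (y * x)" for a b x y :: real
proof -
  assume "a * b = - 1"
  moreover have "(a * x) * (b * y) = (a * b) * (y * x)" by (simp only: mult_ac)
  ultimately show ?thesis by simp
qed

text \<open>Odd Leibniz rule. For \<open>c \<noteq> d\<close>, removing \<open>d\<close> and
  inserting \<open>c\<close> pass the remaining generators with the same signs in either order; only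
  the relative sign of \<open>c\<close> and \<open>d\<close> differs, and that is
  \<open>gsign_anti\<close>.\<close>

lemma gderiv_ggen_mult:
  "gderiv c (ggen d * a) = (if c = d then a else 0) - ggen d * gderiv c a"
proof (rule grass_eqI)
  fix J :: "'a set" assume J: "finite J"
  show "gcoeff (gderiv c (ggen d * a)) J = gcoeff ((if c = d then a else 0) - ggen d * gderiv c a) J"
  proof (cases "c = d")
    case True
    then show ?thesis
      by (auto simp: gcoeff_gderiv gcoeff_ggen_mult insert_absorb)
  next
    case False
    have "gsign {c} J * gsign {d} (insert c J - {d}) = - (gsign {d} (J - {d}) * gsign {c} (J - {d}))"
      if "d \<in> J" "c \<notin> J"
    proof -
      define K where "K = J - {d}"
      have K: "J = insert d K" "d \<notin> K" "c \<notin> K" "finite K" "insert c J - {d} = insert c K"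
        using that False J by (auto simp: K_def)
      show ?thesis unfolding K(5)
        using K gsign_insert_right[of K d c] gsign_insert_right[of K c d] gsign_anti[OF False]
        by (simp add: sign_swap_aux)
    qed
    then show ?thesis using False by (auto simp: gcoeff_gderiv gcoeff_ggen_mult insert_Diff_if simp flip: mult.assoc)
  qed
qed

lemma gderiv_gderiv: "gderiv c (gderiv d a) = - gderiv d (gderiv c a)"
proof (rule grass_eqI)
  fix J :: "'a set" assume J: "finite J"
  show "gcoeff (gderiv c (gderiv d a)) J = gcoeff (- gderiv d (gderiv c a)) J"
  proof (cases "c = d \<or> c \<in> J \<or> d \<in> J")
    case False
    then have "gsign {c} {d} * gsign {d} {c} = -1" by (simp add: gsign_anti)
    then have "gsign {c} {d} * gsign {c} J * (gsign {d} {c} * gsign {d} J) = - (gsign {d} J * gsign {c} J)"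
      by (rule sign_swap_aux)
    moreover have "gsign {d} (insert c J) = gsign {d} {c} * gsign {d} J"
      "gsign {c} (insert d J) = gsign {c} {d} * gsign {c} J"
      using False J gsign_insert_right[of J d c] gsign_insert_right[of J c d] by auto
    moreover have "gsign {d} {c} = - gsign {c} {d}"
      using \<open>gsign {c} {d} * gsign {d} {c} = -1\<close>
      by (metis gsign_sq mult_minus_right mult_left_cancel mult_zero_left neg_equal_zero one_neq_zero zero_neq_neg_one)
    ultimately have "gsign {c} J * gsign {d} (insert c J) = - (gsign {d} J * gsign {c} (insert d J))"
      by simp
    then show ?thesis using False by (auto simp add: gcoeff_gderiv insert_commute simp flip: mult.assoc)
  qed (auto simp: gcoeff_gderiv)
qed

section \<open>Parity and supercommutativity\<close>

lift_definition gpar :: "'g grass \<Rightarrow> 'g grass" is "\<lambda>f I. (- 1) ^ card I * f I" by simp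

lemma gcoeff_gpar: "gcoeff (gpar a) I = (- 1) ^ card I * gcoeff a I" by transfer simp

text \<open>Homogeneity as an eigenvector condition for the parity automorphism. Since
  \<open>gpar\<close> is linear and multiplicative, closure under sums, products and inverses
  becomes algebra without any counting of generators.\<close>

lemma ghomogeneous_gpar: "ghomogeneous k a \<longleftrightarrow> gpar a = (- 1) ^ k *\<^sub>R a"
proof -
  have p: "(card I mod 2 = k mod 2) \<longleftrightarrow> ((- 1) ^ card I = ((- 1) ^ k :: real))" for I :: "'a set"
    by (auto simp: uminus_power_if; presburger)
  have "gpar a = (- 1) ^ k *\<^sub>R a \<longleftrightarrow> (\<forall>I. (- 1) ^ card I * gcoeff a I = (- 1) ^ k * gcoeff a I)"
    by (metis gcoeff_gpar gcoeff_scaleR grass_eqI)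
  also have "\<dots> \<longleftrightarrow> ghomogeneous k a"
    unfolding ghomogeneous_def p mult_cancel_right by blast
  finally show ?thesis ..
qed

lemma gpar_mult: "gpar (a * b) = gpar a * gpar b"
proof (rule grass_eqI)
  fix K :: "'a set" assume K: "finite K"
  show "gcoeff (gpar (a * b)) K = gcoeff (gpar a * gpar b) K"
    unfolding gcoeff_gpar gcoeff_mult sum_distrib_left
  proof (rule sum.cong)
    fix I assume "I \<in> Pow K"
    then have "card K = card I + card (K - I)" using K
      by (metis Pow_iff card_Diff_subset card_mono finite_subset le_add_diff_inverse)
    then show "(- 1) ^ card K * (gsign I (K - I) * gcoeff a I * gcoeff b (K - I)) =
         gsign I (K - I) * ((- 1) ^ card I * gcoeff a I) * ((- 1) ^ card (K - I) * gcoeff b (K - I))"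
      by (simp add: power_add mult_ac)
  qed simp
qed

lemma gpar_simps: "gpar (a + b) = gpar a + gpar b" "gpar (k *\<^sub>R a) = k *\<^sub>R gpar a" "gpar 0 = 0" "gpar 1 = 1"
  by (rule grass_eqI, simp add: gcoeff_gpar gcoeff_1 algebra_simps)+

lemma ghom_mult: "ghomogeneous i a \<Longrightarrow> ghomogeneous j b \<Longrightarrow> ghomogeneous (i + j) (a * b)"
  by (simp add: ghomogeneous_gpar gpar_mult power_add mult.commute)
lemma ghom_add: "ghomogeneous i a \<Longrightarrow> ghomogeneous i b \<Longrightarrow> ghomogeneous i (a + b)"
  by (simp add: ghomogeneous_gpar gpar_simps scaleR_add_right)
lemma ghom_scaleR: "ghomogeneous i a \<Longrightarrow> ghomogeneous i (k *\<^sub>R a)"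
  by (simp add: ghomogeneous_gpar gpar_simps mult.commute)
lemma ghom_0 [simp]: "ghomogeneous i 0" by (simp add: ghomogeneous_def)
lemma ghom_1: "ghomogeneous 0 1" by (simp add: ghomogeneous_gpar gpar_simps)
lemma ghom_uminus: "ghomogeneous i a \<Longrightarrow> ghomogeneous i (- a)"
  by (simp add: ghomogeneous_def)
lemma ghom_diff: "ghomogeneous i a \<Longrightarrow> ghomogeneous i b \<Longrightarrow> ghomogeneous i (a - b)"
  using ghom_add[of i a "- b"] ghom_uminus by auto
lemma ghom_sum: "(\<And>x. x \<in> S \<Longrightarrow> ghomogeneous i (f x)) \<Longrightarrow> ghomogeneous i (sum f S)"
  by (induction S rule: infinite_finite_induct) (auto intro: ghom_add)
lemma ghom_of_real: "ghomogeneous 0 (of_real k)"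
  by (simp add: of_real_def ghom_scaleR ghom_1)
lemma ghom_cong: "i mod 2 = j mod 2 \<Longrightarrow> ghomogeneous i a \<longleftrightarrow> ghomogeneous j a"
  by (simp add: ghomogeneous_def)
lemma ghom_ggen: "ghomogeneous 1 (ggen c)"
proof -
  have g: "gcoeff (ggen c) I = (if I = {c} then 1 else 0)" for I :: "'a set" by transfer simp
  show ?thesis by (simp add: ghomogeneous_def g)
qed

text \<open>Replacing \<open>I\<close> by its complement in \<open>K\<close> matches the
  coefficients of the two products up to the sign of \<open>gsign_swap\<close>. Where both
  coefficients are nonzero, the cardinalities have the parities \<open>i\<close> and
  \<open>j\<close>.\<close>

lemma ghom_commute:
  assumes "ghomogeneous i a" "ghomogeneous j b"
  shows "a * b = (- 1) ^ (i * j) *\<^sub>R (b * a)"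
proof (rule grass_eqI)
  fix K :: "'a set" assume K: "finite K"
  have "gcoeff (b * a) K = (\<Sum>I\<in>Pow K. gsign (K - I) I * gcoeff b (K - I) * gcoeff a I)"
    unfolding gcoeff_mult
    by (rule sum.reindex_bij_witness[of _ "\<lambda>I. K - I" "\<lambda>I. K - I"]) (auto simp: double_diff)
  moreover have "gsign I (K - I) * gcoeff a I * gcoeff b (K - I) =
      (- 1) ^ (i * j) * (gsign (K - I) I * gcoeff b (K - I) * gcoeff a I)" if "I \<in> Pow K" for I
  proof (cases "gcoeff a I = 0 \<or> gcoeff b (K - I) = 0")
    case False
    have fin: "finite I" "finite (K - I)" using K that finite_subset by auto
    have "card I mod 2 = i mod 2" "card (K - I) mod 2 = j mod 2"
      using False assms by (auto simp: ghomogeneous_def)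
    then have "(- 1) ^ (card I * card (K - I)) = ((- 1) ^ (i * j) :: real)"
      by (auto simp: uminus_power_if)
    then show ?thesis using gsign_swap[OF fin] by (simp add: mult_ac)
  qed auto
  ultimately show "gcoeff (a * b) K = gcoeff ((- 1) ^ (i * j) *\<^sub>R (b * a)) K"
    unfolding gcoeff_scaleR gcoeff_mult[of a b] sum_distrib_left
    by (metis (no_types, lifting) sum.cong sum_distrib_left)
qed

text \<open>The second factor is arbitrary, which \<open>ghom_commute\<close> does not cover. This
  matters for values of superfunctions, which need not be homogeneous.\<close>

lemma ghom_even_commute: "ghomogeneous 0 a \<Longrightarrow> a * b = b * a"
proof (rule grass_eqI)
  fix K :: "'a set" assume K: "finite K" and a: "ghomogeneous 0 a"
  have "gcoeff (b * a) K = (\<Sum>I\<in>Pow K. gsign (K - I) I * gcoeff b (K - I) * gcoeff a I)"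
    unfolding gcoeff_mult
    by (rule sum.reindex_bij_witness[of _ "\<lambda>I. K - I" "\<lambda>I. K - I"]) (auto simp: double_diff)
  moreover have "gsign I (K - I) * gcoeff a I * gcoeff b (K - I) =
      gsign (K - I) I * gcoeff b (K - I) * gcoeff a I" if "I \<in> Pow K" for I
  proof (cases "gcoeff a I = 0")
    case False
    have fin: "finite I" "finite (K - I)" using K that finite_subset by auto
    have "even (card I)" using False a by (auto simp: ghomogeneous_def)
    then show ?thesis using gsign_swap[OF fin] by (simp add: mult_ac)
  qed auto
  ultimately show "gcoeff (a * b) K = gcoeff (b * a) K"
    unfolding gcoeff_mult[of a b] by (metis (no_types, lifting) sum.cong)
qed

lemma ghom_odd_sq: "ghomogeneous 1 a \<Longrightarrow> a * a = 0"
proof -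
  assume "ghomogeneous 1 a"
  then have "a * a = - (a * a)" using ghom_commute[of 1 a 1 a] by simp
  then show ?thesis by (metis real_vector.scale_eq_0_iff add_eq_0_iff scaleR_2 zero_neq_numeral)
qed

lemma gbody_mult: "gbody (a * b) = gbody a * gbody b"
  by (simp add: gbody_def gcoeff_mult)
lemma gbody_add: "gbody (a + b) = gbody a + gbody b" by (simp add: gbody_def)
lemma gbody_odd: "ghomogeneous 1 a \<Longrightarrow> gbody a = 0" by (auto simp: gbody_def ghomogeneous_def)

text \<open>\<open>gpar b\<close> is a left inverse of \<open>a\<close> as well, and a left inverse
  equals the right inverse \<open>b\<close>.\<close>

lemma ghom_inverse:
  assumes "ghomogeneous 0 a" "a * b = 1" "b * a = 1"
  shows "ghomogeneous 0 b"
proof -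
  have "gpar b * a = 1" using assms gpar_mult[of b a] by (simp add: ghomogeneous_gpar gpar_simps)
  then have "gpar b = b" using assms by (metis mult.assoc mult.left_neutral mult.right_neutral)
  then show ?thesis by (simp add: ghomogeneous_gpar)
qed

section \<open>Smooth functions\<close>

lemma continuous_on_fun_upd:
  "continuous_on UNIV (\<lambda>t. (x::'c \<Rightarrow> 'b::topological_space)(c := t))"
proof (rule continuous_on_coordinatewise_then_product)
  fix i
  show "continuous_on UNIV (\<lambda>t. (x(c := t)) i)" by (cases "i = c") (auto intro: continuous_intros)
qed

lemma eventually_line:
  fixes x :: "'c \<Rightarrow> 'b::topological_space"
  assumes "open U" "x \<in> U"
  shows "\<forall>\<^sub>F t in nhds (x c). x(c := t) \<in> U"
proof -
  have "open ((\<lambda>t. x(c := t)) -` U)"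
    by (rule open_vimage[OF assms(1) continuous_on_fun_upd])
  then show ?thesis
    using assms(2) by (intro eventually_nhds_in_open[where s = "(\<lambda>t. x(c := t)) -` U", simplified]) auto
qed

lemma pdiff_cong:
  assumes "open U" "x \<in> U" "\<And>y. y \<in> U \<Longrightarrow> \<phi> y = \<psi> y"
  shows "pdiff c \<phi> x = pdiff c \<psi> x"
  unfolding pdiff_def
  by (intro deriv_cong_ev eventually_mono[OF eventually_line[OF assms(1,2)]]) (use assms in auto)

lemma foldr_pdiff_cong:
  assumes "open U" "\<And>y. y \<in> U \<Longrightarrow> \<phi> y = \<psi> y" "x \<in> U"
  shows "foldr pdiff cs \<phi> x = foldr pdiff cs \<psi> x"
  using assms(3)
proof (induction cs arbitrary: x)
  case (Cons c cs)
  show ?case using pdiff_cong[OF assms(1) Cons.prems Cons.IH] by simp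
qed (use assms in simp)

lemma differentiable_cong_ev:
  fixes f g :: "real \<Rightarrow> real"
  assumes "\<forall>\<^sub>F t in nhds a. f t = g t" "g differentiable (at a)"
  shows "f differentiable (at a)"
proof -
  obtain D where "(g has_real_derivative D) (at a)" using assms(2) by (auto simp: real_differentiable_def)
  then have "(f has_real_derivative D) (at a)" using DERIV_cong_ev[OF refl assms(1) refl] by blast
  then show ?thesis by (auto simp: real_differentiable_def)
qed

text \<open>Smoothness is a statement about all iterated derivatives, so it suffices to exhibit a
  class of continuous functions, differentiable along coordinate lines, that is stable under partial
  derivatives. The closure results below differ only in the choice of the class
  \<open>P\<close>.\<close>

lemma smooth_coinduct:
  assumes "P \<phi>" "open U"
    and cont: "\<And>\<psi>. P \<psi> \<Longrightarrow> continuous_on U \<psi>"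
    and diff: "\<And>\<psi> c x. P \<psi> \<Longrightarrow> c \<in> E \<Longrightarrow> x \<in> U \<Longrightarrow> (\<lambda>t. \<psi> (x(c := t))) differentiable (at (x c))"
    and step: "\<And>\<psi> c. P \<psi> \<Longrightarrow> c \<in> E \<Longrightarrow> \<exists>\<eta>. P \<eta> \<and> (\<forall>x\<in>U. pdiff c \<psi> x = \<eta> x)"
  shows "smooth_fun E U \<phi>"
  unfolding smooth_fun_def
proof
  \<comment> \<open>An iterated derivative need not belong to \<open>P\<close> itself, because
    nothing is known outside \<open>U\<close>; it only agrees on \<open>U\<close> with a member of
    \<open>P\<close>.\<close>
  fix cs assume "cs \<in> lists E"
  then have "\<exists>\<eta>. P \<eta> \<and> (\<forall>x\<in>U. foldr pdiff cs \<phi> x = \<eta> x)"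
  proof (induction cs)
    case (Cons c cs)
    then obtain \<eta> where \<eta>: "P \<eta>" "\<forall>x\<in>U. foldr pdiff cs \<phi> x = \<eta> x" "c \<in> E" by auto
    obtain \<eta>' where "P \<eta>'" "\<forall>x\<in>U. pdiff c \<eta> x = \<eta>' x" using step \<eta> by blast
    moreover have "pdiff c (foldr pdiff cs \<phi>) x = pdiff c \<eta> x" if "x \<in> U" for x
      by (rule pdiff_cong[OF assms(2) that]) (use \<eta> in blast)
    ultimately show ?case by auto
  qed (use assms(1) in auto)
  then obtain \<eta> where \<eta>: "P \<eta>" "\<And>x. x \<in> U \<Longrightarrow> foldr pdiff cs \<phi> x = \<eta> x" by blast
  have "continuous_on U (foldr pdiff cs \<phi>)"
    by (rule continuous_on_eq[OF cont[OF \<eta>(1)]]) (simp add: \<eta>(2))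
  moreover have "(\<lambda>t. foldr pdiff cs \<phi> (x(c := t))) differentiable (at (x c))" if "c \<in> E" "x \<in> U" for c x
    by (rule differentiable_cong_ev[OF _ diff[OF \<eta>(1) that]])
       (rule eventually_mono[OF eventually_line[OF assms(2) that(2)] \<eta>(2)])
  ultimately show "continuous_on U (foldr pdiff cs \<phi>) \<and>
      (\<forall>c\<in>E. \<forall>x\<in>U. (\<lambda>t. foldr pdiff cs \<phi> (x(c := t))) differentiable (at (x c)))" by blast
qed

lemma smooth_continuous: "smooth_fun E U \<phi> \<Longrightarrow> continuous_on U \<phi>"
  unfolding smooth_fun_def by (metis foldr.simps(1) id_apply lists.Nil)

lemma smooth_differentiable:
  "smooth_fun E U \<phi> \<Longrightarrow> c \<in> E \<Longrightarrow> x \<in> U \<Longrightarrow> (\<lambda>t. \<phi> (x(c := t))) differentiable (at (x c))"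
  unfolding smooth_fun_def by (drule bspec[of _ _ "[]"]) auto

lemma smooth_DERIV:
  "smooth_fun E U \<phi> \<Longrightarrow> c \<in> E \<Longrightarrow> x \<in> U \<Longrightarrow>
    ((\<lambda>t. \<phi> (x(c := t))) has_real_derivative pdiff c \<phi> x) (at (x c))"
  unfolding pdiff_def by (rule smooth_differentiable[THEN DERIV_deriv_iff_real_differentiable[THEN iffD2]])

lemma smooth_pdiff: "smooth_fun E U \<phi> \<Longrightarrow> c \<in> E \<Longrightarrow> smooth_fun E U (pdiff c \<phi>)"
  unfolding smooth_fun_def
proof
  fix cs assume *: "\<forall>cs\<in>lists E. continuous_on U (foldr pdiff cs \<phi>) \<and>
     (\<forall>c\<in>E. \<forall>x\<in>U. (\<lambda>t. foldr pdiff cs \<phi> (x(c := t))) differentiable (at (x c)))" "c \<in> E" "cs \<in> lists E"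
  then show "continuous_on U (foldr pdiff cs (pdiff c \<phi>)) \<and>
      (\<forall>ca\<in>E. \<forall>x\<in>U. (\<lambda>t. foldr pdiff cs (pdiff c \<phi>) (x(ca := t))) differentiable (at (x ca)))"
    using bspec[OF *(1), of "cs @ [c]"] by simp
qed

lemma smooth_mono: "smooth_fun E U \<phi> \<Longrightarrow> E' \<subseteq> E \<Longrightarrow> smooth_fun E' U \<phi>"
  unfolding smooth_fun_def by (meson lists_mono subset_iff)

lemma smooth_cong:
  assumes "smooth_fun E U \<phi>" "open U" "\<And>x. x \<in> U \<Longrightarrow> \<psi> x = \<phi> x"
  shows "smooth_fun E U \<psi>"
proof -
  let ?P = "\<lambda>\<psi>. \<exists>\<phi>. smooth_fun E U \<phi> \<and> (\<forall>x\<in>U. \<psi> x = \<phi> x)"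
  show ?thesis
  proof (rule smooth_coinduct[where P = ?P])
    show "?P \<psi>" using assms by blast
  next
    fix \<psi> assume "?P \<psi>"
    then obtain \<phi> where \<phi>: "smooth_fun E U \<phi>" "\<And>x. x \<in> U \<Longrightarrow> \<psi> x = \<phi> x" by blast
    show "continuous_on U \<psi>"
      by (rule continuous_on_eq[OF smooth_continuous[OF \<phi>(1)]]) (simp add: \<phi>(2))
    fix c assume c: "c \<in> E"
    show "(\<lambda>t. \<psi> (x(c := t))) differentiable (at (x c))" if "x \<in> U" for x
      by (rule differentiable_cong_ev[OF _ smooth_differentiable[OF \<phi>(1) c that]])
         (rule eventually_mono[OF eventually_line[OF assms(2) that] \<phi>(2)])
    have "\<forall>x\<in>U. pdiff c \<psi> x = pdiff c \<phi> x" using pdiff_cong[OF assms(2)] \<phi>(2) by blast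
    then show "\<exists>\<eta>. ?P \<eta> \<and> (\<forall>x\<in>U. pdiff c \<psi> x = \<eta> x)"
      using smooth_pdiff[OF \<phi>(1) c] by blast
  qed (rule assms(2))
qed

section \<open>Differentiation rules and closure properties of smooth functions\<close>

lemma pdiff_add:
  assumes "smooth_fun E U \<phi>" "smooth_fun E U \<psi>" "c \<in> E" "x \<in> U"
  shows "pdiff c (\<lambda>y. \<phi> y + \<psi> y) x = pdiff c \<phi> x + pdiff c \<psi> x"
  unfolding pdiff_def[of c "\<lambda>y. \<phi> y + \<psi> y"]
  by (rule DERIV_imp_deriv, rule DERIV_add) (rule smooth_DERIV[OF _ assms(3,4)] assms)+

lemma pdiff_cmult:
  assumes "smooth_fun E U \<phi>" "c \<in> E" "x \<in> U"
  shows "pdiff c (\<lambda>y. k * \<phi> y) x = k * pdiff c \<phi> x"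
  unfolding pdiff_def[of c "\<lambda>y. k * \<phi> y"]
  by (rule DERIV_imp_deriv, rule DERIV_cmult) (rule smooth_DERIV[OF _ assms(2,3)] assms)+

lemma pdiff_coord_mult:
  assumes "smooth_fun E U \<phi>" "c \<in> E" "x \<in> U"
  shows "pdiff c (\<lambda>y. y d * \<phi> y) x = (if c = d then \<phi> x else 0) + x d * pdiff c \<phi> x"
proof (cases "c = d")
  case True
  have "((\<lambda>t. t * \<phi> (x(c := t))) has_real_derivative (1 * \<phi> (x(c := x c)) + pdiff c \<phi> x * x c)) (at (x c))"
    by (rule DERIV_mult[OF DERIV_ident smooth_DERIV[OF assms]])
  from DERIV_imp_deriv[OF this] show ?thesis unfolding True
    by (simp add: pdiff_def[of d "\<lambda>y. y d * \<phi> y"] mult.commute)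
next
  case False
  then show ?thesis using pdiff_cmult[OF assms, of "x d"]
    by (simp add: pdiff_def)
qed

lemma smooth_const: "open U \<Longrightarrow> smooth_fun E U (\<lambda>_. k)"
proof -
  assume U: "open U"
  show ?thesis
    by (rule smooth_coinduct[where P = "\<lambda>\<phi>. \<exists>l. \<phi> = (\<lambda>_. l)"])
       (use U in \<open>auto simp: pdiff_def\<close>)
qed

lemma smooth_add:
  assumes "smooth_fun E U \<phi>" "smooth_fun E U \<psi>" "open U"
  shows "smooth_fun E U (\<lambda>x. \<phi> x + \<psi> x)"
proof -
  let ?P = "\<lambda>\<eta>. \<exists>\<phi> \<psi>. smooth_fun E U \<phi> \<and> smooth_fun E U \<psi> \<and> \<eta> = (\<lambda>x. \<phi> x + \<psi> x)"
  show ?thesis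
  proof (rule smooth_coinduct[where P = ?P])
    fix \<eta> assume "?P \<eta>"
    then obtain \<phi> \<psi> where h: "smooth_fun E U \<phi>" "smooth_fun E U \<psi>" "\<eta> = (\<lambda>x. \<phi> x + \<psi> x)" by blast
    show "continuous_on U \<eta>"
      unfolding h(3) using h(1,2)[THEN smooth_continuous] by (rule continuous_on_add)
    fix c assume c: "c \<in> E"
    show "(\<lambda>t. \<eta> (x(c := t))) differentiable (at (x c))" if "x \<in> U" for x
      using h smooth_differentiable[OF _ c that] by auto
    show "\<exists>\<xi>. ?P \<xi> \<and> (\<forall>x\<in>U. pdiff c \<eta> x = \<xi> x)"
      using h c by (intro exI[of _ "\<lambda>x. pdiff c \<phi> x + pdiff c \<psi> x"]) (auto intro: smooth_pdiff simp: pdiff_add)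
  qed (use assms in auto)
qed

lemma smooth_cmult:
  assumes "smooth_fun E U \<phi>" "open U"
  shows "smooth_fun E U (\<lambda>x. k * \<phi> x)"
proof -
  let ?P = "\<lambda>\<eta>. \<exists>\<phi>. smooth_fun E U \<phi> \<and> \<eta> = (\<lambda>x. k * \<phi> x)"
  show ?thesis
  proof (rule smooth_coinduct[where P = ?P])
    fix \<eta> assume "?P \<eta>"
    then obtain \<phi> where h: "smooth_fun E U \<phi>" "\<eta> = (\<lambda>x. k * \<phi> x)" by blast
    show "continuous_on U \<eta>"
      unfolding h(2) using h(1)[THEN smooth_continuous] by (rule continuous_on_mult_left)
    fix c assume c: "c \<in> E"
    show "(\<lambda>t. \<eta> (x(c := t))) differentiable (at (x c))" if "x \<in> U" for x
      using h smooth_differentiable[OF _ c that] by auto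
    show "\<exists>\<xi>. ?P \<xi> \<and> (\<forall>x\<in>U. pdiff c \<eta> x = \<xi> x)"
      using h c by (intro exI[of _ "\<lambda>x. k * pdiff c \<phi> x"]) (auto intro: smooth_pdiff simp: pdiff_cmult)
  qed (use assms in auto)
qed

text \<open>Functions of the form \<open>x d * \<phi> x\<close> are not stable under derivatives,
  since the product rule leaves an extra summand. The class \<open>x d * \<phi> x + \<psi> x\<close>
  absorbs it.\<close>

lemma smooth_coord_mult:
  assumes "smooth_fun E U \<phi>" "open U"
  shows "smooth_fun E U (\<lambda>x. x d * \<phi> x)"
proof -
  let ?P = "\<lambda>\<eta>. \<exists>\<phi> \<psi>. smooth_fun E U \<phi> \<and> smooth_fun E U \<psi> \<and> \<eta> = (\<lambda>x. x d * \<phi> x + \<psi> x)"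
  show ?thesis
  proof (rule smooth_coinduct[where P = ?P])
    show "?P (\<lambda>x. x d * \<phi> x)"
      using assms smooth_const[OF assms(2), of E 0] by (intro exI[of _ \<phi>] exI[of _ "\<lambda>_. 0"]) auto
  next
    fix \<eta> assume "?P \<eta>"
    then obtain \<phi> \<psi> where h: "smooth_fun E U \<phi>" "smooth_fun E U \<psi>" "\<eta> = (\<lambda>x. x d * \<phi> x + \<psi> x)" by blast
    have "continuous_on U (\<lambda>x::coord \<Rightarrow> real. x d)"
      by (rule continuous_on_subset[OF continuous_on_product_coordinates]) simp
    then show "continuous_on U \<eta>"
      unfolding h(3) using h(1,2)[THEN smooth_continuous] by (intro continuous_on_add continuous_on_mult)
    fix c assume c: "c \<in> E"
    have hd: "(\<lambda>t. (x(c := t)) d * \<phi> (x(c := t))) differentiable (at (x c))" if "x \<in> U" for x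
      using smooth_differentiable[OF h(1) c that] by (cases "c = d") (auto intro!: differentiable_mult)
    show "(\<lambda>t. \<eta> (x(c := t))) differentiable (at (x c))" if "x \<in> U" for x
      unfolding h(3) by (intro differentiable_add hd smooth_differentiable[OF h(2) c] that)
    have "pdiff c \<eta> x = x d * pdiff c \<phi> x + ((if c = d then \<phi> x else 0) + pdiff c \<psi> x)" if "x \<in> U" for x
    proof -
      have "pdiff c \<eta> x = pdiff c (\<lambda>x. x d * \<phi> x) x + pdiff c \<psi> x"
        unfolding h(3) pdiff_def[of c "\<lambda>x. x d * \<phi> x + \<psi> x"]
        by (rule DERIV_imp_deriv, rule DERIV_add)
           (use hd[OF that] smooth_DERIV[OF h(2) c that] in \<open>auto simp: pdiff_def DERIV_deriv_iff_real_differentiable\<close>)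
      then show ?thesis using pdiff_coord_mult[OF h(1) c that, of d] by simp
    qed
    moreover have "smooth_fun E U (\<lambda>x. (if c = d then \<phi> x else 0) + pdiff c \<psi> x)"
      using smooth_add[OF h(1) smooth_pdiff[OF h(2) c] assms(2)] smooth_pdiff[OF h(2) c] by (cases "c = d") auto
    ultimately show "\<exists>\<xi>. ?P \<xi> \<and> (\<forall>x\<in>U. pdiff c \<eta> x = \<xi> x)"
      using smooth_pdiff[OF h(1) c]
      by (intro exI[of _ "\<lambda>x. x d * pdiff c \<phi> x + ((if c = d then \<phi> x else 0) + pdiff c \<psi> x)"]) blast
  qed (rule assms(2))
qed

text \<open>Derivatives in directions on which \<phi> does not depend are zero. Hence smoothness in
  the even coordinates of one coordinate set implies smoothness in all even coordinates, and
  superfunctions of different coordinate sets can be combined freely.\<close>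

lemma smooth_extend:
  assumes "smooth_fun E U \<phi>" "open U"
    and dep: "\<And>x y. (\<And>c. c \<in> E \<Longrightarrow> x c = y c) \<Longrightarrow> \<phi> x = \<phi> y"
  shows "smooth_fun E' U \<phi>"
proof (rule smooth_coinduct[where P = "\<lambda>\<phi>. smooth_fun E U \<phi> \<and> (\<forall>x y. (\<forall>c\<in>E. x c = y c) \<longrightarrow> \<phi> x = \<phi> y)"])
  fix \<psi> c
  assume \<psi>: "smooth_fun E U \<psi> \<and> (\<forall>x y. (\<forall>c\<in>E. x c = y c) \<longrightarrow> \<psi> x = \<psi> y)"
  have off: "(\<lambda>t. \<psi> (x(c := t))) = (\<lambda>t. \<psi> x)" if "c \<notin> E" for x
    using \<psi> that by (metis fun_upd_other)
  show "continuous_on U \<psi>" using \<psi> smooth_continuous by blast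
  show "(\<lambda>t. \<psi> (x(c := t))) differentiable (at (x c))" if "x \<in> U" for x
    using \<psi> that off smooth_differentiable by (cases "c \<in> E") (blast, simp)
  show "\<exists>\<eta>. (smooth_fun E U \<eta> \<and> (\<forall>x y. (\<forall>c\<in>E. x c = y c) \<longrightarrow> \<eta> x = \<eta> y)) \<and> (\<forall>x\<in>U. pdiff c \<psi> x = \<eta> x)"
  proof (cases "c \<in> E")
    case True
    have "pdiff c \<psi> x = pdiff c \<psi> y" if "\<forall>c\<in>E. x c = y c" for x y
    proof -
      have "(\<lambda>t. \<psi> (x(c := t))) = (\<lambda>t. \<psi> (y(c := t)))" using \<psi> that by fastforce
      then show ?thesis using that True by (simp add: pdiff_def)
    qed
    then show ?thesis using True \<psi> smooth_pdiff by blast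
  next
    case False
    then show ?thesis using smooth_const[OF assms(2), of E 0]
      by (intro exI[of _ "\<lambda>_. 0"]) (simp add: pdiff_def off)
  qed
next
  show "smooth_fun E U \<phi> \<and> (\<forall>x y. (\<forall>c\<in>E. x c = y c) \<longrightarrow> \<phi> x = \<phi> y)"
    using assms(1) dep by blast
qed (rule assms(2))

subsection \<open>Symmetry of second derivatives\<close>

lemma continuous_on_fun_upd2:
  "continuous_on UNIV (\<lambda>z. (x::'c \<Rightarrow> 'b::topological_space)(c := fst z, d := snd z))"
proof (rule continuous_on_coordinatewise_then_product)
  fix i
  show "continuous_on UNIV (\<lambda>z. (x(c := fst z, d := snd z)) i)"
    by (cases "i = d"; cases "i = c") (auto intro: continuous_intros)
qed

text \<open>The second difference is symmetric in \<open>c\<close> and \<open>d\<close>. The mean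
  value theorem, applied first along \<open>c\<close> and then along \<open>d\<close>, identifies
  the quotient with the mixed derivative at an intermediate point, and continuity of that derivative
  gives the limit. Exchanging \<open>c\<close> and \<open>d\<close> then yields
  \<open>pdiff_commute\<close>.\<close>

lemma second_difference_tendsto:
  assumes \<phi>: "smooth_fun E U \<phi>" and "open U" "c \<in> E" "d \<in> E" "c \<noteq> d" "x \<in> U"
  shows "((\<lambda>h. (\<phi> (x(c := x c + h, d := x d + h)) - \<phi> (x(c := x c + h, d := x d))
      - \<phi> (x(c := x c, d := x d + h)) + \<phi> (x(c := x c, d := x d))) / (h * h))
      \<longlongrightarrow> pdiff d (pdiff c \<phi>) x) (at_right 0)"
proof (rule tendstoI)
  fix \<epsilon> :: real assume \<epsilon>: "0 < \<epsilon>"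
  \<comment> \<open>The plane through \<open>x\<close> in the directions \<open>c\<close> and
    \<open>d\<close>; continuity in the product topology is needed only on this plane.\<close>
  define G where "G = (\<lambda>z. x(c := fst z, d := snd z))"
  define \<psi> where "\<psi> = pdiff d (pdiff c \<phi>)"
  define S where "S = G -` U"
  have Gx: "G (x c, x d) = x" by (auto simp: G_def)
  have contG: "continuous_on UNIV G" unfolding G_def by (rule continuous_on_fun_upd2)
  have "open S" unfolding S_def by (rule open_vimage[OF \<open>open U\<close> contG])
  have "smooth_fun E U \<psi>" unfolding \<psi>_def using assms by (blast intro: smooth_pdiff)
  then have "continuous_on S (\<lambda>z. \<psi> (G z))"
    by (intro continuous_on_compose2[OF smooth_continuous continuous_on_subset[OF contG]]) (auto simp: S_def)
  then have "open (S \<inter> (\<lambda>z. \<psi> (G z)) -` ball (\<psi> x) \<epsilon>)"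
    using \<open>open S\<close> by (auto simp: continuous_on_open_vimage Int_commute)
  moreover have "(x c, x d) \<in> S \<inter> (\<lambda>z. \<psi> (G z)) -` ball (\<psi> x) \<epsilon>"
    using \<epsilon> assms Gx by (auto simp: S_def)
  ultimately obtain A B where AB: "open A" "open B" "x c \<in> A" "x d \<in> B"
    "A \<times> B \<subseteq> S \<inter> (\<lambda>z. \<psi> (G z)) -` ball (\<psi> x) \<epsilon>"
    by (elim open_prod_elim) auto
  obtain \<delta> where \<delta>: "\<delta> > 0" "\<And>s. dist s (x c) < \<delta> \<Longrightarrow> s \<in> A" "\<And>t. dist t (x d) < \<delta> \<Longrightarrow> t \<in> B"
  proof -
    obtain e1 e2 where "e1 > 0" "\<And>s. dist s (x c) < e1 \<Longrightarrow> s \<in> A" "e2 > 0" "\<And>s. dist s (x d) < e2 \<Longrightarrow> s \<in> B"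
      using AB(1-4) by (meson open_dist)
    then show ?thesis using that[of "min e1 e2"] by auto
  qed
  have in_AB: "G (s, t) \<in> U \<and> dist (\<psi> (G (s, t))) (\<psi> x) < \<epsilon>"
    if "dist s (x c) < \<delta>" "dist t (x d) < \<delta>" for s t
    using AB(5) \<delta>(2)[OF that(1)] \<delta>(3)[OF that(2)] by (auto simp: S_def dist_commute)
  have "dist ((\<phi> (G (x c + h, x d + h)) - \<phi> (G (x c + h, x d)) - \<phi> (G (x c, x d + h)) + \<phi> (G (x c, x d))) / (h * h)) (\<psi> x) < \<epsilon>"
    if h: "0 < h" "h < \<delta>" for h
  proof -
    have D1: "((\<lambda>s. \<phi> (G (s, t))) has_real_derivative pdiff c \<phi> (G (s, t))) (at s)"
      if "x c \<le> s" "s \<le> x c + h" "x d \<le> t" "t \<le> x d + h" for s t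
    proof -
      have "G (s, t) \<in> U" using in_AB[of s t] that h by (auto simp: dist_real_def)
      from smooth_DERIV[OF \<phi> \<open>c \<in> E\<close> this] show ?thesis
        using \<open>c \<noteq> d\<close> by (simp add: G_def fun_upd_twist)
    qed
    have D2: "((\<lambda>t. pdiff c \<phi> (G (s, t))) has_real_derivative \<psi> (G (s, t))) (at t)"
      if "x c \<le> s" "s \<le> x c + h" "x d \<le> t" "t \<le> x d + h" for s t
    proof -
      have "G (s, t) \<in> U" using in_AB[of s t] that h by (auto simp: dist_real_def)
      from smooth_DERIV[OF smooth_pdiff[OF \<phi> \<open>c \<in> E\<close>] \<open>d \<in> E\<close> this] show ?thesis
        by (simp add: G_def \<psi>_def)
    qed
    obtain s where s: "x c < s" "s < x c + h"
      "(\<phi> (G (x c + h, x d + h)) - \<phi> (G (x c + h, x d))) - (\<phi> (G (x c, x d + h)) - \<phi> (G (x c, x d)))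
       = (x c + h - x c) * (pdiff c \<phi> (G (s, x d + h)) - pdiff c \<phi> (G (s, x d)))"
    proof -
      have "\<exists>s>x c. s < x c + h \<and>
        (\<phi> (G (x c + h, x d + h)) - \<phi> (G (x c + h, x d))) - (\<phi> (G (x c, x d + h)) - \<phi> (G (x c, x d)))
        = (x c + h - x c) * (pdiff c \<phi> (G (s, x d + h)) - pdiff c \<phi> (G (s, x d)))"
        by (rule MVT2, use h in simp, rule DERIV_diff; rule D1) (use h in auto)
      then show thesis using that by blast
    qed
    obtain t where t: "x d < t" "t < x d + h"
      "pdiff c \<phi> (G (s, x d + h)) - pdiff c \<phi> (G (s, x d)) = (x d + h - x d) * \<psi> (G (s, t))"
    proof -
      have "\<exists>t>x d. t < x d + h \<and>
        pdiff c \<phi> (G (s, x d + h)) - pdiff c \<phi> (G (s, x d)) = (x d + h - x d) * \<psi> (G (s, t))"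
        by (rule MVT2, use h in simp, rule D2) (use h s in auto)
      then show thesis using that by blast
    qed
    have "(\<phi> (G (x c + h, x d + h)) - \<phi> (G (x c + h, x d)) - \<phi> (G (x c, x d + h)) + \<phi> (G (x c, x d))) / (h * h) = \<psi> (G (s, t))"
      using s(3) t(3) h by (simp add: field_simps)
    moreover have "dist (\<psi> (G (s, t))) (\<psi> x) < \<epsilon>"
      using in_AB[of s t] s t h by (auto simp: dist_real_def)
    ultimately show ?thesis by simp
  qed
  then show "\<forall>\<^sub>F h in at_right 0. dist ((\<phi> (x(c := x c + h, d := x d + h)) - \<phi> (x(c := x c + h, d := x d))
      - \<phi> (x(c := x c, d := x d + h)) + \<phi> (x(c := x c, d := x d))) / (h * h)) (pdiff d (pdiff c \<phi>) x) < \<epsilon>"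
    unfolding eventually_at_right_field using \<delta>(1) by (auto simp: G_def \<psi>_def)
qed

lemma pdiff_commute:
  assumes \<phi>: "smooth_fun E U \<phi>" and "open U" "c \<in> E" "d \<in> E" "x \<in> U"
  shows "pdiff c (pdiff d \<phi>) x = pdiff d (pdiff c \<phi>) x"
proof (cases "c = d")
  case False
  show ?thesis
    using second_difference_tendsto[OF \<phi> assms(2-4) False assms(5)]
    by (rule tendsto_unique[rotated 2])
       (use second_difference_tendsto[OF \<phi> assms(2,4,3) not_sym[OF False] assms(5)] False
         in \<open>simp_all add: fun_upd_twist algebra_simps\<close>)
qed simp

section \<open>The domain of mixed forms\<close>

text \<open>The unit sphere of the maximum norm on \<open>q\<close>-tuples. Tuples are extended by
  zero beyond \<open>q\<close>, which makes the sphere a closed part of a product of compact sets,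
  so that Tychonoff's theorem applies.\<close>

lemma compact_sup_sphere:
  "compact {v :: nat \<Rightarrow> real. (\<forall>j. v j \<in> (if j < q then {-1..1} else {0})) \<and> (\<exists>j<q. \<bar>v j\<bar> = 1)}"
proof -
  let ?C = "\<lambda>j. if j < q then {-1..1} else {0::real}"
  have "compactin (product_topology (\<lambda>_::nat. euclidean :: real topology) UNIV) (PiE UNIV ?C)"
    unfolding compactin_PiE by auto
  then have "compact (PiE UNIV ?C)" by (simp add: euclidean_product_topology)
  moreover have "closed (\<Union>j\<in>{..<q}. {v::nat \<Rightarrow> real. \<bar>v j\<bar> = 1})"
  proof (rule closed_UN)
    show "\<forall>j\<in>{..<q}. closed {v::nat \<Rightarrow> real. \<bar>v j\<bar> = 1}"
    proof
      fix j
      have "continuous_on UNIV (\<lambda>v::nat \<Rightarrow> real. \<bar>v j\<bar>)"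
        by (intro continuous_intros continuous_on_product_coordinates)
      then show "closed {v::nat \<Rightarrow> real. \<bar>v j\<bar> = 1}"
        by (rule closed_Collect_eq) simp
    qed
  qed simp
  ultimately have "compact (PiE UNIV ?C \<inter> (\<Union>j\<in>{..<q}. {v::nat \<Rightarrow> real. \<bar>v j\<bar> = 1}))"
    by (rule compact_Int_closed)
  moreover have "PiE UNIV ?C \<inter> (\<Union>j\<in>{..<q}. {v::nat \<Rightarrow> real. \<bar>v j\<bar> = 1})
      = {v. (\<forall>j. v j \<in> ?C j) \<and> (\<exists>j<q. \<bar>v j\<bar> = 1)}"
    by (auto simp: PiE_def Pi_def)
  ultimately show ?thesis by simp
qed

lemma sup_sphere_normalize:
  fixes v :: "nat \<Rightarrow> real"
  assumes "j < q" "v j \<noteq> 0"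
  obtains k where "k \<noteq> 0" "(\<forall>j. (if j < q then v j * k else 0) \<in> (if j < q then {-1..1} else {0}))"
    "\<exists>j<q. \<bar>v j * k\<bar> = 1"
proof -
  define M where "M = Max ((\<lambda>j. \<bar>v j\<bar>) ` {..<q})"
  have le: "\<bar>v i\<bar> \<le> M" if "i < q" for i unfolding M_def using that by auto
  have "M \<in> (\<lambda>j. \<bar>v j\<bar>) ` {..<q}" unfolding M_def using assms(1) by (intro Max_in) auto
  then obtain i where i: "i < q" "M = \<bar>v i\<bar>" by auto
  have M: "M > 0" using le[OF assms(1)] assms(2) by linarith
  have "\<bar>v l * inverse M\<bar> \<le> 1" if "l < q" for l
    using le[OF that] M by (simp add: abs_mult field_simps)
  then have "\<forall>l. (if l < q then v l * inverse M else 0) \<in> (if l < q then {-1..1} else {0})"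
    by (auto simp: abs_le_iff)
  moreover have "\<bar>v i * inverse M\<bar> = 1" using i M by (simp add: abs_mult)
  ultimately show ?thesis using that[of "inverse M"] i M by auto
qed

text \<open>Injectivity means that the sum of the absolute values of the rows has a positive minimum
  on the compact sphere. Changing finitely many entries by less than some \<delta> cannot bring it
  down to zero.\<close>

lemma open_injective_family:
  fixes A :: "'t::topological_space \<Rightarrow> 'r \<Rightarrow> nat \<Rightarrow> real"
  assumes R: "finite R" and cont: "\<And>a j. continuous_on UNIV (\<lambda>x. A x a j)"
  shows "open {x. \<forall>v. (\<forall>a\<in>R. (\<Sum>j<q. A x a j * v j) = 0) \<longrightarrow> (\<forall>j<q. v j = 0)}" (is "open ?G")
proof (subst open_subopen, rule ballI)
  fix x assume x: "x \<in> ?G"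
  define S where "S = {v :: nat \<Rightarrow> real. (\<forall>j. v j \<in> (if j < q then {-1..1} else {0})) \<and> (\<exists>j<q. \<bar>v j\<bar> = 1)}"
  define f where "f = (\<lambda>x v. \<Sum>a\<in>R. \<bar>\<Sum>j<q. A x a j * v j\<bar>)"
  have S_good: "x \<in> ?G" if "\<And>v. v \<in> S \<Longrightarrow> f x v > 0" for x
  proof (clarsimp, rule ccontr)
    fix v j assume v: "\<forall>a\<in>R. (\<Sum>j<q. A x a j * v j) = 0" "j < q" "v j \<noteq> 0"
    obtain k where k: "k \<noteq> 0" "(\<forall>j. (if j < q then v j * k else 0) \<in> (if j < q then {-1..1} else {0}))"
      "\<exists>j<q. \<bar>v j * k\<bar> = 1"
      using sup_sphere_normalize[of j q v] v by blast
    let ?w = "\<lambda>j. if j < q then v j * k else 0"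
    have "?w \<in> S" using k unfolding S_def by auto
    moreover have "(\<Sum>j<q. A x a j * ?w j) = k * (\<Sum>j<q. A x a j * v j)" for a
      by (simp add: sum_distrib_left mult_ac)
    then have "f x ?w = 0" using v(1) by (simp add: f_def)
    ultimately show False using that by fastforce
  qed
  show "\<exists>T. open T \<and> x \<in> T \<and> T \<subseteq> ?G"
  proof (cases "S = {}")
    \<comment> \<open>\<open>S\<close> is empty only for \<open>q = 0\<close>, where the condition
      is void.\<close>
    case True
    then show ?thesis using S_good by (intro exI[of _ UNIV]) auto
  next
    case False
    have "continuous_on S (f x)" unfolding f_def
      by (intro continuous_intros continuous_on_subset[OF continuous_on_product_coordinates]) auto
    then obtain v0 where v0: "v0 \<in> S" "\<And>v. v \<in> S \<Longrightarrow> f x v0 \<le> f x v"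
      using continuous_attains_inf[OF compact_sup_sphere[of q, folded S_def] False] by blast
    have pos: "f x v0 > 0"
    proof (rule ccontr)
      assume "\<not> f x v0 > 0"
      moreover have "f x v0 \<ge> 0" unfolding f_def by (rule sum_nonneg) simp
      ultimately have "f x v0 = 0" by linarith
      then have "(\<Sum>a\<in>R. \<bar>\<Sum>j<q. A x a j * v0 j\<bar>) = 0" by (simp add: f_def)
      then have "\<forall>a\<in>R. (\<Sum>j<q. A x a j * v0 j) = 0" using R by (simp add: sum_nonneg_eq_0_iff)
      then have "\<forall>j<q. v0 j = 0" using x by blast
      then show False using v0(1) by (auto simp: S_def)
    qed
    \<comment> \<open>Changing every entry by less than \<delta> changes \<open>f\<close> by at most
      \<open>card R * q * \<delta>\<close> on the sphere, which has to stay below the minimum. The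
      summand 1 keeps the denominator positive if \<open>R\<close> is empty.\<close>
    define \<delta> where "\<delta> = f x v0 / (real (card R) * real q + 1)"
    have \<delta>: "\<delta> > 0" unfolding \<delta>_def using pos by (intro divide_pos_pos) (auto intro: add_nonneg_pos)
    have \<delta>': "real (card R) * real q * \<delta> < f x v0"
    proof -
      have "0 \<le> real (card R) * real q" by simp
      then have "real (card R) * real q * f x v0 < f x v0 * (real (card R) * real q + 1)"
        "0 < real (card R) * real q + 1"
        using pos by (simp add: algebra_simps, linarith)
      then show ?thesis unfolding \<delta>_def by (simp add: pos_divide_less_eq)
    qed
    define N where "N = (\<Inter>a\<in>R. \<Inter>j\<in>{..<q}. {y. \<bar>A y a j - A x a j\<bar> < \<delta>})"
    have "open N" unfolding N_def
      by (intro open_INT ballI open_Collect_less continuous_intros cont) (use R in auto)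
    moreover have "x \<in> N" using \<delta> by (auto simp: N_def)
    moreover have "y \<in> ?G" if "y \<in> N" for y
    proof (rule S_good)
      fix v assume v: "v \<in> S"
      have vle: "\<bar>v j\<bar> \<le> 1" for j
        using v unfolding S_def by (auto simp: abs_le_iff split: if_splits dest!: spec[of _ j])
      have "\<bar>\<Sum>j<q. A x a j * v j\<bar> \<le> \<bar>\<Sum>j<q. A y a j * v j\<bar> + real q * \<delta>" if "a \<in> R" for a
      proof -
        have "(\<Sum>j<q. A x a j * v j) = (\<Sum>j<q. A y a j * v j) - (\<Sum>j<q. (A y a j - A x a j) * v j)"
          by (simp add: sum_subtractf[symmetric] algebra_simps)
        moreover have "\<bar>\<Sum>j<q. (A y a j - A x a j) * v j\<bar> \<le> (\<Sum>j<q. \<delta>)"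
        proof (rule order_trans[OF sum_abs sum_mono])
          fix j assume "j \<in> {..<q}"
          then have "\<bar>A y a j - A x a j\<bar> \<le> \<delta>" using \<open>y \<in> N\<close> \<open>a \<in> R\<close> by (auto simp: N_def less_imp_le)
          then show "\<bar>(A y a j - A x a j) * v j\<bar> \<le> \<delta>"
            using mult_mono[of "\<bar>A y a j - A x a j\<bar>" \<delta> "\<bar>v j\<bar>" 1] vle[of j] \<delta> by (simp add: abs_mult)
        qed
        ultimately show ?thesis by simp
      qed
      then have "f x v \<le> (\<Sum>a\<in>R. \<bar>\<Sum>j<q. A y a j * v j\<bar> + real q * \<delta>)"
        unfolding f_def by (rule sum_mono)
      then have "f x v \<le> f y v + real (card R) * real q * \<delta>"
        by (simp add: f_def sum.distrib)
      then show "f y v > 0" using v0(2)[OF v] \<delta>' by linarith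
    qed
    ultimately show ?thesis by blast
  qed
qed

text \<open>Both rank conditions say that a matrix depending continuously on \<open>x\<close> is
  injective: the odd-odd block of p over w for the columns, and the transposed odd-odd block of w
  for the rows.\<close>

lemma open_form_dom: "open (form_dom m q s)"
proof -
  let ?A = "\<lambda>(x :: coord \<Rightarrow> real) a j. x ((case a of Inl i \<Rightarrow> Pc (Odd i) | Inr i \<Rightarrow> Wc (Odd i)) (Odd j))"
  let ?B = "\<lambda>(x :: coord \<Rightarrow> real) j i. x (Wc (Odd i) (Odd j))"
  have 1: "open {x. \<forall>v. (\<forall>a\<in>Inl ` {..<m} \<union> Inr ` {..<s}. (\<Sum>j<q. ?A x a j * v j) = 0) \<longrightarrow> (\<forall>j<q. v j = 0)}"
    by (rule open_injective_family) (auto intro: continuous_on_product_coordinates)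
  have 2: "open {x. \<forall>v. (\<forall>j\<in>{..<q}. (\<Sum>i<s. ?B x j i * v i) = 0) \<longrightarrow> (\<forall>i<s. v i = 0)}"
    by (rule open_injective_family) (auto intro: continuous_on_product_coordinates)
  show ?thesis
    by (rule back_subst[of "open", OF open_Int[OF 1 2]])
       (auto simp: form_dom_def ball_Un lessThan_def mult.commute)
qed

text \<open>Since only odd-odd entries occur, a line along any other coordinate stays in the domain,
  and adding an even row or an even column leaves the domain unchanged. The operators and \<sigma>
  thus all act over the same \<open>form_dom m q s\<close>.\<close>

lemma form_dom_cong:
  assumes 1: "\<And>a j. a < m \<Longrightarrow> j < q \<Longrightarrow> x (Pc (Odd a) (Odd j)) = y (Pc (Odd a) (Odd j))"
    and 2: "\<And>a j. a < s \<Longrightarrow> j < q \<Longrightarrow> x (Wc (Odd a) (Odd j)) = y (Wc (Odd a) (Odd j))"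
  shows "x \<in> form_dom m q s \<longleftrightarrow> y \<in> form_dom m q s"
proof -
  have e1: "(\<Sum>j<q. x (Pc (Odd a) (Odd j)) * c j) = (\<Sum>j<q. y (Pc (Odd a) (Odd j)) * c j)" if "a < m" for a c
    using that 1 by (intro sum.cong) auto
  have e2: "(\<Sum>j<q. x (Wc (Odd a) (Odd j)) * c j) = (\<Sum>j<q. y (Wc (Odd a) (Odd j)) * c j)" if "a < s" for a c
    using that 2 by (intro sum.cong) auto
  have e3: "(\<Sum>i<s. d i * x (Wc (Odd i) (Odd j))) = (\<Sum>i<s. d i * y (Wc (Odd i) (Odd j)))" if "j < q" for j d
    using that 2 by (intro sum.cong) auto
  show ?thesis unfolding form_dom_def by (simp add: e1 e2 e3)
qed

section \<open>Smooth superfunctions\<close>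

lemma cpar_cases: "cpar c = 0 \<or> cpar c = 1" by (cases c) auto
lemma cpar_nz [simp]: "0 < cpar c \<longleftrightarrow> cpar c = Suc 0" "cpar c \<noteq> Suc 0 \<longleftrightarrow> cpar c = 0"
  using cpar_cases[of c] by auto

text \<open>Weaker than membership in \<open>sfuns\<close>: no coordinate set is fixed and no values
  outside \<open>U\<close> are prescribed, so that derivatives and products with further coordinates
  stay in the class. The bound \<open>G\<close> is uniform in \<open>x\<close>; this is what makes
  the coefficientwise derivative an element of the Grassmann algebra.\<close>

definition smooth_sfun :: "(coord \<Rightarrow> real) set \<Rightarrow> sfun \<Rightarrow> bool" where
  "smooth_sfun U f \<longleftrightarrow> (\<exists>G. finite G \<and> (\<forall>x I. gcoeff (f x) I \<noteq> 0 \<longrightarrow> I \<subseteq> G)) \<and>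
     (\<forall>I. smooth_fun {c. cpar c = 0} U (\<lambda>x. gcoeff (f x) I))"

lemma smooth_sfun_coeff: "smooth_sfun U f \<Longrightarrow> smooth_fun {c. cpar c = 0} U (\<lambda>x. gcoeff (f x) I)"
  by (simp add: smooth_sfun_def)

text \<open>\<open>Grass\<close> is meaningful only on families of finite support. A coefficient at
  a set not contained in \<open>G\<close> is identically zero, hence so is its derivative, and
  finitely many coefficients remain.\<close>

lemma gcoeff_sderiv:
  assumes "smooth_sfun U f" "cpar c = 0"
  shows "gcoeff (sderiv c f x) I = pdiff c (\<lambda>y. gcoeff (f y) I) x"
proof -
  obtain G where G: "finite G" "\<And>x I. gcoeff (f x) I \<noteq> 0 \<Longrightarrow> I \<subseteq> G"
    using assms(1) by (auto simp: smooth_sfun_def)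
  have sub: "I \<subseteq> G" if "pdiff c (\<lambda>y. gcoeff (f y) I) x \<noteq> 0" for I
  proof (rule ccontr)
    assume "\<not> I \<subseteq> G"
    then have "(\<lambda>y. gcoeff (f y) I) = (\<lambda>_. 0)" using G(2) by blast
    then show False using that by (simp add: pdiff_def)
  qed
  have "finite {I. pdiff c (\<lambda>y. gcoeff (f y) I) x \<noteq> 0}"
    by (rule finite_subset[of _ "Pow G"]) (use sub G(1) in auto)
  then show ?thesis using sub finite_subset[OF _ G(1)] assms(2)
    by (simp add: sderiv_def Grass_inverse)
qed

lemma sderiv_odd: "cpar c = 1 \<Longrightarrow> sderiv c f x = gderiv c (f x)"
  by (simp add: sderiv_def)

lemma sderiv_cong:
  assumes "open U" "x \<in> U" "\<And>y. y \<in> U \<Longrightarrow> f y = g y"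
  shows "sderiv c f x = sderiv c g x"
proof -
  have "pdiff c (\<lambda>y. gcoeff (f y) I) x = pdiff c (\<lambda>y. gcoeff (g y) I) x" for I
    by (rule pdiff_cong[OF assms(1,2)]) (simp add: assms(3))
  then show ?thesis using assms by (simp add: sderiv_def)
qed

lemma smooth_sfunI:
  assumes "finite G" "\<And>x I. gcoeff (f x) I \<noteq> 0 \<Longrightarrow> I \<subseteq> G"
    "\<And>I. smooth_fun {c. cpar c = 0} U (\<lambda>x. gcoeff (f x) I)"
  shows "smooth_sfun U f"
  using assms unfolding smooth_sfun_def by blast

lemma smooth_sfunE:
  assumes "smooth_sfun U f"
  obtains G where "finite G" "\<And>x I. gcoeff (f x) I \<noteq> 0 \<Longrightarrow> I \<subseteq> G"
  using assms unfolding smooth_sfun_def by blast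

lemma smooth_sfun_0: "open U \<Longrightarrow> smooth_sfun U (\<lambda>_. 0)"
  by (rule smooth_sfunI[of "{}"]) (auto intro: smooth_const)

lemma smooth_sfun_add:
  assumes "smooth_sfun U f" "smooth_sfun U g" "open U"
  shows "smooth_sfun U (\<lambda>x. f x + g x)"
proof -
  obtain G H where GH: "finite G" "\<And>x I. gcoeff (f x) I \<noteq> 0 \<Longrightarrow> I \<subseteq> G"
    "finite H" "\<And>x I. gcoeff (g x) I \<noteq> 0 \<Longrightarrow> I \<subseteq> H"
    using assms by (meson smooth_sfunE)
  show ?thesis
  proof (rule smooth_sfunI[of "G \<union> H"])
    show "I \<subseteq> G \<union> H" if "gcoeff (f x + g x) I \<noteq> 0" for x I
    proof -
      have "gcoeff (f x) I \<noteq> 0 \<or> gcoeff (g x) I \<noteq> 0" using that by auto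
      then show ?thesis using GH by blast
    qed
  qed (use GH assms smooth_sfun_coeff in \<open>auto intro!: smooth_add\<close>)
qed

lemma smooth_sfun_scaleR:
  assumes "smooth_sfun U f" "open U"
  shows "smooth_sfun U (\<lambda>x. k *\<^sub>R f x)"
proof -
  obtain G where G: "finite G" "\<And>x I. gcoeff (f x) I \<noteq> 0 \<Longrightarrow> I \<subseteq> G" using assms by (meson smooth_sfunE)
  show ?thesis
    by (rule smooth_sfunI[OF G(1)]) (use G assms smooth_sfun_coeff in \<open>auto intro!: smooth_cmult\<close>)
qed

lemma smooth_sfun_diff:
  assumes "smooth_sfun U f" "smooth_sfun U g" "open U"
  shows "smooth_sfun U (\<lambda>x. f x - g x)"
  using smooth_sfun_add[OF assms(1) smooth_sfun_scaleR[OF assms(2,3), of "-1"] assms(3)] by simp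

lemma smooth_sfun_sum:
  "open U \<Longrightarrow> (\<And>i. i \<in> S \<Longrightarrow> smooth_sfun U (f i)) \<Longrightarrow> smooth_sfun U (\<lambda>x. \<Sum>i\<in>S. f i x)"
  by (induction S rule: infinite_finite_induct) (auto intro!: smooth_sfun_0 smooth_sfun_add)

lemma smooth_sfun_cong:
  assumes "smooth_sfun U f" "open U" "\<And>x. x \<in> U \<Longrightarrow> g x = f x" "\<And>x. x \<notin> U \<Longrightarrow> g x = 0"
  shows "smooth_sfun U g"
proof -
  obtain G where G: "finite G" "\<And>x I. gcoeff (f x) I \<noteq> 0 \<Longrightarrow> I \<subseteq> G" using assms by (meson smooth_sfunE)
  show ?thesis
  proof (rule smooth_sfunI[OF G(1)])
    show "I \<subseteq> G" if "gcoeff (g x) I \<noteq> 0" for x I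
      using that G(2) assms(3,4) by (cases "x \<in> U") auto
    show "smooth_fun {c. cpar c = 0} U (\<lambda>x. gcoeff (g x) I)" for I
      by (rule smooth_cong[OF smooth_sfun_coeff[OF assms(1)] assms(2)]) (simp add: assms(3))
  qed
qed

lemma smooth_sfun_restr: "smooth_sfun U f \<Longrightarrow> open U \<Longrightarrow> smooth_sfun U (restr U f)"
  by (rule smooth_sfun_cong) (auto simp: restr_def)

lemma smooth_sfun_sderiv:
  assumes f: "smooth_sfun U f" and U: "open U"
  shows "smooth_sfun U (sderiv c f)"
proof -
  obtain G where G: "finite G" "\<And>x I. gcoeff (f x) I \<noteq> 0 \<Longrightarrow> I \<subseteq> G" using assms by (meson smooth_sfunE)
  show ?thesis
  proof (cases "cpar c = 0")
    case True
    show ?thesis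
    proof (rule smooth_sfunI[OF G(1)])
      fix x I assume "gcoeff (sderiv c f x) I \<noteq> 0"
      then have nz: "pdiff c (\<lambda>y. gcoeff (f y) I) x \<noteq> 0" using gcoeff_sderiv[OF f True] by simp
      show "I \<subseteq> G"
      proof (rule ccontr)
        assume "\<not> I \<subseteq> G"
        then have "(\<lambda>y. gcoeff (f y) I) = (\<lambda>_. 0)" using G(2) by blast
        then show False using nz by (simp add: pdiff_def)
      qed
    next
      show "smooth_fun {c. cpar c = 0} U (\<lambda>x. gcoeff (sderiv c f x) I)" for I
        using smooth_pdiff[OF smooth_sfun_coeff[OF f], of c I] True by (simp add: gcoeff_sderiv[OF f True])
    qed
  next
    case False
    then have c: "cpar c = 1" by simp
    show ?thesis
    proof (rule smooth_sfunI[OF G(1)])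
      show "I \<subseteq> G" if "gcoeff (sderiv c f x) I \<noteq> 0" for x I
        using that G(2)[of x "insert c I"] by (auto simp: sderiv_odd[OF c] gcoeff_gderiv split: if_splits)
      show "smooth_fun {c. cpar c = 0} U (\<lambda>x. gcoeff (sderiv c f x) I)" for I
        using smooth_cmult[OF smooth_sfun_coeff[OF f] U] smooth_const[OF U]
        by (cases "c \<in> I") (auto simp: sderiv_odd[OF c] gcoeff_gderiv)
    qed
  qed
qed

lemma gcoeff_cfun_mult:
  "gcoeff (cfun c x * a) I = (if cpar c = 0 then x c * gcoeff a I
     else if c \<in> I then gsign {c} (I - {c}) * gcoeff a (I - {c}) else 0)"
proof -
  have "of_real k * a = k *\<^sub>R a" for k by (simp add: of_real_def)
  then show ?thesis by (simp add: cfun_def gcoeff_ggen_mult)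
qed

lemma smooth_sfun_cfun_mult:
  assumes f: "smooth_sfun U f" and U: "open U"
  shows "smooth_sfun U (\<lambda>x. cfun c x * f x)"
proof -
  obtain G where G: "finite G" "\<And>x I. gcoeff (f x) I \<noteq> 0 \<Longrightarrow> I \<subseteq> G" using assms by (meson smooth_sfunE)
  show ?thesis
  proof (rule smooth_sfunI[of "insert c G"])
    show "I \<subseteq> insert c G" if "gcoeff (cfun c x * f x) I \<noteq> 0" for x I
    proof (cases "cpar c = 0")
      case True
      then show ?thesis using that G(2)[of x I] by (auto simp: gcoeff_cfun_mult)
    next
      case False
      then have "gcoeff (f x) (I - {c}) \<noteq> 0" using that by (auto simp: gcoeff_cfun_mult split: if_splits)
      then show ?thesis using G(2) by blast
    qed
    show "smooth_fun {c. cpar c = 0} U (\<lambda>x. gcoeff (cfun c x * f x) I)" for I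
      using smooth_coord_mult[OF smooth_sfun_coeff[OF f] U] smooth_cmult[OF smooth_sfun_coeff[OF f] U] smooth_const[OF U]
      by (cases "cpar c = 0"; cases "c \<in> I") (auto simp: gcoeff_cfun_mult)
  qed (use G in simp)
qed

section \<open>Differentiation rules for superfunctions\<close>

lemma sderiv_add:
  assumes "smooth_sfun U f" "smooth_sfun U g" "open U" "x \<in> U"
  shows "sderiv c (\<lambda>y. f y + g y) x = sderiv c f x + sderiv c g x"
proof (cases "cpar c = 0")
  case True
  show ?thesis
    by (rule grass_eqI)
       (use True pdiff_add[OF assms(1,2)[THEN smooth_sfun_coeff], of c x] assms in
         \<open>simp add: gcoeff_sderiv[OF smooth_sfun_add[OF assms(1-3)] True]
            gcoeff_sderiv[OF assms(1) True] gcoeff_sderiv[OF assms(2) True]\<close>)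
qed (simp add: sderiv_odd gderiv_add)

lemma sderiv_scaleR:
  assumes "smooth_sfun U f" "open U" "x \<in> U"
  shows "sderiv c (\<lambda>y. k *\<^sub>R f y) x = k *\<^sub>R sderiv c f x"
proof (cases "cpar c = 0")
  case True
  show ?thesis
    by (rule grass_eqI)
       (use True pdiff_cmult[OF assms(1)[THEN smooth_sfun_coeff], of c x] assms in
         \<open>simp add: gcoeff_sderiv[OF smooth_sfun_scaleR[OF assms(1-2)] True]
            gcoeff_sderiv[OF assms(1) True]\<close>)
qed (simp add: sderiv_odd gderiv_scaleR)

lemma sderiv_diff:
  assumes "smooth_sfun U f" "smooth_sfun U g" "open U" "x \<in> U"
  shows "sderiv c (\<lambda>y. f y - g y) x = sderiv c f x - sderiv c g x"
  using sderiv_add[OF assms(1) smooth_sfun_scaleR[OF assms(2,3), of "-1"] assms(3,4)]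
    sderiv_scaleR[OF assms(2-4), of c "-1"] by simp

lemma sderiv_0: "sderiv c (\<lambda>_. 0) x = 0"
  using gcoeff_sderiv[OF smooth_sfun_0[of UNIV], of c x] by (cases "cpar c = 0") (auto simp: sderiv_odd pdiff_def intro: grass_eqI)

lemma sderiv_sum:
  assumes "open U" "x \<in> U" "\<And>i. i \<in> S \<Longrightarrow> smooth_sfun U (f i)"
  shows "sderiv c (\<lambda>y. \<Sum>i\<in>S. f i y) x = (\<Sum>i\<in>S. sderiv c (f i) x)"
  using assms(3)
proof (induction S rule: infinite_finite_induct)
  case (insert i S)
  have "smooth_sfun U (\<lambda>y. \<Sum>i\<in>S. f i y)" by (rule smooth_sfun_sum[OF assms(1)]) (use insert in simp)
  then show ?case using insert sderiv_add[of U "f i", OF _ _ assms(1,2)] by simp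
qed (simp_all add: sderiv_0)

text \<open>Graded Leibniz rule. For even \<open>c\<close> and odd \<open>d\<close> the
  multiplication only permutes coefficients with constant signs, so it is an instance of linearity;
  for odd \<open>c\<close> the rule is that of \<open>gderiv\<close>.\<close>

lemma sderiv_cfun_mult:
  assumes f: "smooth_sfun U f" and U: "open U" "x \<in> U"
  shows "sderiv c (\<lambda>y. cfun d y * f y) x
    = (if c = d then f x else 0) + (- 1) ^ (cpar c * cpar d) *\<^sub>R (cfun d x * sderiv c f x)"
proof (cases "cpar c = 0")
  case True
  note g = gcoeff_sderiv[OF smooth_sfun_cfun_mult[OF f U(1)] True] gcoeff_sderiv[OF f True]
  show ?thesis
  proof (rule grass_eqI)
    fix I :: "coord set"
    have "pdiff c (\<lambda>y. gcoeff (cfun d y * f y) I) x = (if c = d then gcoeff (f x) I else 0) + gcoeff (cfun d x * sderiv c f x) I"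
    proof (cases "cpar d = 0")
      case T: True
      then show ?thesis
        using pdiff_coord_mult[OF smooth_sfun_coeff[OF f], of c x d I] True U by (simp add: gcoeff_cfun_mult g)
    next
      case False
      then have "c \<noteq> d" using True by auto
      then show ?thesis
        using False pdiff_cmult[OF smooth_sfun_coeff[OF f], of c x "gsign {d} (I - {d})" "I - {d}"] True U
        by (auto simp: gcoeff_cfun_mult g pdiff_def[of c "\<lambda>y. 0"])
    qed
    then show "gcoeff (sderiv c (\<lambda>y. cfun d y * f y) x) I
      = gcoeff ((if c = d then f x else 0) + (- 1) ^ (cpar c * cpar d) *\<^sub>R (cfun d x * sderiv c f x)) I"
      using True by (simp add: g(1))
  qed
next
  case False
  then have c: "cpar c = 1" by simp
  show ?thesis
  proof (cases "cpar d = 0")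
    case True
    then show ?thesis using c by (auto simp: sderiv_odd cfun_def of_real_def gderiv_scaleR)
  next
    case False
    then show ?thesis using c by (simp add: sderiv_odd cfun_def gderiv_ggen_mult)
  qed
qed

text \<open>Two even derivatives commute by symmetry of second derivatives of the coefficients, two
  odd ones anticommute in the Grassmann algebra. An odd derivative selects coefficients with
  constant signs and so commutes with an even one.\<close>

lemma sderiv_commute:
  assumes f: "smooth_sfun U f" and U: "open U" "x \<in> U"
  shows "sderiv c (sderiv d f) x = (- 1) ^ (cpar c * cpar d) *\<^sub>R sderiv d (sderiv c f) x"
proof -
  have mixed: "sderiv c (sderiv d f) x = sderiv d (sderiv c f) x" if "cpar c = 0" "cpar d = 1" for c d
  proof (rule grass_eqI)
    fix I :: "coord set"
    show "gcoeff (sderiv c (sderiv d f) x) I = gcoeff (sderiv d (sderiv c f) x) I"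
      using pdiff_cmult[OF smooth_sfun_coeff[OF f], of c x "gsign {d} I" "insert d I"] that U
      by (auto simp: gcoeff_sderiv[OF smooth_sfun_sderiv[OF f U(1)] that(1)] gcoeff_sderiv[OF f that(1)]
        sderiv_odd gcoeff_gderiv pdiff_def[of c "\<lambda>y. 0"])
  qed
  consider "cpar c = 0" "cpar d = 0" | "cpar c = 0" "cpar d = 1" | "cpar c = 1" "cpar d = 0" | "cpar c = 1" "cpar d = 1"
    using cpar_cases[of c] cpar_cases[of d] by (elim disjE) simp_all
  then show ?thesis
  proof cases
    case 1
    show ?thesis
      by (rule grass_eqI)
         (use 1 pdiff_commute[OF smooth_sfun_coeff[OF f] U(1), of c d x] U(2) in
          \<open>simp add: gcoeff_sderiv[OF smooth_sfun_sderiv[OF f U(1)]] gcoeff_sderiv[OF f]\<close>)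
  next
    case 4
    then show ?thesis using gderiv_gderiv[of c d "f x"] by (simp add: sderiv_odd)
  qed (use mixed in auto)
qed

section \<open>Evaluation at Grassmann-valued points\<close>

lemma finite_dimset [simp]: "finite (dimset k l)" by (simp add: dimset_def)

lemma coords_eq:
  "coords n m p q r s = (\<lambda>(A, K). Pc A K) ` (dimset n m \<times> dimset p q) \<union> (\<lambda>(F, K). Wc F K) ` (dimset r s \<times> dimset p q)"
  by (auto simp: coords_def)

lemma finite_coords [simp]: "finite (coords n m p q r s)"
  unfolding coords_eq by (intro finite_UnI finite_imageI finite_cartesian_product finite_dimset)

lemma gcoeff_mult_nz: "gcoeff (a * b) K \<noteq> 0 \<Longrightarrow> \<exists>I\<subseteq>K. gcoeff a I \<noteq> 0 \<and> gcoeff b (K - I) \<noteq> 0"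
  unfolding gcoeff_mult by (metis (mono_tags, lifting) Pow_iff mult_eq_0_iff sum.neutral)

lemma gbody_soul [simp]: "gbody (gsoul a) = 0"
  by (simp add: gbody_def gsoul_def gcoeff_of_real)

lemma ghom_gsoul: "ghomogeneous 0 a \<Longrightarrow> ghomogeneous 0 (gsoul a)"
  unfolding gsoul_def by (intro ghom_diff ghom_of_real)

lemma finite_gsupport: "finite (\<Union>{I. gcoeff a I \<noteq> 0})"
  using finite_gcoeff gcoeff_finite by blast

text \<open>A soul has no constant term, so every factor contributes at least one generator to each
  monomial. Products of more souls than there are generators involved must vanish.\<close>

lemma prod_gsoul_support:
  assumes "cs \<in> lists E" "gcoeff (prod_list (map (\<lambda>c. gsoul (z c)) cs)) I \<noteq> 0"
  shows "length cs \<le> card I \<and> I \<subseteq> (\<Union>c\<in>E. \<Union>{I. gcoeff (gsoul (z c)) I \<noteq> 0})"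
  using assms
proof (induction cs arbitrary: I rule: list.induct)
  case Nil
  then show ?case by (auto simp: gcoeff_1 split: if_splits)
next
  case (Cons c cs)
  then obtain J where J: "J \<subseteq> I" "gcoeff (gsoul (z c)) J \<noteq> 0"
    "gcoeff (prod_list (map (\<lambda>c. gsoul (z c)) cs)) (I - J) \<noteq> 0"
    using gcoeff_mult_nz[of "gsoul (z c)"] by force
  have "J \<noteq> {}" using J(2) gbody_soul[of "z c"] unfolding gbody_def by metis
  moreover have fin: "finite I" using Cons.prems(2) gcoeff_finite by blast
  ultimately have "card J > 0" using J(1) finite_subset card_gt_0_iff by blast
  moreover have "card I = card J + card (I - J)"
    using fin J(1) by (metis card_Diff_subset card_mono finite_subset le_add_diff_inverse)
  moreover have "length cs \<le> card (I - J)" "I - J \<subseteq> (\<Union>c\<in>E. \<Union>{I. gcoeff (gsoul (z c)) I \<noteq> 0})"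
    using Cons.IH[OF _ J(3)] Cons.prems(1) by auto
  moreover have "J \<subseteq> (\<Union>c\<in>E. \<Union>{I. gcoeff (gsoul (z c)) I \<noteq> 0})" using J(2) Cons.prems(1) by auto
  ultimately show ?case using J(1) by auto
qed

text \<open>The bound counts the generators in the souls of the even coordinates. It does not depend
  on \<phi>, so one cut-off serves a function and all its derivatives.\<close>

lemma taylor_term_vanish:
  assumes "finite E"
  obtains N0 where "\<And>\<phi> N. N \<ge> N0 \<Longrightarrow> taylor_term E \<phi> z N = 0"
proof
  let ?G = "\<Union>c\<in>E. \<Union>{I. gcoeff (gsoul (z c)) I \<noteq> 0}"
  have G: "finite ?G" using assms finite_gsupport by (intro finite_UN_I) auto
  fix \<phi> N assume N: "N \<ge> Suc (card ?G)"
  have "prod_list (map (\<lambda>c. gsoul (z c)) cs) = 0" if cs: "cs \<in> lists E" "length cs = N" for cs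
  proof (rule grass_eqI, rule ccontr)
    fix I assume "gcoeff (prod_list (map (\<lambda>c. gsoul (z c)) cs)) I \<noteq> gcoeff 0 I"
    then have "N \<le> card I" "I \<subseteq> ?G" using prod_gsoul_support[OF cs(1), of z I] cs(2) by auto
    then have "card I \<le> card ?G" using card_mono[OF G] by blast
    then show False using N \<open>N \<le> card I\<close> by linarith
  qed
  then show "taylor_term E \<phi> z N = 0" by (simp add: taylor_term_def)
qed

lemma taylor_eq_sum:
  assumes "\<And>N. N \<ge> N0 \<Longrightarrow> taylor_term E \<phi> z N = 0"
  shows "taylor E \<phi> z = (\<Sum>N<N0. taylor_term E \<phi> z N)"
  unfolding taylor_def
  by (rule sum.mono_neutral_left) (use assms in \<open>auto simp: not_less[symmetric]\<close>)

lemma taylor_term_0: "taylor_term E \<phi> z 0 = of_real (\<phi> (\<lambda>c. gbody (z c)))"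
proof -
  have "{cs. cs \<in> lists E \<and> length cs = 0} = {[]}" by auto
  then show ?thesis by (simp add: taylor_term_def of_real_def)
qed

text \<open>Splits off the last letter of the word \<open>cs\<close>, which is the derivative
  applied first, and moves its even soul to the front. Identities between Taylor terms can then be
  proved by induction on \<open>N\<close> for all \<phi> at once.\<close>

lemma taylor_term_Suc:
  assumes "finite E" "\<And>c. c \<in> E \<Longrightarrow> ghomogeneous 0 (z c)"
  shows "taylor_term E \<phi> z (Suc N) = (1 / real (Suc N)) *\<^sub>R
    (\<Sum>c\<in>E. gsoul (z c) * taylor_term E (pdiff c \<phi>) z N)"
proof -
  let ?b = "\<lambda>c. gbody (z c)" and ?W = "\<lambda>N. {cs. cs \<in> lists E \<and> length cs = N}"
  let ?P = "\<lambda>cs. prod_list (map (\<lambda>c. gsoul (z c)) cs)"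
  have "(\<Sum>cs\<in>?W (Suc N). foldr pdiff cs \<phi> ?b *\<^sub>R ?P cs)
     = (\<Sum>(c, cs)\<in>E \<times> ?W N. foldr pdiff cs (pdiff c \<phi>) ?b *\<^sub>R (gsoul (z c) * ?P cs))"
  proof (rule sum.reindex_bij_witness[of _ "\<lambda>(c, cs). cs @ [c]" "\<lambda>cs. (last cs, butlast cs)"], goal_cases)
    case (1 cs)
    then have "cs \<noteq> []" by auto
    then show ?case by simp
  next
    case (2 cs)
    then have ne: "cs \<noteq> []" by auto
    have "set (butlast cs) \<subseteq> set cs" by (meson in_set_butlastD subsetI)
    then show ?case using 2 last_in_set[OF ne] by (auto simp: in_lists_conv_set)
  next
    case (5 cs)
    then obtain ds d where cs: "cs = ds @ [d]" by (cases cs rule: rev_cases) auto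
    have "ghomogeneous 0 (gsoul (z d))" using 5 cs assms(2) by (auto intro: ghom_gsoul)
    then show ?case using ghom_even_commute[of "gsoul (z d)" "?P ds"] by (simp add: cs)
  qed auto
  also have "\<dots> = (\<Sum>c\<in>E. gsoul (z c) * (\<Sum>cs\<in>?W N. foldr pdiff cs (pdiff c \<phi>) ?b *\<^sub>R ?P cs))"
    by (simp add: sum.cartesian_product[symmetric] sum_distrib_left)
  finally have eq: "(\<Sum>cs\<in>?W (Suc N). foldr pdiff cs \<phi> ?b *\<^sub>R ?P cs) = \<dots>" .
  define B where "B = (\<lambda>c. \<Sum>cs\<in>?W N. foldr pdiff cs (pdiff c \<phi>) ?b *\<^sub>R ?P cs)"
  have "taylor_term E \<phi> z (Suc N) = (1 / fact (Suc N)) *\<^sub>R (\<Sum>c\<in>E. gsoul (z c) * B c)"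
    unfolding taylor_term_def eq B_def ..
  also have "\<dots> = (1 / real (Suc N)) *\<^sub>R (\<Sum>c\<in>E. gsoul (z c) * ((1 / fact N) *\<^sub>R B c))"
    by (simp add: scaleR_sum_right mult.commute)
  finally show ?thesis by (simp only: taylor_term_def B_def)
qed

lemma taylor_term_cong:
  assumes "open U" "\<And>y. y \<in> U \<Longrightarrow> \<phi> y = \<psi> y" "(\<lambda>c. gbody (z c)) \<in> U"
  shows "taylor_term E \<phi> z N = taylor_term E \<psi> z N"
  unfolding taylor_term_def using foldr_pdiff_cong[OF assms] by simp

lemma taylor_cong:
  assumes "open U" "\<And>y. y \<in> U \<Longrightarrow> \<phi> y = \<psi> y" "(\<lambda>c. gbody (z c)) \<in> U"
  shows "taylor E \<phi> z = taylor E \<psi> z"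
proof -
  have "taylor_term E \<phi> z = taylor_term E \<psi> z" by (rule ext) (rule taylor_term_cong[OF assms])
  then show ?thesis by (simp only: taylor_def)
qed

section \<open>Taylor evaluation of smooth functions at a Grassmann-valued point\<close>

locale eval_point =
  fixes C :: "coord set" and U :: "(coord \<Rightarrow> real) set" and z :: "coord \<Rightarrow> nat grass"
  assumes fin: "finite C" and U: "open U" and body: "(\<lambda>c. gbody (z c)) \<in> U"
    and par: "\<And>c. c \<in> C \<Longrightarrow> ghomogeneous (cpar c) (z c)"
begin

abbreviation T :: "((coord \<Rightarrow> real) \<Rightarrow> real) \<Rightarrow> nat \<Rightarrow> nat grass" where
  "T \<phi> N \<equiv> taylor_term (evens C) \<phi> z N"
abbreviation sm :: "((coord \<Rightarrow> real) \<Rightarrow> real) \<Rightarrow> bool" where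
  "sm \<equiv> smooth_fun {c. cpar c = 0} U"

lemma fin_evens: "finite (evens C)" using fin by (simp add: evens_def)
lemma fin_odds: "finite (odds C)" using fin by (simp add: odds_def)
lemma evens_hom: "c \<in> evens C \<Longrightarrow> ghomogeneous 0 (z c)" using par[of c] by (auto simp: evens_def)
lemma odds_hom: "c \<in> odds C \<Longrightarrow> ghomogeneous 1 (z c)" using par[of c] by (auto simp: odds_def)
lemma evens_soul: "c \<in> evens C \<Longrightarrow> ghomogeneous 0 (gsoul (z c))" using evens_hom ghom_gsoul by blast
lemma evens_par: "c \<in> evens C \<Longrightarrow> cpar c = 0" by (simp add: evens_def)

lemma T_Suc: "real (Suc N) *\<^sub>R T \<phi> (Suc N) = (\<Sum>c\<in>evens C. gsoul (z c) * T (pdiff c \<phi>) N)"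
  by (simp add: taylor_term_Suc[OF fin_evens evens_hom])

lemma T_cong: "(\<And>y. y \<in> U \<Longrightarrow> \<phi> y = \<psi> y) \<Longrightarrow> T \<phi> N = T \<psi> N"
  by (rule taylor_term_cong[OF U _ body])

lemma T_cancel: "real (Suc N) *\<^sub>R T \<phi> (Suc N) = real (Suc N) *\<^sub>R X \<Longrightarrow> T \<phi> (Suc N) = X"
  by simp

lemma T_hom: "ghomogeneous 0 (T \<phi> N)"
proof (induction N arbitrary: \<phi>)
  case (Suc N)
  have "ghomogeneous 0 (\<Sum>c\<in>evens C. gsoul (z c) * T (pdiff c \<phi>) N)"
    using Suc evens_soul ghom_mult[of 0 _ 0] by (intro ghom_sum) auto
  then show ?case by (simp add: taylor_term_Suc[OF fin_evens evens_hom] ghom_scaleR)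
qed (simp add: taylor_term_0 ghom_of_real)

lemma T_add: "sm \<phi> \<Longrightarrow> sm \<psi> \<Longrightarrow> T (\<lambda>x. \<phi> x + \<psi> x) N = T \<phi> N + T \<psi> N"
proof (induction N arbitrary: \<phi> \<psi>)
  case (Suc N)
  show ?case
  proof (rule T_cancel)
    have "T (pdiff c (\<lambda>x. \<phi> x + \<psi> x)) N = T (pdiff c \<phi>) N + T (pdiff c \<psi>) N" if "c \<in> evens C" for c
    proof -
      have "T (pdiff c (\<lambda>x. \<phi> x + \<psi> x)) N = T (\<lambda>x. pdiff c \<phi> x + pdiff c \<psi> x) N"
        by (rule T_cong) (use that evens_par pdiff_add[OF Suc.prems] in auto)
      then show ?thesis using Suc that evens_par by (simp add: smooth_pdiff)
    qed
    then show "real (Suc N) *\<^sub>R T (\<lambda>x. \<phi> x + \<psi> x) (Suc N) = real (Suc N) *\<^sub>R (T \<phi> (Suc N) + T \<psi> (Suc N))"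
      unfolding scaleR_add_right T_Suc by (simp add: distrib_left sum.distrib)
  qed
qed (simp add: taylor_term_0)

lemma T_cmult: "sm \<phi> \<Longrightarrow> T (\<lambda>x. k * \<phi> x) N = k *\<^sub>R T \<phi> N"
proof (induction N arbitrary: \<phi>)
  case (Suc N)
  show ?case
  proof (rule T_cancel)
    have "T (pdiff c (\<lambda>x. k * \<phi> x)) N = k *\<^sub>R T (pdiff c \<phi>) N" if "c \<in> evens C" for c
    proof -
      have "T (pdiff c (\<lambda>x. k * \<phi> x)) N = T (\<lambda>x. k * pdiff c \<phi> x) N"
        by (rule T_cong) (use that evens_par pdiff_cmult[OF Suc.prems] in auto)
      then show ?thesis using Suc that evens_par by (simp add: smooth_pdiff)
    qed
    then have "real (Suc N) *\<^sub>R T (\<lambda>x. k * \<phi> x) (Suc N) = k *\<^sub>R (real (Suc N) *\<^sub>R T \<phi> (Suc N))"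
      unfolding T_Suc by (simp add: scaleR_sum_right)
    then show "real (Suc N) *\<^sub>R T (\<lambda>x. k * \<phi> x) (Suc N) = real (Suc N) *\<^sub>R (k *\<^sub>R T \<phi> (Suc N))"
      by (simp add: mult.commute)
  qed
qed (simp add: taylor_term_0 of_real_def)

lemma T_const0: "T (\<lambda>_. 0) N = 0"
  using T_cmult[OF smooth_const[OF U, of _ 0], of 0] by simp

text \<open>Taylor terms lagging by one degree. A soul raises the degree in the souls by one, so in
  a product with a coordinate the soul part of degree \<open>N\<close> stems from degree
  \<open>N - 1\<close>; in degree 0 there is none.\<close>

definition Tp :: "((coord \<Rightarrow> real) \<Rightarrow> real) \<Rightarrow> nat \<Rightarrow> nat grass" where
  "Tp \<phi> N = (case N of 0 \<Rightarrow> 0 | Suc M \<Rightarrow> T \<phi> M)"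

lemma sum_Tp: "(\<Sum>c\<in>evens C. gsoul (z c) * Tp (pdiff c \<phi>) N) = real N *\<^sub>R T \<phi> N"
  by (cases N) (simp add: Tp_def, simp only: Tp_def nat.case T_Suc)

lemma Tp_cong: "(\<And>y. y \<in> U \<Longrightarrow> \<phi> y = \<psi> y) \<Longrightarrow> Tp \<phi> N = Tp \<psi> N"
proof -
  assume *: "\<And>y. y \<in> U \<Longrightarrow> \<phi> y = \<psi> y"
  have "T \<phi> M = T \<psi> M" for M by (rule T_cong) (rule *)
  then show ?thesis by (simp add: Tp_def split: nat.split)
qed

lemma T_coord_mult:
  "sm \<phi> \<Longrightarrow> c \<in> evens C \<Longrightarrow> T (\<lambda>x. x c * \<phi> x) N = gbody (z c) *\<^sub>R T \<phi> N + gsoul (z c) * Tp \<phi> N"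
proof (induction N arbitrary: \<phi>)
  case (Suc N)
  have c: "gsoul (z c) * x = x * gsoul (z c)" for x
    using ghom_even_commute evens_soul[OF Suc.prems(2)] by blast
  show ?case
  proof (rule T_cancel)
    have st: "gsoul (z d) * T (pdiff d (\<lambda>x. x c * \<phi> x)) N = (if d = c then gsoul (z d) * T \<phi> N else 0)
       + gbody (z c) *\<^sub>R (gsoul (z d) * T (pdiff d \<phi>) N) + gsoul (z c) * (gsoul (z d) * Tp (pdiff d \<phi>) N)"
      if "d \<in> evens C" for d
    proof -
      have d: "cpar d = 0" using that evens_par by auto
      have sd: "sm (pdiff d \<phi>)" using Suc.prems d by (simp add: smooth_pdiff)
      have "T (pdiff d (\<lambda>x. x c * \<phi> x)) N = T (\<lambda>x. (if d = c then \<phi> x else 0) + x c * pdiff d \<phi> x) N"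
        by (rule T_cong) (use d pdiff_coord_mult[OF Suc.prems(1)] in auto)
      also have "\<dots> = T (\<lambda>x. if d = c then \<phi> x else 0) N + T (\<lambda>x. x c * pdiff d \<phi> x) N"
      proof (rule T_add)
        show "sm (\<lambda>x. if d = c then \<phi> x else 0)"
          using Suc.prems(1) smooth_const[OF U] by (cases "d = c") auto
        show "sm (\<lambda>x. x c * pdiff d \<phi> x)" by (rule smooth_coord_mult[OF sd U])
      qed
      also have "T (\<lambda>x. if d = c then \<phi> x else 0) N = (if d = c then T \<phi> N else 0)"
        using T_const0 by auto
      also have "T (\<lambda>x. x c * pdiff d \<phi> x) N = gbody (z c) *\<^sub>R T (pdiff d \<phi>) N + gsoul (z c) * Tp (pdiff d \<phi>) N"
        by (rule Suc.IH[OF sd Suc.prems(2)])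
      finally have e: "T (pdiff d (\<lambda>x. x c * \<phi> x)) N = (if d = c then T \<phi> N else 0) +
          (gbody (z c) *\<^sub>R T (pdiff d \<phi>) N + gsoul (z c) * Tp (pdiff d \<phi>) N)" .
      have "gsoul (z d) * (gsoul (z c) * Tp (pdiff d \<phi>) N) = gsoul (z c) * (gsoul (z d) * Tp (pdiff d \<phi>) N)"
        using c[of "gsoul (z d)"] by (metis mult.assoc)
      then show ?thesis unfolding e by (simp add: distrib_left)
    qed
    have "real (Suc N) *\<^sub>R T (\<lambda>x. x c * \<phi> x) (Suc N) =
       (\<Sum>d\<in>evens C. (if d = c then gsoul (z d) * T \<phi> N else 0)
       + gbody (z c) *\<^sub>R (gsoul (z d) * T (pdiff d \<phi>) N) + gsoul (z c) * (gsoul (z d) * Tp (pdiff d \<phi>) N))"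
      unfolding T_Suc by (intro sum.cong refl st)
    also have "\<dots> = (\<Sum>d\<in>evens C. if d = c then gsoul (z d) * T \<phi> N else 0)
       + gbody (z c) *\<^sub>R (\<Sum>d\<in>evens C. gsoul (z d) * T (pdiff d \<phi>) N)
       + gsoul (z c) * (\<Sum>d\<in>evens C. gsoul (z d) * Tp (pdiff d \<phi>) N)"
      by (simp only: sum.distrib scaleR_sum_right sum_distrib_left)
    also have "\<dots> = gsoul (z c) * T \<phi> N
       + gbody (z c) *\<^sub>R (real (Suc N) *\<^sub>R T \<phi> (Suc N)) + gsoul (z c) * (real N *\<^sub>R T \<phi> N)"
      unfolding T_Suc[symmetric] sum_Tp using Suc.prems(2) fin_evens by simp
    \<comment> \<open>The soul part collects \<open>N\<close> from \<open>sum_Tp\<close> and one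
      more from the derivative of the coordinate itself, which together give the factor
      \<open>Suc N\<close>.\<close>
    also have "\<dots> = real (Suc N) *\<^sub>R (gbody (z c) *\<^sub>R T \<phi> (Suc N) + gsoul (z c) * Tp \<phi> (Suc N))"
      by (simp add: Tp_def algebra_simps)
    finally show "real (Suc N) *\<^sub>R T (\<lambda>x. x c * \<phi> x) (Suc N) =
       real (Suc N) *\<^sub>R (gbody (z c) *\<^sub>R T \<phi> (Suc N) + gsoul (z c) * Tp \<phi> (Suc N))" .
  qed
qed (simp add: taylor_term_0 Tp_def of_real_def)

abbreviation tay :: "((coord \<Rightarrow> real) \<Rightarrow> real) \<Rightarrow> nat grass" where
  "tay \<phi> \<equiv> taylor (evens C) \<phi> z"

lemma tay_sum:
  obtains N0 where "\<And>\<phi> N1. N1 \<ge> N0 \<Longrightarrow> tay \<phi> = (\<Sum>N<N1. T \<phi> N)"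
proof -
  obtain N0 where "\<And>\<phi> N. N \<ge> N0 \<Longrightarrow> T \<phi> N = 0" using taylor_term_vanish[OF fin_evens, of z] by metis
  then show ?thesis using that[of N0] by (simp add: taylor_eq_sum)
qed

lemma sum_Tp_lessThan: "(\<Sum>N<Suc M. Tp \<phi> N) = (\<Sum>N<M. T \<phi> N)"
  unfolding sum.lessThan_Suc_shift by (simp only: Tp_def nat.case add_0)

lemma tay_sum1:
  obtains N0 where "\<And>\<phi>. tay \<phi> = (\<Sum>N<N0. T \<phi> N)"
  using tay_sum by (metis order_refl)

lemma tay_add: "sm \<phi> \<Longrightarrow> sm \<psi> \<Longrightarrow> tay (\<lambda>x. \<phi> x + \<psi> x) = tay \<phi> + tay \<psi>"
  by (rule tay_sum1) (simp only: T_add sum.distrib)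

lemma tay_cmult: "sm \<phi> \<Longrightarrow> tay (\<lambda>x. k * \<phi> x) = k *\<^sub>R tay \<phi>"
  by (rule tay_sum1) (simp only: T_cmult scaleR_sum_right)

lemma tay_0: "tay (\<lambda>_. 0) = 0"
  by (rule tay_sum1) (simp only: T_const0 sum.neutral_const)

lemma tay_hom: "ghomogeneous 0 (tay \<phi>)"
  by (rule tay_sum1) (simp only: T_hom ghom_sum)

lemma tay_coord_mult:
  assumes "sm \<phi>" "c \<in> evens C"
  shows "tay (\<lambda>x. x c * \<phi> x) = z c * tay \<phi>"
proof -
  obtain N0 where N0: "\<And>\<phi> N1. N1 \<ge> N0 \<Longrightarrow> tay \<phi> = (\<Sum>N<N1. T \<phi> N)" using tay_sum by blast
  \<comment> \<open>One term beyond the cut-off is taken, because \<open>Tp\<close> lags by one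
    degree.\<close>
  have "tay (\<lambda>x. x c * \<phi> x) = (\<Sum>N<Suc N0. gbody (z c) *\<^sub>R T \<phi> N + gsoul (z c) * Tp \<phi> N)"
    unfolding N0[OF le_SucI[OF order_refl]] by (intro sum.cong refl T_coord_mult[OF assms])
  also have "\<dots> = gbody (z c) *\<^sub>R tay \<phi> + gsoul (z c) * (\<Sum>N<Suc N0. Tp \<phi> N)"
    unfolding N0[OF le_SucI[OF order_refl]] by (simp only: sum.distrib scaleR_sum_right sum_distrib_left)
  also have "(\<Sum>N<Suc N0. Tp \<phi> N) = tay \<phi>" unfolding sum_Tp_lessThan N0[OF order_refl] ..
  finally show ?thesis by (simp add: gsoul_def of_real_def algebra_simps)
qed

end

section \<open>Exact shifts of one even coordinate\<close>

lemma pdiff_line_affine: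
  assumes \<phi>: "smooth_fun E U \<phi>" and "c \<in> E" "x \<in> U" "open U"
    and line: "\<And>y t. y \<in> U \<Longrightarrow> y(c := t) \<in> U" and zero: "\<And>y. y \<in> U \<Longrightarrow> pdiff c (pdiff c \<phi>) y = 0"
  shows "\<phi> (x(c := t)) = \<phi> x + (t - x c) * pdiff c \<phi> x"
proof -
  have D: "((\<lambda>t. \<psi> (x(c := t))) has_real_derivative pdiff c \<psi> (x(c := t))) (at t)"
    if "smooth_fun E U \<psi>" for \<psi> t
    using smooth_DERIV[OF that assms(2) line[OF assms(3), of t]] by simp
  \<comment> \<open>The whole line lies in \<open>U\<close>, so the vanishing second derivative
    makes the first one constant along it for every \<open>t\<close>, however far from
    \<open>x c\<close>.\<close>
  have const: "pdiff c \<phi> (x(c := t)) = pdiff c \<phi> (x(c := x c))" for t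
    by (rule DERIV_isconst_all[of "\<lambda>t. pdiff c \<phi> (x(c := t))"])
       (use D[OF smooth_pdiff[OF \<phi> assms(2)]] zero line assms(3) in auto)
  have "((\<lambda>t. \<phi> (x(c := t)) - t * pdiff c \<phi> x) has_real_derivative 0) (at t)" for t
    by (rule derivative_eq_intros D[OF \<phi>] | simp add: const)+
  then have "\<phi> (x(c := t)) - t * pdiff c \<phi> x = \<phi> (x(c := x c)) - x c * pdiff c \<phi> x"
    using DERIV_isconst_all[of "\<lambda>t. \<phi> (x(c := t)) - t * pdiff c \<phi> x" t "x c"] by blast
  then show ?thesis by (simp add: algebra_simps)
qed

context eval_point
begin

text \<open>Either the Taylor expansion in \<open>h\<close> ends after the linear term because \<open>h\<^sup>2 = 0\<close>,
  or \<open>\<phi>\<close> is affine in the coordinate \<open>c\<close>, and then \<open>h\<close> may have a body.\<close>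

lemma T_shift:
  assumes c: "c \<in> evens C" and h: "ghomogeneous 0 h" and pt': "eval_point C U (z(c := z c + h))"
  shows "sm \<phi> \<Longrightarrow> gbody h = 0 \<and> h * h = 0 \<or>
      (\<forall>y\<in>U. pdiff c (pdiff c \<phi>) y = 0) \<and> (\<forall>y\<in>U. \<forall>t. y(c := t) \<in> U) \<Longrightarrow>
    taylor_term (evens C) \<phi> (z(c := z c + h)) N
    = T \<phi> N + gbody h *\<^sub>R T (pdiff c \<phi>) N + gsoul h * Tp (pdiff c \<phi>) N"
proof (induction N arbitrary: \<phi>)
  case 0
  have b: "(\<lambda>d. gbody ((z(c := z c + h)) d)) = (\<lambda>d. gbody (z d))(c := gbody (z c) + gbody h)"
    by (auto simp: gbody_add)
  have "\<phi> ((\<lambda>d. gbody (z d))(c := gbody (z c) + gbody h)) = \<phi> (\<lambda>d. gbody (z d)) + gbody h * pdiff c \<phi> (\<lambda>d. gbody (z d))"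
  proof (cases "gbody h = 0 \<and> h * h = 0")
    case True
    then show ?thesis by (simp add: fun_upd_idem)
  next
    case False
    then have line: "\<And>y t. y \<in> U \<Longrightarrow> y(c := t) \<in> U" and zero: "\<And>y. y \<in> U \<Longrightarrow> pdiff c (pdiff c \<phi>) y = 0"
      using 0(2) by blast+
    have "\<phi> ((\<lambda>d. gbody (z d))(c := gbody (z c) + gbody h)) = \<phi> (\<lambda>d. gbody (z d))
        + (gbody (z c) + gbody h - gbody (z c)) * pdiff c \<phi> (\<lambda>d. gbody (z d))"
      by (rule pdiff_line_affine[OF 0(1) _ body U line zero]) (use evens_par[OF c] in simp_all)
    then show ?thesis by (simp only: add_diff_cancel_left')
  qed
  then show ?case unfolding taylor_term_0 b
    by (simp only: Tp_def nat.case of_real_add of_real_mult mult_zero_right add_0_right scaleR_conv_of_real)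
next
  case (Suc N)
  interpret p: eval_point C U "z(c := z c + h)" by (rule pt')
  let ?s = "gsoul h"
  have s_comm: "?s * x = x * ?s" for x using ghom_even_commute[OF ghom_gsoul[OF h]] .
  have ec: "cpar c = 0" using evens_par[OF c] .
  have soul: "gsoul ((z(c := z c + h)) d) = gsoul (z d) + (if d = c then ?s else 0)" for d
    by (simp add: gsoul_def gbody_add)
  \<comment> \<open>These are the terms of second order in \<open>h\<close>. In one case
    \<open>h\<close> coincides with its soul and has square zero, in the other the second derivative
    vanishes.\<close>
  have kill: "?s * (gbody h *\<^sub>R T (pdiff c (pdiff c \<phi>)) N + ?s * Tp (pdiff c (pdiff c \<phi>)) N) = 0"
  proof (cases "gbody h = 0 \<and> h * h = 0")
    case True
    then have "?s * ?s = 0" by (simp add: gsoul_def)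
    then show ?thesis using True by (simp add: mult.assoc[symmetric])
  next
    case False
    then have z0: "\<And>y. y \<in> U \<Longrightarrow> pdiff c (pdiff c \<phi>) y = 0" using Suc.prems(2) by blast
    have "T (pdiff c (pdiff c \<phi>)) N = 0" "Tp (pdiff c (pdiff c \<phi>)) N = Tp (\<lambda>_. 0) N"
      using T_cong[OF z0] Tp_cong[OF z0] T_const0 by auto
    moreover have "Tp (\<lambda>_. 0) N = 0" using T_const0 by (cases N) (auto simp: Tp_def)
    ultimately show ?thesis by simp
  qed
  have step: "taylor_term (evens C) (pdiff d \<phi>) (z(c := z c + h)) N
     = T (pdiff d \<phi>) N + gbody h *\<^sub>R T (pdiff d (pdiff c \<phi>)) N + ?s * Tp (pdiff d (pdiff c \<phi>)) N"
    \<comment> \<open>To apply the induction hypothesis to \<open>pdiff d \<phi>\<close>, its second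
      derivative along \<open>c\<close> must vanish as well; it is the derivative along
      \<open>d\<close> of a function that is zero on \<open>U\<close>.\<close>
    if d: "d \<in> evens C" for d
  proof -
    have ed: "cpar d = 0" using evens_par[OF d] .
    have com: "pdiff c (pdiff d \<phi>) y = pdiff d (pdiff c \<phi>) y" if "y \<in> U" for y
      using pdiff_commute[OF Suc.prems(1) U _ _ that] ec ed by simp
    have smc: "sm (pdiff c \<phi>)" using smooth_pdiff[OF Suc.prems(1), of c] ec by simp
    have "pdiff c (pdiff c (pdiff d \<phi>)) y = pdiff d (pdiff c (pdiff c \<phi>)) y" if "y \<in> U" for y
      using pdiff_cong[where c = c, OF U that com] pdiff_commute[OF smc U _ _ that, of c d] ec ed by simp
    moreover have "pdiff d (pdiff c (pdiff c \<phi>)) y = 0" if "\<forall>y\<in>U. pdiff c (pdiff c \<phi>) y = 0" "y \<in> U" for y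
    proof -
      have "pdiff d (pdiff c (pdiff c \<phi>)) y = pdiff d (\<lambda>_. 0) y"
        by (rule pdiff_cong[OF U that(2)]) (use that(1) in auto)
      then show ?thesis by (simp add: pdiff_def)
    qed
    ultimately have "taylor_term (evens C) (pdiff d \<phi>) (z(c := z c + h)) N
       = T (pdiff d \<phi>) N + gbody h *\<^sub>R T (pdiff c (pdiff d \<phi>)) N + ?s * Tp (pdiff c (pdiff d \<phi>)) N"
      by (intro Suc.IH) (use Suc.prems ed smooth_pdiff in auto)
    then show ?thesis using T_cong[OF com] Tp_cong[OF com] by simp
  qed
  have "real (Suc N) *\<^sub>R taylor_term (evens C) \<phi> (z(c := z c + h)) (Suc N)
    = (\<Sum>d\<in>evens C. gsoul (z d) * T (pdiff d \<phi>) N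
        + gbody h *\<^sub>R (gsoul (z d) * T (pdiff d (pdiff c \<phi>)) N)
        + ?s * (gsoul (z d) * Tp (pdiff d (pdiff c \<phi>)) N)
        + (if d = c then ?s * (T (pdiff d \<phi>) N + (gbody h *\<^sub>R T (pdiff d (pdiff c \<phi>)) N + ?s * Tp (pdiff d (pdiff c \<phi>)) N)) else 0))"
    unfolding p.T_Suc
  proof (rule sum.cong)
    fix d assume d: "d \<in> evens C"
    have "gsoul (z d) * (?s * Tp (pdiff d (pdiff c \<phi>)) N) = ?s * (gsoul (z d) * Tp (pdiff d (pdiff c \<phi>)) N)"
      using s_comm[of "gsoul (z d)"] by (metis mult.assoc)
    then show "gsoul ((z(c := z c + h)) d) * p.T (pdiff d \<phi>) N = gsoul (z d) * T (pdiff d \<phi>) N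
        + gbody h *\<^sub>R (gsoul (z d) * T (pdiff d (pdiff c \<phi>)) N)
        + ?s * (gsoul (z d) * Tp (pdiff d (pdiff c \<phi>)) N)
        + (if d = c then ?s * (T (pdiff d \<phi>) N + (gbody h *\<^sub>R T (pdiff d (pdiff c \<phi>)) N + ?s * Tp (pdiff d (pdiff c \<phi>)) N)) else 0)"
      unfolding step[OF d] soul by (simp add: distrib_left distrib_right scaleR_add_right)
  qed simp
  also have "\<dots> = (\<Sum>d\<in>evens C. gsoul (z d) * T (pdiff d \<phi>) N)
      + gbody h *\<^sub>R (\<Sum>d\<in>evens C. gsoul (z d) * T (pdiff d (pdiff c \<phi>)) N)
      + ?s * (\<Sum>d\<in>evens C. gsoul (z d) * Tp (pdiff d (pdiff c \<phi>)) N)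
      + ?s * (T (pdiff c \<phi>) N + (gbody h *\<^sub>R T (pdiff c (pdiff c \<phi>)) N + ?s * Tp (pdiff c (pdiff c \<phi>)) N))"
    using c fin_evens by (simp only: sum.distrib scaleR_sum_right sum_distrib_left) simp
  also have "\<dots> = real (Suc N) *\<^sub>R T \<phi> (Suc N) + gbody h *\<^sub>R (real (Suc N) *\<^sub>R T (pdiff c \<phi>) (Suc N))
      + ?s * (real N *\<^sub>R T (pdiff c \<phi>) N) + ?s * T (pdiff c \<phi>) N"
    unfolding T_Suc[symmetric] sum_Tp distrib_left[of ?s] kill[unfolded distrib_left] by simp
  also have "\<dots> = real (Suc N) *\<^sub>R (T \<phi> (Suc N) + gbody h *\<^sub>R T (pdiff c \<phi>) (Suc N) + ?s * Tp (pdiff c \<phi>) (Suc N))"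
    by (simp add: Tp_def algebra_simps)
  finally show ?case by (rule p.T_cancel)
qed

lemma tay_shift:
  assumes c: "c \<in> evens C" and h: "ghomogeneous 0 h" and pt': "eval_point C U (z(c := z c + h))"
    and "sm \<phi>" "gbody h = 0 \<and> h * h = 0 \<or>
      (\<forall>y\<in>U. pdiff c (pdiff c \<phi>) y = 0) \<and> (\<forall>y\<in>U. \<forall>t. y(c := t) \<in> U)"
  shows "taylor (evens C) \<phi> (z(c := z c + h)) = tay \<phi> + h * tay (pdiff c \<phi>)"
proof -
  interpret p: eval_point C U "z(c := z c + h)" by (rule pt')
  obtain N0 where N0: "\<And>\<phi> N1. N1 \<ge> N0 \<Longrightarrow> tay \<phi> = (\<Sum>N<N1. T \<phi> N)" using tay_sum by blast
  obtain N0' where N0': "\<And>\<phi> N1. N1 \<ge> N0' \<Longrightarrow> p.tay \<phi> = (\<Sum>N<N1. p.T \<phi> N)" using p.tay_sum by blast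
  define M where "M = max N0 N0'"
  have M: "tay \<phi> = (\<Sum>N<M. T \<phi> N)" "tay \<phi> = (\<Sum>N<Suc M. T \<phi> N)" "p.tay \<phi> = (\<Sum>N<Suc M. p.T \<phi> N)" for \<phi>
    by (rule N0 N0'; simp add: M_def)+
  have "p.tay \<phi> = (\<Sum>N<Suc M. T \<phi> N + gbody h *\<^sub>R T (pdiff c \<phi>) N + gsoul h * Tp (pdiff c \<phi>) N)"
    unfolding M(3) by (intro sum.cong refl T_shift[OF assms])
  also have "\<dots> = tay \<phi> + gbody h *\<^sub>R tay (pdiff c \<phi>) + gsoul h * (\<Sum>N<Suc M. Tp (pdiff c \<phi>) N)"
    unfolding M(2) by (simp only: sum.distrib scaleR_sum_right sum_distrib_left)
  also have "(\<Sum>N<Suc M. Tp (pdiff c \<phi>) N) = tay (pdiff c \<phi>)" unfolding sum_Tp_lessThan M(1) ..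
  also have "tay \<phi> + gbody h *\<^sub>R tay (pdiff c \<phi>) + gsoul h * tay (pdiff c \<phi>) = tay \<phi> + h * tay (pdiff c \<phi>)"
    by (simp add: gsoul_def of_real_def algebra_simps)
  finally show ?thesis .
qed

end

section \<open>Odd coordinates in the evaluation\<close>

lemma prod_list_sorted_pull:
  fixes z :: "'c::linorder \<Rightarrow> 'g::linorder grass"
  assumes "sorted l" "distinct l" "c \<in> set l" "\<And>d. d \<in> set l \<Longrightarrow> ghomogeneous 1 (z d)"
  shows "prod_list (map z l) = (- 1) ^ card {j \<in> set l. j < c} *\<^sub>R (z c * prod_list (map z (remove1 c l)))"
  using assms
proof (induction l)
  case (Cons a l)
  show ?case
  proof (cases "a = c")
    case True
    then have "{j \<in> set (a # l). j < c} = {}" using Cons.prems(1) by auto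
    then have "card {j \<in> set (a # l). j < c} = 0" by (simp only: card.empty)
    then show ?thesis using True by (simp only: power_0 scaleR_one list.map prod_list.Cons remove1.simps if_True simp_thms)
  next
    case False
    then have c: "c \<in> set l" and ac: "a < c" using Cons.prems by auto
    have "{j \<in> set (a # l). j < c} = insert a {j \<in> set l. j < c}" using ac by auto
    then have card: "card {j \<in> set (a # l). j < c} = Suc (card {j \<in> set l. j < c})"
      using Cons.prems(2) by simp
    have "z a * z c = - (z c * z a)"
      using ghom_commute[of 1 "z a" 1 "z c"] Cons.prems(3,4) by simp
    then have sw: "z a * (z c * x) = - (z c * (z a * x))" for x
      by (metis mult.assoc mult_minus_left)
    have "prod_list (map z l) = (- 1) ^ card {j \<in> set l. j < c} *\<^sub>R (z c * prod_list (map z (remove1 c l)))"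
      using Cons c by simp
    then show ?thesis unfolding card using False by (simp add: sw)
  qed
qed simp

lemma sum_Pow_split:
  assumes "finite S" "c \<in> S"
  shows "(\<Sum>I\<in>Pow S. F I) = (\<Sum>J\<in>Pow (S - {c}). F J + F (insert c J))"
proof -
  have "Pow S = Pow (S - {c}) \<union> insert c ` Pow (S - {c})"
    using assms(2) Pow_insert[of c "S - {c}"] by (simp add: insert_absorb)
  then have "(\<Sum>I\<in>Pow S. F I) = (\<Sum>J\<in>Pow (S - {c}). F J) + (\<Sum>J\<in>insert c ` Pow (S - {c}). F J)"
    using assms(1) by (simp, subst sum.union_disjoint) auto
  also have "(\<Sum>J\<in>insert c ` Pow (S - {c}). F J) = (\<Sum>J\<in>Pow (S - {c}). F (insert c J))"
    by (subst sum.reindex) (auto simp: inj_on_def)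
  finally show ?thesis by (simp add: sum.distrib)
qed

context eval_point
begin

abbreviation odd_prod :: "coord set \<Rightarrow> nat grass" where
  "odd_prod I \<equiv> prod_list (map z (sorted_list_of_set I))"

lemma seval_eq: "seval C f z = (\<Sum>I\<in>Pow (odds C). tay (\<lambda>x. gcoeff (f x) I) * odd_prod I)"
  by (simp add: seval_def)

text \<open>The new factor passes exactly the factors preceding it in the order. The resulting sign
  is the one in \<open>gderiv\<close>, so that the two cancel when a superfunction is split along an
  odd coordinate.\<close>

lemma odd_prod_insert:
  assumes "J \<subseteq> odds C" "c \<in> odds C" "c \<notin> J"
  shows "odd_prod (insert c J) = gsign {c} J *\<^sub>R (z c * odd_prod J)"
proof -
  have fJ: "finite J" using assms fin_odds finite_subset by blast
  define l where "l = sorted_list_of_set (insert c J)"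
  have l: "sorted l" "distinct l" "set l = insert c J" using fJ by (simp_all add: l_def sorted_insort distinct_insort set_insort_key)
  have "odd_prod (insert c J) = (- 1) ^ card {j \<in> set l. j < c} *\<^sub>R (z c * prod_list (map z (remove1 c l)))"
    unfolding l_def[symmetric] by (rule prod_list_sorted_pull) (use l assms odds_hom in auto)
  moreover have "{j \<in> set l. j < c} = {j \<in> J. j < c}" using l(3) by auto
  moreover have "remove1 c l = sorted_list_of_set J"
    using fJ assms by (simp add: l_def flip: sorted_list_of_set_remove)
  ultimately show ?thesis by (simp add: gsign_singleton)
qed

lemma seval_cong:
  assumes "\<And>y. y \<in> U \<Longrightarrow> f y = g y"
  shows "seval C f z = seval C g z"
proof -
  have "tay (\<lambda>x. gcoeff (f x) I) = tay (\<lambda>x. gcoeff (g x) I)" for I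
    by (rule taylor_cong[OF U _ body]) (simp add: assms)
  then show ?thesis by (simp add: seval_eq)
qed

lemma seval_add:
  "smooth_sfun U f \<Longrightarrow> smooth_sfun U g \<Longrightarrow> seval C (\<lambda>x. f x + g x) z = seval C f z + seval C g z"
  by (simp add: seval_eq tay_add smooth_sfun_coeff distrib_right sum.distrib)

lemma seval_scaleR:
  "smooth_sfun U f \<Longrightarrow> seval C (\<lambda>x. k *\<^sub>R f x) z = k *\<^sub>R seval C f z"
  by (simp add: seval_eq tay_cmult smooth_sfun_coeff scaleR_sum_right)

lemma seval_diff:
  assumes "smooth_sfun U f" "smooth_sfun U g"
  shows "seval C (\<lambda>x. f x - g x) z = seval C f z - seval C g z"
  using seval_add[OF assms(1) smooth_sfun_scaleR[OF assms(2) U, of "-1"]]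
    seval_scaleR[OF assms(2), of "-1"] by simp

lemma seval_0: "seval C (\<lambda>_. 0) z = 0"
  by (simp add: seval_eq tay_0)

lemma seval_zero_on: "(\<And>y. y \<in> U \<Longrightarrow> f y = 0) \<Longrightarrow> seval C f z = 0"
  using seval_cong[of f "\<lambda>_. 0"] seval_0 by simp

lemma seval_sum:
  "(\<And>i. i \<in> S \<Longrightarrow> smooth_sfun U (f i)) \<Longrightarrow> seval C (\<lambda>x. \<Sum>i\<in>S. f i x) z = (\<Sum>i\<in>S. seval C (f i) z)"
proof (induction S rule: infinite_finite_induct)
  case (insert i S)
  have "smooth_sfun U (\<lambda>x. \<Sum>i\<in>S. f i x)" by (rule smooth_sfun_sum[OF U]) (use insert in simp)
  then show ?case using insert by (simp add: seval_add)
qed (simp_all add: seval_0)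

lemma seval_odd_deriv:
  assumes "c \<in> odds C"
  shows "seval C (sderiv c f) z = (\<Sum>J\<in>Pow (odds C - {c}).
    tay (\<lambda>x. gsign {c} J * gcoeff (f x) (insert c J)) * odd_prod J)"
proof -
  have c: "cpar c = 1" using assms by (simp add: odds_def)
  show ?thesis
    unfolding seval_eq sum_Pow_split[OF fin_odds assms]
  proof (rule sum.cong)
    fix J assume "J \<in> Pow (odds C - {c})"
    then have "c \<notin> J" by auto
    then show "tay (\<lambda>x. gcoeff (sderiv c f x) J) * odd_prod J
        + tay (\<lambda>x. gcoeff (sderiv c f x) (insert c J)) * odd_prod (insert c J)
      = tay (\<lambda>x. gsign {c} J * gcoeff (f x) (insert c J)) * odd_prod J"
      by (simp add: sderiv_odd[OF c] gcoeff_gderiv tay_0)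
  qed simp
qed

text \<open>A superfunction is affine in each odd coordinate, and \<open>seval_odd_deriv\<close>
  shows that its slope is evaluated on monomials free of \<open>c\<close>.\<close>

lemma seval_split_odd:
  assumes f: "smooth_sfun U f" and c: "c \<in> odds C"
  shows "seval C f z = (\<Sum>J\<in>Pow (odds C - {c}). tay (\<lambda>x. gcoeff (f x) J) * odd_prod J)
    + z c * seval C (sderiv c f) z"
  unfolding seval_odd_deriv[OF c] seval_eq[of f] sum_Pow_split[OF fin_odds c] sum_distrib_left sum.distrib
proof (intro arg_cong2[where f = "(+)"] refl sum.cong)
  fix J assume "J \<in> Pow (odds C - {c})"
  then have J: "J \<subseteq> odds C" "c \<notin> J" by auto
  let ?t = "tay (\<lambda>x. gcoeff (f x) (insert c J))"
  have "?t * (z c * odd_prod J) = z c * (?t * odd_prod J)"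
    using ghom_even_commute[OF tay_hom, of _ "z c"] by (metis mult.assoc)
  then show "?t * odd_prod (insert c J) = z c * (tay (\<lambda>x. gsign {c} J * gcoeff (f x) (insert c J)) * odd_prod J)"
    using odd_prod_insert[OF J(1) c J(2)] by (simp add: tay_cmult[OF smooth_sfun_coeff[OF f]])
qed

text \<open>For even \<open>c\<close> this holds for each coefficient by
  \<open>tay_coord_mult\<close>. For odd \<open>c\<close> every monomial of the product contains
  \<open>c\<close>, so splitting along \<open>c\<close> leaves \<open>z c\<close> times the part of
  \<open>f\<close> free of \<open>c\<close>; the other part of \<open>f\<close> may be added because
  \<open>z c\<close> has square zero.\<close>

lemma seval_cfun_mult:
  assumes f: "smooth_sfun U f" and c: "c \<in> C"
  shows "seval C (\<lambda>x. cfun c x * f x) z = z c * seval C f z"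
proof (cases "cpar c = 0")
  case True
  then have "c \<in> evens C" using c by (simp add: evens_def)
  then show ?thesis
    using tay_coord_mult[OF smooth_sfun_coeff[OF f]] True
    by (simp add: seval_eq gcoeff_cfun_mult sum_distrib_left mult.assoc)
next
  case False
  then have c1: "cpar c = 1" by simp
  then have co: "c \<in> odds C" using c by (simp add: odds_def)
  have "seval C (sderiv c (\<lambda>x. cfun c x * f x)) z = seval C (\<lambda>x. f x - cfun c x * sderiv c f x) z"
    by (rule seval_cong) (simp add: sderiv_cfun_mult[OF f U] c1)
  have zero: "tay (\<lambda>x. gcoeff (cfun c x * f x) J) = 0" if "c \<notin> J" for J
    using that c1 by (simp add: gcoeff_cfun_mult tay_0)
  have "z c * (\<Sum>J\<in>Pow (odds C - {c}). tay (\<lambda>x. gcoeff (f x) J) * odd_prod J) = z c * seval C f z"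
    using seval_split_odd[OF f co] ghom_odd_sq[OF odds_hom[OF co]]
    by (simp add: distrib_left flip: mult.assoc)
  moreover have "seval C (\<lambda>x. cfun c x * f x) z = z c * (\<Sum>J\<in>Pow (odds C - {c}). tay (\<lambda>x. gcoeff (f x) J) * odd_prod J)"
    unfolding seval_split_odd[OF smooth_sfun_cfun_mult[OF f U] co] seval_odd_deriv[OF co]
  proof -
    have "gcoeff (cfun c x * f x) (insert c J) = gsign {c} J * gcoeff (f x) J" if "J \<in> Pow (odds C - {c})" for x J
    proof -
      have "insert c J - {c} = J" using that by auto
      then show ?thesis by (simp add: gcoeff_cfun_mult c1)
    qed
    then have "(\<Sum>J\<in>Pow (odds C - {c}). tay (\<lambda>x. gsign {c} J * gcoeff (cfun c x * f x) (insert c J)) * odd_prod J)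
      = (\<Sum>J\<in>Pow (odds C - {c}). tay (\<lambda>x. gcoeff (f x) J) * odd_prod J)"
      by (intro sum.cong) simp_all
    moreover have "(\<Sum>J\<in>Pow (odds C - {c}). tay (\<lambda>x. gcoeff (cfun c x * f x) J) * odd_prod J) = 0"
    proof (rule sum.neutral, rule ballI)
      fix J assume "J \<in> Pow (odds C - {c})"
      then have "c \<notin> J" by auto
      then show "tay (\<lambda>x. gcoeff (cfun c x * f x) J) * odd_prod J = 0" using zero by simp
    qed
    ultimately show "(\<Sum>J\<in>Pow (odds C - {c}). tay (\<lambda>x. gcoeff (cfun c x * f x) J) * odd_prod J)
      + z c * (\<Sum>J\<in>Pow (odds C - {c}). tay (\<lambda>x. gsign {c} J * gcoeff (cfun c x * f x) (insert c J)) * odd_prod J)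
      = z c * (\<Sum>J\<in>Pow (odds C - {c}). tay (\<lambda>x. gcoeff (f x) J) * odd_prod J)" by simp
  qed
  ultimately show ?thesis by simp
qed

lemma odd_prod_cong:
  assumes "J \<subseteq> odds C" "\<And>d. d \<in> J \<Longrightarrow> z' d = z d"
  shows "prod_list (map z' (sorted_list_of_set J)) = odd_prod J"
proof -
  have "finite J" using assms(1) fin_odds finite_subset by blast
  then show ?thesis using assms(2) by (metis (mono_tags, lifting) map_eq_conv set_sorted_list_of_set)
qed

lemma taylor_upd_odd:
  assumes "c \<in> odds C" "ghomogeneous 1 h"
  shows "taylor (evens C) \<phi> (z(c := h)) = tay \<phi>"
proof -
  have b: "(\<lambda>d. gbody ((z(c := h)) d)) = (\<lambda>d. gbody (z d))"
    using gbody_odd[OF assms(2)] gbody_odd[OF odds_hom[OF assms(1)]] by auto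
  have ne: "c \<notin> evens C" using assms(1) by (auto simp: odds_def evens_def)
  have "prod_list (map (\<lambda>d. gsoul ((z(c := h)) d)) cs) = prod_list (map (\<lambda>d. gsoul (z d)) cs)"
    if "cs \<in> lists (evens C)" for cs
    using that ne by (intro arg_cong[where f = prod_list] map_cong) auto
  then have "taylor_term (evens C) \<phi> (z(c := h)) = taylor_term (evens C) \<phi> z"
    unfolding taylor_term_def b by (intro ext arg_cong2[where f = "(*\<^sub>R)"] refl sum.cong) auto
  then show ?thesis by (simp only: taylor_def)
qed

text \<open>An odd increment has no body and does not enter the Taylor expansions, and
  \<open>f\<close> is affine in \<open>c\<close>. Hence the first-order formula is exact for every
  \<open>f\<close>.\<close>

lemma seval_shift_odd:
  assumes f: "smooth_sfun U f" and c: "c \<in> odds C" and h: "ghomogeneous 1 h"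
  shows "seval C f (z(c := z c + h)) = seval C f z + h * seval C (sderiv c f) z"
proof -
  let ?z = "z(c := z c + h)"
  have h': "ghomogeneous 1 (z c + h)" by (rule ghom_add[OF odds_hom[OF c] h])
  interpret p: eval_point C U ?z
  proof
    have "(\<lambda>d. gbody (?z d)) = (\<lambda>d. gbody (z d))"
      using gbody_odd[OF h'] gbody_odd[OF odds_hom[OF c]] by auto
    then show "(\<lambda>d. gbody (?z d)) \<in> U" using body by simp
    show "ghomogeneous (cpar d) (?z d)" if "d \<in> C" for d
      using that c h' par[OF that] by (auto simp: odds_def)
  qed (rule fin U)+
  have prods: "prod_list (map ?z (sorted_list_of_set J)) = odd_prod J" if "J \<in> Pow (odds C - {c})" for J
    by (rule odd_prod_cong) (use that in auto)
  have "seval C f ?z = (\<Sum>J\<in>Pow (odds C - {c}). tay (\<lambda>x. gcoeff (f x) J) * odd_prod J)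
     + (z c + h) * seval C (sderiv c f) ?z"
    unfolding p.seval_split_odd[OF f c] by (simp add: taylor_upd_odd[OF c h'] prods)
  moreover have "seval C (sderiv c f) ?z = seval C (sderiv c f) z"
    unfolding p.seval_odd_deriv[OF c] seval_odd_deriv[OF c] by (simp add: taylor_upd_odd[OF c h'] prods)
  ultimately show ?thesis
    by (simp add: seval_split_odd[OF f c] distrib_right)
qed

lemma seval_shift_even:
  assumes f: "smooth_sfun U f" and c: "c \<in> evens C" and h: "ghomogeneous 0 h"
    and pt': "eval_point C U (z(c := z c + h))"
    and cond: "gbody h = 0 \<and> h * h = 0 \<or>
      (\<forall>y\<in>U. sderiv c (sderiv c f) y = 0) \<and> (\<forall>y\<in>U. \<forall>t. y(c := t) \<in> U)"
  shows "seval C f (z(c := z c + h)) = seval C f z + h * seval C (sderiv c f) z"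
proof -
  let ?z = "z(c := z c + h)"
  interpret p: eval_point C U ?z by (rule pt')
  have c0: "cpar c = 0" using c by (simp add: evens_def)
  have co: "c \<notin> odds C" using c by (auto simp: evens_def odds_def)
  have g1: "(\<lambda>x. gcoeff (sderiv c f x) I) = pdiff c (\<lambda>x. gcoeff (f x) I)" for I
    by (rule ext) (rule gcoeff_sderiv[OF f c0])
  have g2: "pdiff c (pdiff c (\<lambda>x. gcoeff (f x) I)) y = gcoeff (sderiv c (sderiv c f) y) I" for I y
    unfolding gcoeff_sderiv[OF smooth_sfun_sderiv[OF f U] c0] g1 ..
  have t: "taylor (evens C) (\<lambda>x. gcoeff (f x) I) ?z
     = tay (\<lambda>x. gcoeff (f x) I) + h * tay (\<lambda>x. gcoeff (sderiv c f x) I)" for I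
    unfolding g1 by (rule tay_shift[OF c h pt' smooth_sfun_coeff[OF f]]) (use cond g2 in auto)
  have prods: "prod_list (map ?z (sorted_list_of_set J)) = odd_prod J" if "J \<in> Pow (odds C)" for J
    by (rule odd_prod_cong) (use that co in auto)
  show ?thesis
    unfolding p.seval_eq seval_eq sum_distrib_left sum.distrib[symmetric]
    by (rule sum.cong) (simp_all add: t prods distrib_right mult.assoc)
qed

end

subsection \<open>Shifting the argument of a superfunction\<close>

text \<open>\<open>h_body\<close> asks for complete lines only where the increment has a body; a
  nilpotent increment leaves the body of the point where it is.\<close>

locale eval_shift =
  fixes C :: "coord set" and U :: "(coord \<Rightarrow> real) set" and h :: "coord \<Rightarrow> nat grass"
  assumes finC: "finite C" and openU: "open U"
    and h_hom: "\<And>c. c \<in> C \<Longrightarrow> ghomogeneous (cpar c) (h c)"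
    and h_body: "\<And>c x t. c \<in> C \<Longrightarrow> gbody (h c) \<noteq> 0 \<Longrightarrow> x \<in> U \<Longrightarrow> x(c := t) \<in> U"
begin

definition move :: "coord set \<Rightarrow> (coord \<Rightarrow> nat grass) \<Rightarrow> coord \<Rightarrow> nat grass" where
  "move D z = (\<lambda>c. if c \<in> D then z c + h c else z c)"

abbreviation pt :: "(coord \<Rightarrow> nat grass) \<Rightarrow> bool" where "pt \<equiv> eval_point C U"

lemma pt_upd:
  assumes "pt z" "c \<in> C"
  shows "pt (z(c := z c + h c))"
proof -
  interpret eval_point C U z by fact
  have b: "(\<lambda>d. gbody ((z(c := z c + h c)) d)) = (\<lambda>d. gbody (z d))(c := gbody (z c) + gbody (h c))"
    by (auto simp: gbody_add)
  show ?thesis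
  proof
    show "(\<lambda>d. gbody ((z(c := z c + h c)) d)) \<in> U"
      unfolding b using body h_body[OF assms(2) _ body] by (cases "gbody (h c) = 0") (auto simp: fun_upd_idem)
    show "ghomogeneous (cpar d) ((z(c := z c + h c)) d)" if "d \<in> C" for d
      using that par[OF that] h_hom[OF that] by (auto intro: ghom_add)
  qed (rule fin U)+
qed

definition shift_cond :: "sfun \<Rightarrow> coord \<Rightarrow> bool" where
  "shift_cond f c \<longleftrightarrow> cpar c = 1 \<or> gbody (h c) = 0 \<and> h c * h c = 0 \<or>
     (\<forall>y\<in>U. sderiv c (sderiv c f) y = 0) \<and> (\<forall>y\<in>U. \<forall>t. y(c := t) \<in> U)"

text \<open>Under this condition the increments within \<open>D\<close> do not interact: for two
  different coordinates either the product of the increments or the mixed second derivative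
  vanishes.\<close>

definition col_cond :: "sfun \<Rightarrow> coord set \<Rightarrow> bool" where
  "col_cond f D \<longleftrightarrow> (\<forall>c\<in>D. shift_cond f c) \<and>
     (\<forall>c\<in>D. \<forall>d\<in>D. c \<noteq> d \<longrightarrow> h d * h c = 0 \<or> (\<forall>y\<in>U. sderiv c (sderiv d f) y = 0))"

lemma seval_upd:
  assumes "pt z" "smooth_sfun U f" "c \<in> C" "shift_cond f c"
  shows "seval C f (z(c := z c + h c)) = seval C f z + h c * seval C (sderiv c f) z"
proof -
  interpret eval_point C U z by fact
  show ?thesis
  proof (cases "cpar c = 0")
    case True
    then show ?thesis
      using seval_shift_even[OF assms(2) _ _ pt_upd[OF assms(1,3)]] assms(3,4) h_hom[OF assms(3)]
      by (auto simp: evens_def shift_cond_def)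
  next
    case False
    then show ?thesis
      using seval_shift_odd[OF assms(2)] assms(3) h_hom[OF assms(3)] by (auto simp: odds_def)
  qed
qed

text \<open>Derivatives can be moved past one another up to sign, so the derivative along
  \<open>e\<close> may be applied last, to a function vanishing on \<open>U\<close>. Through this,
  \<open>col_cond\<close> is inherited by derivatives of \<open>f\<close>.\<close>

lemma sderiv_third_zero:
  assumes f: "smooth_sfun U f" and zero: "\<forall>y\<in>U. sderiv c (sderiv d f) y = 0" and "y \<in> U"
  shows "sderiv c (sderiv d (sderiv e f)) y = 0"
proof -
  let ?k = "(- 1) ^ (cpar d * cpar e) :: real" and ?l = "(- 1) ^ (cpar c * cpar e) :: real"
  have "sderiv c (sderiv d (sderiv e f)) y = sderiv c (\<lambda>y. ?k *\<^sub>R sderiv e (sderiv d f) y) y"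
    by (rule sderiv_cong[OF openU assms(3)]) (rule sderiv_commute[OF f openU])
  also have "\<dots> = ?k *\<^sub>R sderiv c (sderiv e (sderiv d f)) y"
    by (intro sderiv_scaleR[OF _ openU assms(3)] smooth_sfun_sderiv f openU)
  also have "sderiv c (sderiv e (sderiv d f)) y = ?l *\<^sub>R sderiv e (sderiv c (sderiv d f)) y"
    by (rule sderiv_commute[OF smooth_sfun_sderiv[OF f openU] openU assms(3)])
  also have "sderiv e (sderiv c (sderiv d f)) y = sderiv e (\<lambda>_. 0) y"
    by (rule sderiv_cong[OF openU assms(3)]) (use zero in auto)
  finally show ?thesis by (simp add: sderiv_0)
qed

lemma col_cond_sderiv: "smooth_sfun U f \<Longrightarrow> col_cond f D \<Longrightarrow> col_cond (sderiv e f) D"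
  unfolding col_cond_def shift_cond_def by (meson sderiv_third_zero)

lemma move_insert: "c \<notin> D \<Longrightarrow> move (insert c D) z = move D (z(c := z c + h c))"
  by (auto simp: move_def fun_eq_iff)

lemma pt_move: "finite D \<Longrightarrow> D \<subseteq> C \<Longrightarrow> pt z \<Longrightarrow> pt (move D z)"
proof (induction D arbitrary: z rule: finite_induct)
  case empty
  then show ?case by (simp add: move_def)
next
  case (insert c D)
  then show ?case using pt_upd by (simp add: move_insert)
qed

text \<open>Coordinates are moved one after another. After \<open>c\<close> has moved, the slopes
  along the other \<open>d\<close> are taken at the new point; the correction is
  \<open>h d * h c\<close> times a mixed derivative, which \<open>col_cond\<close> kills.\<close>

lemma seval_move:
  assumes "finite D" "D \<subseteq> C" "pt z" "smooth_sfun U f" "col_cond f D"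
  shows "seval C f (move D z) = seval C f z + (\<Sum>c\<in>D. h c * seval C (sderiv c f) z)"
  using assms
proof (induction D arbitrary: z rule: finite_induct)
  case empty
  then show ?case by (simp add: move_def)
next
  case (insert c D)
  let ?z = "z(c := z c + h c)"
  interpret eval_point C U z by fact
  have c: "c \<in> C" and D: "D \<subseteq> C" using insert.prems by auto
  have cond: "col_cond f D" "shift_cond f c" using insert.prems(4) by (auto simp: col_cond_def)
  have sd: "smooth_sfun U (sderiv d f)" for d using smooth_sfun_sderiv[OF insert.prems(3) openU] .
  have step: "h d * seval C (sderiv d f) ?z = h d * seval C (sderiv d f) z" if d: "d \<in> D" for d
  proof -
    have "shift_cond (sderiv d f) c"
      using col_cond_sderiv[OF insert.prems(3,4)] by (auto simp: col_cond_def)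
    then have "seval C (sderiv d f) ?z = seval C (sderiv d f) z + h c * seval C (sderiv c (sderiv d f)) z"
      by (rule seval_upd[OF insert.prems(2) sd c])
    moreover have "h d * (h c * seval C (sderiv c (sderiv d f)) z) = 0"
    proof -
      have "h d * h c = 0 \<or> (\<forall>y\<in>U. sderiv c (sderiv d f) y = 0)"
      proof -
        have "c \<noteq> d" using insert.hyps(2) d by blast
        moreover have "c \<in> insert c D" "d \<in> insert c D" using d by simp_all
        ultimately show ?thesis using insert.prems(4) unfolding col_cond_def by metis
      qed
      then show ?thesis
      proof
        assume "h d * h c = 0"
        then show ?thesis by (simp add: mult.assoc[symmetric])
      next
        assume "\<forall>y\<in>U. sderiv c (sderiv d f) y = 0"
        then have "seval C (sderiv c (sderiv d f)) z = 0" by (intro seval_zero_on) blast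
        then show ?thesis by simp
      qed
    qed
    ultimately show ?thesis by (simp add: distrib_left)
  qed
  have "seval C f (move (insert c D) z) = seval C f ?z + (\<Sum>d\<in>D. h d * seval C (sderiv d f) ?z)"
    unfolding move_insert[OF insert.hyps(2)] by (rule insert.IH[OF D pt_upd[OF insert.prems(2) c] insert.prems(3) cond(1)])
  also have "\<dots> = seval C f z + (\<Sum>d\<in>insert c D. h d * seval C (sderiv d f) z)"
    using insert.hyps seval_upd[OF insert.prems(2,3) c cond(2)] by (simp add: step)
  finally show ?case .
qed

text \<open>Interactions between two columns vanish only in the sum over all pairs of rows, not term
  by term, so each column moves as a block. The last hypothesis is quantified over points because
  the induction applies it after other columns have moved.\<close>

lemma seval_move_columns:
  assumes "finite S" "\<And>K. K \<in> S \<Longrightarrow> finite (D K)" "\<And>K. K \<in> S \<Longrightarrow> D K \<subseteq> C"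
    and "pt z" and f: "smooth_sfun U f" and "\<And>K. K \<in> S \<Longrightarrow> col_cond f (D K)"
    and "\<And>K J. K \<in> S \<Longrightarrow> J \<in> S \<Longrightarrow> K \<noteq> J \<Longrightarrow> D K \<inter> D J = {}"
    and "\<And>K J z. K \<in> S \<Longrightarrow> J \<in> S \<Longrightarrow> K \<noteq> J \<Longrightarrow> pt z \<Longrightarrow>
      (\<Sum>c\<in>D K. \<Sum>d\<in>D J. h c * (h d * seval C (sderiv d (sderiv c f)) z)) = 0"
  shows "seval C f (move (\<Union>K\<in>S. D K) z) = seval C f z + (\<Sum>K\<in>S. \<Sum>c\<in>D K. h c * seval C (sderiv c f) z)"
  using assms(1-4,6-8)
proof (induction S arbitrary: z rule: finite_induct)
  case empty
  then show ?case by (simp add: move_def)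
next
  case (insert J S)
  let ?z = "move (D J) z"
  have fJ: "finite (D J)" "D J \<subseteq> C" "col_cond f (D J)" using insert.prems by auto
  have "seval C f (move (\<Union>K\<in>insert J S. D K) z) = seval C f (move (\<Union>K\<in>S. D K) ?z)"
  proof (rule arg_cong[where f = "seval C f"])
    have "c \<notin> D J" if "c \<in> (\<Union>K\<in>S. D K)" for c using that insert.prems(5) insert.hyps by blast
    then show "move (\<Union>K\<in>insert J S. D K) z = move (\<Union>K\<in>S. D K) ?z" by (auto simp: move_def fun_eq_iff)
  qed
  also have "seval C f (move (\<Union>K\<in>S. D K) ?z) = seval C f ?z + (\<Sum>K\<in>S. \<Sum>c\<in>D K. h c * seval C (sderiv c f) ?z)"
    by (rule insert.IH) (use insert.prems pt_move[OF fJ(1,2)] in auto)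
  also have "seval C f ?z = seval C f z + (\<Sum>c\<in>D J. h c * seval C (sderiv c f) z)"
    by (rule seval_move[OF fJ(1,2) insert.prems(3) f fJ(3)])
  also have "(\<Sum>K\<in>S. \<Sum>c\<in>D K. h c * seval C (sderiv c f) ?z) = (\<Sum>K\<in>S. \<Sum>c\<in>D K. h c * seval C (sderiv c f) z)"
  proof (rule sum.cong)
    fix K assume K: "K \<in> S"
    have "seval C (sderiv c f) ?z = seval C (sderiv c f) z + (\<Sum>d\<in>D J. h d * seval C (sderiv d (sderiv c f)) z)" for c
      by (rule seval_move[OF fJ(1,2) insert.prems(3) smooth_sfun_sderiv[OF f openU] col_cond_sderiv[OF f fJ(3)]])
    then have "(\<Sum>c\<in>D K. h c * seval C (sderiv c f) ?z) = (\<Sum>c\<in>D K. h c * seval C (sderiv c f) z)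
       + (\<Sum>c\<in>D K. \<Sum>d\<in>D J. h c * (h d * seval C (sderiv d (sderiv c f)) z))"
      by (simp add: distrib_left sum.distrib sum_distrib_left)
    also have "(\<Sum>c\<in>D K. \<Sum>d\<in>D J. h c * (h d * seval C (sderiv d (sderiv c f)) z)) = 0"
      by (rule insert.prems(6)) (use K insert in auto)
    finally show "(\<Sum>c\<in>D K. h c * seval C (sderiv c f) ?z) = (\<Sum>c\<in>D K. h c * seval C (sderiv c f) z)" by simp
  qed simp
  finally show ?case using insert.hyps by (simp add: add.assoc)
qed

end

subsection \<open>Superfunctions of fewer coordinates\<close>

lemma pdiff_indep:
  assumes dep: "\<And>x y. (\<And>c. c \<in> E \<Longrightarrow> x c = y c) \<Longrightarrow> \<phi> x = \<phi> y"
  shows "c \<notin> E \<Longrightarrow> pdiff c \<phi> = (\<lambda>_. 0)"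
    and "(\<And>d. d \<in> E \<Longrightarrow> x d = y d) \<Longrightarrow> pdiff c \<phi> x = pdiff c \<phi> y"
proof -
  have 1: "pdiff c \<phi> = (\<lambda>_. 0)" if "c \<notin> E"
  proof
    fix x
    have "(\<lambda>t. \<phi> (x(c := t))) = (\<lambda>t. \<phi> x)" using that by (intro ext dep) auto
    then show "pdiff c \<phi> x = 0" by (simp add: pdiff_def)
  qed
  then show "c \<notin> E \<Longrightarrow> pdiff c \<phi> = (\<lambda>_. 0)" .
  assume xy: "\<And>d. d \<in> E \<Longrightarrow> x d = y d"
  show "pdiff c \<phi> x = pdiff c \<phi> y"
  proof (cases "c \<in> E")
    case True
    have "(\<lambda>t. \<phi> (x(c := t))) = (\<lambda>t. \<phi> (y(c := t)))" using xy by (intro ext dep) auto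
    then show ?thesis using xy[OF True] by (simp add: pdiff_def)
  qed (simp add: 1)
qed

lemma taylor_indep:
  assumes pt: "eval_point C U z" and pt': "eval_point C' U z'" and CC: "C \<subseteq> C'"
    and eq: "\<And>c. c \<in> C \<Longrightarrow> z' c = z c"
    and dep: "\<And>x y. (\<And>c. c \<in> evens C \<Longrightarrow> x c = y c) \<Longrightarrow> \<phi> x = \<phi> y"
  shows "taylor (evens C') \<phi> z' = taylor (evens C) \<phi> z"
proof -
  interpret eval_point C U z by fact
  interpret p: eval_point C' U z' by fact
  have sub: "evens C \<subseteq> evens C'" using CC by (auto simp: evens_def)
  have "p.T \<phi> N = T \<phi> N" for N using dep
  proof (induction N arbitrary: \<phi>)
    case 0
    have "\<phi> (\<lambda>c. gbody (z' c)) = \<phi> (\<lambda>c. gbody (z c))"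
      by (rule 0) (use eq in \<open>auto simp: evens_def\<close>)
    then show ?case by (simp add: taylor_term_0)
  next
    case (Suc N)
    have off: "p.T (pdiff c \<phi>) N = 0" if "c \<notin> evens C" for c
    proof -
      have "pdiff c \<phi> = (\<lambda>_. 0)" by (rule pdiff_indep(1)[OF Suc.prems that])
      then show ?thesis using p.T_const0[of N] by metis
    qed
    have "(\<Sum>c\<in>evens C'. gsoul (z' c) * p.T (pdiff c \<phi>) N) = (\<Sum>c\<in>evens C. gsoul (z' c) * p.T (pdiff c \<phi>) N)"
      by (rule sum.mono_neutral_right) (use p.fin_evens sub off in auto)
    also have "\<dots> = (\<Sum>c\<in>evens C. gsoul (z c) * T (pdiff c \<phi>) N)"
    proof (rule sum.cong)
      fix c assume "c \<in> evens C"
      then have "z' c = z c" using eq by (simp add: evens_def)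
      moreover have "p.T (pdiff c \<phi>) N = T (pdiff c \<phi>) N"
        by (rule Suc.IH) (rule pdiff_indep(2)[OF Suc.prems])
      ultimately show "gsoul (z' c) * p.T (pdiff c \<phi>) N = gsoul (z c) * T (pdiff c \<phi>) N" by simp
    qed simp
    finally have "real (Suc N) *\<^sub>R p.T \<phi> (Suc N) = real (Suc N) *\<^sub>R T \<phi> (Suc N)"
      by (simp only: T_Suc p.T_Suc)
    then show ?case by (rule p.T_cancel)
  qed
  then have "taylor_term (evens C') \<phi> z' = taylor_term (evens C) \<phi> z" by (rule ext)
  then show ?thesis by (simp only: taylor_def)
qed

text \<open>Derivatives of elements of \<open>sfuns C U\<close> need not vanish outside \<open>U\<close>, hence this weaker notion.\<close>

definition local_on :: "coord set \<Rightarrow> sfun \<Rightarrow> bool" where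
  "local_on C f \<longleftrightarrow> (\<forall>x y. (\<forall>c\<in>evens C. x c = y c) \<longrightarrow> f x = f y) \<and>
     (\<forall>x I. gcoeff (f x) I \<noteq> 0 \<longrightarrow> I \<subseteq> odds C)"

lemma sfuns_local: "f \<in> sfuns C U \<Longrightarrow> local_on C f"
  unfolding sfuns_def local_on_def mem_Collect_eq by (elim conjE, intro conjI)

lemma local_dep: "local_on C f \<Longrightarrow> (\<And>c. c \<in> evens C \<Longrightarrow> x c = y c) \<Longrightarrow> f x = f y"
  unfolding local_on_def by blast

lemma local_support: "local_on C f \<Longrightarrow> gcoeff (f x) I \<noteq> 0 \<Longrightarrow> I \<subseteq> odds C"
  unfolding local_on_def by blast

lemma sfuns_smooth_sfun:
  assumes f: "f \<in> sfuns C U" and "finite C" "open U"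
  shows "smooth_sfun U f"
proof (rule smooth_sfunI[of "odds C"])
  show "finite (odds C)" using assms by (simp add: odds_def)
  show "I \<subseteq> odds C" if "gcoeff (f x) I \<noteq> 0" for x I using local_support[OF sfuns_local[OF f] that] .
  fix I
  have sm: "smooth_fun (evens C) U (\<lambda>x. gcoeff (f x) I)"
  proof -
    have "\<forall>I. smooth_fun (evens C) U (\<lambda>x. gcoeff (f x) I)" using f by (simp add: sfuns_def)
    then show ?thesis by (rule spec)
  qed
  show "smooth_fun {c. cpar c = 0} U (\<lambda>x. gcoeff (f x) I)"
  proof (rule smooth_extend[OF sm assms(3)])
    show "gcoeff (f x) I = gcoeff (f y) I" if "\<And>c. c \<in> evens C \<Longrightarrow> x c = y c" for x y
      using local_dep[OF sfuns_local[OF f] that] by simp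
  qed
qed

text \<open>Additional even coordinates contribute zero derivatives, additional odd ones zero
  coefficients. In this way L and its derivatives can be evaluated at points of the larger
  superdomain on which \<sigma> L lives. The case of equal coordinate sets says that only the values
  of \<open>z\<close> on \<open>C\<close> matter.\<close>

lemma seval_more_coords:
  assumes f: "local_on C f" and pt: "eval_point C U z" and pt': "eval_point C' U z'" and CC: "C \<subseteq> C'"
    and eq: "\<And>c. c \<in> C \<Longrightarrow> z' c = z c"
  shows "seval C' f z' = seval C f z"
proof -
  interpret eval_point C U z by fact
  interpret p: eval_point C' U z' by fact
  have sub: "odds C \<subseteq> odds C'" using CC by (auto simp: odds_def)
  have "seval C' f z' = (\<Sum>I\<in>Pow (odds C). taylor (evens C') (\<lambda>x. gcoeff (f x) I) z' * p.odd_prod I)"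
    unfolding p.seval_eq
  proof (rule sum.mono_neutral_right)
    show "\<forall>I\<in>Pow (odds C') - Pow (odds C). taylor (evens C') (\<lambda>x. gcoeff (f x) I) z' * p.odd_prod I = 0"
    proof
      fix I assume "I \<in> Pow (odds C') - Pow (odds C)"
      then have "(\<lambda>x. gcoeff (f x) I) = (\<lambda>_. 0)" using local_support[OF f] by blast
      then show "taylor (evens C') (\<lambda>x. gcoeff (f x) I) z' * p.odd_prod I = 0" by (simp add: p.tay_0)
    qed
  qed (use p.fin_odds sub in auto)
  also have "\<dots> = seval C f z" unfolding seval_eq
  proof (rule sum.cong)
    fix I assume I: "I \<in> Pow (odds C)"
    have "taylor (evens C') (\<lambda>x. gcoeff (f x) I) z' = tay (\<lambda>x. gcoeff (f x) I)"
    proof (rule taylor_indep[OF pt pt' CC eq])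
      show "gcoeff (f x) I = gcoeff (f y) I" if "\<And>c. c \<in> evens C \<Longrightarrow> x c = y c" for x y
        using local_dep[OF f that] by simp
    qed
    moreover have "p.odd_prod I = odd_prod I"
      by (rule odd_prod_cong) (use I eq in \<open>auto simp: odds_def\<close>)
    ultimately show "taylor (evens C') (\<lambda>x. gcoeff (f x) I) z' * p.odd_prod I = tay (\<lambda>x. gcoeff (f x) I) * odd_prod I"
      by simp
  qed simp
  finally show ?thesis .
qed

section \<open>The operators on mixed forms\<close>

text \<open>The rows of \<open>p\<close> over \<open>w\<close> are treated alike: \<open>Inl A\<close> is the row \<open>p\<^sub>A\<close> and \<open>Inr F\<close> the row \<open>w\<^sub>F\<close>.\<close>

fun rpar :: "idx + idx \<Rightarrow> nat" where
  "rpar (Inl A) = par A"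
| "rpar (Inr F) = par F"

fun crd :: "idx + idx \<Rightarrow> idx \<Rightarrow> coord" where
  "crd (Inl A) K = Pc A K"
| "crd (Inr F) K = Wc F K"

definition rows :: "nat \<Rightarrow> nat \<Rightarrow> nat \<Rightarrow> nat \<Rightarrow> (idx + idx) set" where
  "rows n m r s = dimset n m <+> dimset r s"

abbreviation (input) sg :: "nat \<Rightarrow> real" where "sg k \<equiv> (- 1) ^ k"

lemma sg_cong: "even i \<longleftrightarrow> even j \<Longrightarrow> sg i = sg j"
  by (simp add: minus_one_power_iff)

lemma cpar_crd [simp]: "cpar (crd X K) = (rpar X + par K) mod 2" by (cases X) auto
lemma crd_eq [simp]: "crd X K = crd Y J \<longleftrightarrow> X = Y \<and> K = J" by (cases X; cases Y) auto
lemma finite_rows [simp]: "finite (rows n m r s)" by (simp add: rows_def)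
lemma crd_coords: "crd X K \<in> coords n m p q r s \<longleftrightarrow> X \<in> rows n m r s \<and> K \<in> dimset p q"
  by (cases X) (auto simp: rows_def coords_def)
lemma coords_rows: "coords n m p q r s = (\<Union>K\<in>dimset p q. (\<lambda>X. crd X K) ` rows n m r s)"
proof (rule set_eqI)
  fix c
  obtain X K where c: "c = crd X K" by (metis coord.exhaust crd.simps)
  show "c \<in> coords n m p q r s \<longleftrightarrow> c \<in> (\<Union>K\<in>dimset p q. (\<lambda>X. crd X K) ` rows n m r s)"
    unfolding c crd_coords by auto
qed

lemma sum_rows: "(\<Sum>X\<in>rows n m r s. F X) = (\<Sum>A\<in>dimset n m. F (Inl A)) + (\<Sum>B\<in>dimset r s. F (Inr B))"
  unfolding rows_def by (simp add: sum.Plus)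

lemma dimset_Suc: "dimset (Suc p) q = insert (Even p) (dimset p q)"
  by (auto simp: dimset_def lessThan_Suc)
lemma Even_notin_dimset [simp]: "Even p \<notin> dimset p q" by (auto simp: dimset_def)
lemma rows_Suc: "rows n m (Suc r) s = insert (Inr (Even r)) (rows n m r s)"
  by (auto simp: rows_def dimset_Suc)
lemma Inr_notin_rows [simp]: "Inr (Even r) \<notin> rows n m r s" by (auto simp: rows_def)

lemma ghom_cfun: "ghomogeneous (cpar c) (cfun c x)"
  using ghom_ggen[of c] by (cases "cpar c = 0") (auto simp: cfun_def ghom_of_real)

lemma ghom_cpar_crd: "ghomogeneous (cpar (crd X K)) a \<longleftrightarrow> ghomogeneous (rpar X + par K) a"
  by (rule ghom_cong) simp

lemma ghom_cfun_crd: "ghomogeneous (rpar X + par K) (cfun (crd X K) x)"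
  using ghom_cfun by (rule ghom_cpar_crd[THEN iffD1])

lemma ghom_swap:
  "ghomogeneous i a \<Longrightarrow> ghomogeneous j b \<Longrightarrow> a * (b * c) = sg (i * j) *\<^sub>R (b * (a * c))"
  using ghom_commute[of i a j b] by (simp flip: mult.assoc)

section \<open>Pairing with a vector, and the operators in terms of rows\<close>

definition rval :: "(idx \<Rightarrow> real) \<Rightarrow> idx + idx \<Rightarrow> real" where
  "rval u X = (case X of Inl A \<Rightarrow> u A | Inr _ \<Rightarrow> 0)"

text \<open>The value of the covector in column \<open>K\<close> on \<open>u\<close>. In terms of it
  e(u) is multiplication by the value in the additional column minus a first-order operator, and its
  sum over the components of \<open>u\<close> disappears.\<close>

definition pairing :: "nat \<Rightarrow> nat \<Rightarrow> (idx \<Rightarrow> real) \<Rightarrow> idx \<Rightarrow> (coord \<Rightarrow> real) \<Rightarrow> coord grass" where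
  "pairing n m u K x = (\<Sum>A\<in>dimset n m. u A *\<^sub>R cfun (Pc A K) x)"

lemma pairing_rows: "pairing n m u K x = (\<Sum>X\<in>rows n m r s. rval u X *\<^sub>R cfun (crd X K) x)"
  by (simp add: pairing_def sum_rows rval_def)

lemma ghom_pairing:
  assumes "\<And>A. A \<in> dimset n m \<Longrightarrow> u A \<noteq> 0 \<Longrightarrow> par A = a"
  shows "ghomogeneous (a + par K) (pairing n m u K x)"
  unfolding pairing_def
proof (rule ghom_sum)
  fix A assume "A \<in> dimset n m"
  then show "ghomogeneous (a + par K) (u A *\<^sub>R cfun (Pc A K) x)"
    using assms[of A] ghom_cfun_crd[of "Inl A" K x] by (cases "u A = 0") (auto intro: ghom_scaleR)
qed

lemma smooth_sfun_pairing_mult: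
  assumes "smooth_sfun U f" "open U"
  shows "smooth_sfun U (\<lambda>x. pairing n m u K x * f x)"
proof -
  have "smooth_sfun U (\<lambda>x. \<Sum>A\<in>dimset n m. u A *\<^sub>R (cfun (Pc A K) x * f x))"
    using assms by (intro smooth_sfun_sum smooth_sfun_scaleR smooth_sfun_cfun_mult)
  then show ?thesis by (simp add: pairing_def sum_distrib_right)
qed

text \<open>Homogeneity of \<open>u\<close> is essential: all components that contribute have the
  same parity \<open>a\<close>, so the Leibniz sign can be taken out of the sum.\<close>

lemma sderiv_pairing_mult:
  assumes f: "smooth_sfun U f" and U: "open U" "x \<in> U" and X: "X \<in> rows n m r s"
    and a: "\<And>A. A \<in> dimset n m \<Longrightarrow> u A \<noteq> 0 \<Longrightarrow> par A = a"
  shows "sderiv (crd X J) (\<lambda>x. pairing n m u K x * f x) x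
    = (if J = K then rval u X else 0) *\<^sub>R f x
      + sg ((rpar X + par J) * (a + par K)) *\<^sub>R (pairing n m u K x * sderiv (crd X J) f x)"
proof -
  let ?c = "crd X J"
  have "sderiv ?c (\<lambda>x. pairing n m u K x * f x) x = sderiv ?c (\<lambda>x. \<Sum>A\<in>dimset n m. u A *\<^sub>R (cfun (Pc A K) x * f x)) x"
    by (simp add: pairing_def sum_distrib_right)
  also have "\<dots> = (\<Sum>A\<in>dimset n m. sderiv ?c (\<lambda>x. u A *\<^sub>R (cfun (Pc A K) x * f x)) x)"
    using f U by (intro sderiv_sum smooth_sfun_scaleR smooth_sfun_cfun_mult) auto
  also have "\<dots> = (\<Sum>A\<in>dimset n m. (if A \<in> {A. X = Inl A \<and> J = K} then u A *\<^sub>R f x else 0)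
      + sg ((rpar X + par J) * (a + par K)) *\<^sub>R (u A *\<^sub>R (cfun (Pc A K) x * sderiv ?c f x)))"
  proof (rule sum.cong)
    fix A assume A: "A \<in> dimset n m"
    have e: "(crd X J = Pc A K) \<longleftrightarrow> X = Inl A \<and> J = K" using crd_eq[of X J "Inl A" K] by simp
    have "sderiv ?c (\<lambda>x. u A *\<^sub>R (cfun (Pc A K) x * f x)) x = u A *\<^sub>R sderiv ?c (\<lambda>x. cfun (Pc A K) x * f x) x"
      using f U by (intro sderiv_scaleR smooth_sfun_cfun_mult) auto
    also have "\<dots> = u A *\<^sub>R ((if X = Inl A \<and> J = K then f x else 0)
        + sg (((rpar X + par J) mod 2) * ((par A + par K) mod 2)) *\<^sub>R (cfun (Pc A K) x * sderiv ?c f x))"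
      using sderiv_cfun_mult[OF f U, of ?c "Pc A K"] e by simp
    also have "\<dots> = (if X = Inl A \<and> J = K then u A *\<^sub>R f x else 0)
        + u A *\<^sub>R (sg (((rpar X + par J) mod 2) * ((par A + par K) mod 2)) *\<^sub>R (cfun (Pc A K) x * sderiv ?c f x))"
      by (simp add: scaleR_add_right)
    also have "u A *\<^sub>R (sg (((rpar X + par J) mod 2) * ((par A + par K) mod 2)) *\<^sub>R (cfun (Pc A K) x * sderiv ?c f x))
        = sg ((rpar X + par J) * (a + par K)) *\<^sub>R (u A *\<^sub>R (cfun (Pc A K) x * sderiv ?c f x))"
    proof (cases "u A = 0")
      case False
      have "sg (((rpar X + par J) mod 2) * ((par A + par K) mod 2)) = sg ((rpar X + par J) * (a + par K))"
        by (rule sg_cong) (simp add: a[OF A False])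
      then show ?thesis by simp
    qed simp
    finally show "sderiv ?c (\<lambda>x. u A *\<^sub>R (cfun (Pc A K) x * f x)) x
      = (if A \<in> {A. X = Inl A \<and> J = K} then u A *\<^sub>R f x else 0)
      + sg ((rpar X + par J) * (a + par K)) *\<^sub>R (u A *\<^sub>R (cfun (Pc A K) x * sderiv ?c f x))"
      by simp
  qed simp
  also have "\<dots> = (\<Sum>A\<in>dimset n m. (if A \<in> {A. X = Inl A \<and> J = K} then u A *\<^sub>R f x else 0))
      + sg ((rpar X + par J) * (a + par K)) *\<^sub>R (pairing n m u K x * sderiv ?c f x)"
    by (simp add: sum.distrib pairing_def sum_distrib_right scaleR_sum_right)
  also have "(\<Sum>A\<in>dimset n m. (if A \<in> {A. X = Inl A \<and> J = K} then u A *\<^sub>R f x else 0))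
      = (if J = K then rval u X else 0) *\<^sub>R f x"
  proof (cases X)
    case (Inl B)
    then have "B \<in> dimset n m" using X by (auto simp: rows_def)
    then show ?thesis using Inl by (cases "J = K") (simp_all add: rval_def)
  qed (simp add: rval_def)
  finally show ?thesis .
qed

lemma e_vec_eq:
  assumes "x \<in> form_dom m q s"
  shows "e_vec n m p q r s e u f x = sg r *\<^sub>R (pairing n m (vcomp n m e u) (Even p) x * f x
    - (\<Sum>X\<in>rows n m r s. \<Sum>K\<in>dimset p q. sg (rpar X * par K) *\<^sub>R
        (pairing n m (vcomp n m e u) K x * (cfun (crd X (Even p)) x * sderiv (crd X K) f x))))"
proof -
  let ?u = "vcomp n m e u" and ?A = "dimset n m" and ?S = "dimset p q"
  have swap: "(\<Sum>A\<in>?A. ?u A *\<^sub>R (\<Sum>B\<in>T. \<Sum>K\<in>?S. c B K *\<^sub>R (cfun (Pc A K) x * y B * d B K)))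
     = (\<Sum>B\<in>T. \<Sum>K\<in>?S. c B K *\<^sub>R (pairing n m ?u K x * (y B * d B K)))" for T c y d
  proof -
    have "(\<Sum>A\<in>?A. ?u A *\<^sub>R (\<Sum>B\<in>T. \<Sum>K\<in>?S. c B K *\<^sub>R (cfun (Pc A K) x * y B * d B K)))
      = (\<Sum>A\<in>?A. \<Sum>B\<in>T. \<Sum>K\<in>?S. c B K *\<^sub>R (?u A *\<^sub>R (cfun (Pc A K) x * (y B * d B K))))"
      by (simp add: scaleR_sum_right mult.commute mult.assoc)
    also have "\<dots> = (\<Sum>B\<in>T. \<Sum>A\<in>?A. \<Sum>K\<in>?S. c B K *\<^sub>R (?u A *\<^sub>R (cfun (Pc A K) x * (y B * d B K))))"
      by (rule sum.swap)
    also have "\<dots> = (\<Sum>B\<in>T. \<Sum>K\<in>?S. \<Sum>A\<in>?A. c B K *\<^sub>R (?u A *\<^sub>R (cfun (Pc A K) x * (y B * d B K))))"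
      by (intro sum.cong refl sum.swap)
    finally show ?thesis
      by (simp add: pairing_def sum_distrib_right scaleR_sum_right)
  qed
  have 0: "(\<Sum>A\<in>?A. ?u A *\<^sub>R (cfun (Pc A (Even p)) x * f x)) = pairing n m ?u (Even p) x * f x"
    by (simp add: pairing_def sum_distrib_right)
  show ?thesis
    unfolding e_vec_def restr_def sum_rows crd.simps rpar.simps
    using assms
    by (simp only: if_True scaleR_diff_right sum_subtractf sum.distrib swap 0 diff_diff_add scaleR_add_right)
qed

lemma sderiv_outside:
  assumes f: "f \<in> sfuns C U" and "finite C" "open U" and c: "c \<notin> C"
  shows "sderiv c f = (\<lambda>_. 0)"
proof
  fix x
  show "sderiv c f x = 0"
  proof (cases "cpar c = 0")
    case True
    have ce: "c \<notin> evens C" using c by (simp add: evens_def)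
    have "gcoeff (sderiv c f x) I = 0" for I
    proof -
      have "pdiff c (\<lambda>y. gcoeff (f y) I) = (\<lambda>_. 0)"
      proof (rule pdiff_indep(1)[OF _ ce])
        show "gcoeff (f x) I = gcoeff (f y) I" if "\<And>c. c \<in> evens C \<Longrightarrow> x c = y c" for x y
          using local_dep[OF sfuns_local[OF f] that] by simp
      qed
      then show ?thesis by (simp add: gcoeff_sderiv[OF sfuns_smooth_sfun[OF assms(1-3)] True])
    qed
    then show ?thesis by (intro grass_eqI) simp
  next
    case False
    then have c1: "cpar c = 1" by simp
    have "gcoeff (f x) (insert c J) = 0" for J
      using local_support[OF sfuns_local[OF f], of x "insert c J"] c by (auto simp: odds_def)
    then show ?thesis by (intro grass_eqI) (simp add: sderiv_odd[OF c1] gcoeff_gderiv)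
  qed
qed

section \<open>The differential equations of a form\<close>

locale mform =
  fixes n m p q r s :: nat and L :: sfun
  assumes form: "L \<in> mixed_forms n m p q r s"
begin

abbreviation "U \<equiv> form_dom m q s"
abbreviation "R \<equiv> rows n m r s"
abbreviation "S \<equiv> dimset p q"

text \<open>The additional row of \<open>w\<close> in the target of \<open>e(\<alpha>)\<close>.\<close>

abbreviation "wr \<equiv> Inr (Even r) :: idx + idx"

lemma L_sfuns: "L \<in> sfuns (coords n m p q r s) U"
  using form by (simp add: mixed_forms_def)

lemma smooth_L: "smooth_sfun U L"
  by (rule sfuns_smooth_sfun[OF L_sfuns finite_coords open_form_dom])

lemma smooth_DL: "smooth_sfun U (sderiv c L)"
  by (rule smooth_sfun_sderiv[OF smooth_L open_form_dom])

lemma sderiv_L_outside: "c \<notin> coords n m p q r s \<Longrightarrow> sderiv c L x = 0"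
  using sderiv_outside[OF L_sfuns finite_coords open_form_dom] by simp

lemma sderiv_sderiv_L_outside:
  assumes "c \<notin> coords n m p q r s" "x \<in> U"
  shows "sderiv c (sderiv d L) x = 0"
proof -
  have "sderiv c L = (\<lambda>_. 0)" using sderiv_L_outside[OF assms(1)] by blast
  then show ?thesis
    using sderiv_commute[OF smooth_L open_form_dom assms(2), of c d] by (simp add: sderiv_0)
qed

lemma pde:
  assumes X: "X \<in> R" and Y: "Y \<in> R" and K: "K \<in> S" and J: "J \<in> S" and x: "x \<in> U"
  shows "sderiv (crd X K) (sderiv (crd Y J) L) x
    + sg (rpar X * rpar Y + (rpar X + rpar Y) * par J) *\<^sub>R sderiv (crd Y K) (sderiv (crd X J) L) x = 0"
proof -
  have PP: "sderiv (Pc A K) (sderiv (Pc B J) L) x + sg (par A * par B + (par A + par B) * par J)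
          *\<^sub>R sderiv (Pc B K) (sderiv (Pc A J) L) x = 0"
    if "A \<in> dimset n m" "B \<in> dimset n m" "K \<in> S" "J \<in> S" for A B K J
    using form that x unfolding mixed_forms_def by blast
  have PW: "sderiv (Pc A K) (sderiv (Wc F J) L) x + sg (par A * par F + (par A + par F) * par J)
          *\<^sub>R sderiv (Wc F K) (sderiv (Pc A J) L) x = 0"
    if "A \<in> dimset n m" "F \<in> dimset r s" "K \<in> S" "J \<in> S" for A F K J
    using form that x unfolding mixed_forms_def by blast
  have WW: "sderiv (Wc F K) (sderiv (Wc G J) L) x + sg (par F * par G + (par F + par G) * par J)
          *\<^sub>R sderiv (Wc G K) (sderiv (Wc F J) L) x = 0"
    if "F \<in> dimset r s" "G \<in> dimset r s" "K \<in> S" "J \<in> S" for F G K J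
    using form that x unfolding mixed_forms_def by blast
  \<comment> \<open>This case is not listed among the equations of a form; it is the mixed equation
    multiplied by its own sign.\<close>
  have WP: "sderiv (Wc F K) (sderiv (Pc A J) L) x + sg (par F * par A + (par F + par A) * par J)
          *\<^sub>R sderiv (Pc A K) (sderiv (Wc F J) L) x = 0"
    if "A \<in> dimset n m" "F \<in> dimset r s" "K \<in> S" "J \<in> S" for A F
  proof -
    let ?k = "par A * par F + (par A + par F) * par J"
    have "sg ?k *\<^sub>R (sderiv (Pc A K) (sderiv (Wc F J) L) x + sg ?k *\<^sub>R sderiv (Wc F K) (sderiv (Pc A J) L) x) = 0"
      using PW[OF that] by simp
    then show ?thesis
      by (simp add: scaleR_add_right power_add[symmetric] mult_2[symmetric] power_mult add.commute mult.commute)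
  qed
  show ?thesis
    using X Y K J PP PW WW WP by (cases X; cases Y) (auto simp: rows_def)
qed

text \<open>\<open>pde\<close> exchanges the rows and keeps the columns; composing it with the
  commutation of the two derivatives keeps the rows and exchanges the columns. This is the version
  that fits e(u)e(v), where the rows are tied to the two additional columns.\<close>

lemma pde_col:
  assumes X: "X \<in> R" and Y: "Y \<in> R" and K: "K \<in> S" and J: "J \<in> S" and x: "x \<in> U"
  shows "sderiv (crd X K) (sderiv (crd Y J) L) x
    = - sg (rpar X * par J + rpar X * par K + par K * par J) *\<^sub>R sderiv (crd X J) (sderiv (crd Y K) L) x"
proof -
  have "sderiv (crd X K) (sderiv (crd Y J) L) x
     = - sg (rpar X * rpar Y + (rpar X + rpar Y) * par J) *\<^sub>R sderiv (crd Y K) (sderiv (crd X J) L) x"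
    using pde[OF assms] by (simp add: add_eq_0_iff2)
  also have "sderiv (crd Y K) (sderiv (crd X J) L) x
     = sg (cpar (crd Y K) * cpar (crd X J)) *\<^sub>R sderiv (crd X J) (sderiv (crd Y K) L) x"
    by (rule sderiv_commute[OF smooth_L open_form_dom x])
  also have "- sg (rpar X * rpar Y + (rpar X + rpar Y) * par J) *\<^sub>R sg (cpar (crd Y K) * cpar (crd X J)) *\<^sub>R
       sderiv (crd X J) (sderiv (crd Y K) L) x =
     - sg ((rpar X * rpar Y + (rpar X + rpar Y) * par J) + cpar (crd Y K) * cpar (crd X J)) *\<^sub>R
       sderiv (crd X J) (sderiv (crd Y K) L) x"
    by (simp add: power_add)
  also have "sg ((rpar X * rpar Y + (rpar X + rpar Y) * par J) + cpar (crd Y K) * cpar (crd X J))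
     = sg (rpar X * par J + rpar X * par K + par K * par J)"
    by (rule sg_cong) (simp, blast)
  finally show ?thesis .
qed

end

lemma sg_scaleR: "sg i *\<^sub>R (sg j *\<^sub>R W) = sg (i + j) *\<^sub>R (W :: 'a :: real_vector)"
  by (simp add: power_add)

lemma sg_scaleR_cong: "even i \<longleftrightarrow> even j \<Longrightarrow> sg i *\<^sub>R W = sg j *\<^sub>R (W :: 'a :: real_vector)"
  using sg_cong[of i j] by simp

lemma sum3_swap: "(\<Sum>K\<in>S. \<Sum>Y\<in>R. \<Sum>J\<in>S. F K Y J) = (\<Sum>K\<in>S. \<Sum>Y\<in>R. \<Sum>J\<in>S. F J Y K)"
proof -
  have "(\<Sum>K\<in>S. \<Sum>Y\<in>R. \<Sum>J\<in>S. F K Y J) = (\<Sum>Y\<in>R. \<Sum>K\<in>S. \<Sum>J\<in>S. F K Y J)" by (rule sum.swap)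
  also have "\<dots> = (\<Sum>Y\<in>R. \<Sum>K\<in>S. \<Sum>J\<in>S. F J Y K)" by (intro sum.cong refl sum.swap)
  also have "\<dots> = (\<Sum>K\<in>S. \<Sum>Y\<in>R. \<Sum>J\<in>S. F J Y K)" by (rule sum.swap)
  finally show ?thesis .
qed

section \<open>The relation for two vectors\<close>

locale mform_pt = mform +
  fixes x :: "coord \<Rightarrow> real"
  assumes x: "x \<in> U"
begin

abbreviation "xc X j \<equiv> cfun (crd X j) x"
abbreviation "P u K \<equiv> pairing n m u K x"
abbreviation "D1 X K \<equiv> sderiv (crd X K) L x"
abbreviation "D2 X K Y J \<equiv> sderiv (crd X K) (sderiv (crd Y J) L) x"
abbreviation homog :: "(idx \<Rightarrow> real) \<Rightarrow> nat \<Rightarrow> bool" where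
  "homog u a \<equiv> \<forall>A\<in>dimset n m. u A \<noteq> 0 \<longrightarrow> par A = a"

text \<open>Together with \<open>D2_outside\<close> this removes all terms in which a derivative in
  the additional row or column reaches L, which does not depend on it.\<close>

lemma D1_outside: "\<not> (X \<in> R \<and> K \<in> S) \<Longrightarrow> D1 X K = 0"
  by (rule sderiv_L_outside) (simp add: crd_coords)

lemma D2_outside: "\<not> (X \<in> R \<and> K \<in> S) \<Longrightarrow> D2 X K Y J = 0"
  by (rule sderiv_sderiv_L_outside[OF _ x]) (simp add: crd_coords)

lemma P_hom: "homog u a \<Longrightarrow> ghomogeneous (a + par K) (P u K)"
  by (rule ghom_pairing) blast

lemma chi_hom: "ghomogeneous (rpar X) (xc X (Even j))"
  using ghom_cfun_crd[of X "Even j" x] by simp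

lemma rval_hom: "homog u a \<Longrightarrow> X \<in> R \<Longrightarrow> rval u X \<noteq> 0 \<Longrightarrow> rpar X = a"
  by (auto simp: rval_def rows_def split: sum.splits)

lemma sderiv_e_vec:
  assumes v: "homog (vcomp n m e v) a'" and Z: "Z \<in> rows n m r' s"
  defines "w \<equiv> vcomp n m e v"
  shows "sderiv (crd Z K) (e_vec n m p q r s e v L) x = sg r *\<^sub>R (
     (if K = Even p then rval w Z else 0) *\<^sub>R L x + sg ((rpar Z + par K) * a') *\<^sub>R (P w (Even p) * D1 Z K)
     - (\<Sum>Y\<in>R. \<Sum>J\<in>S. sg (rpar Y * par J) *\<^sub>R (
          (if K = J then rval w Z else 0) *\<^sub>R (xc Y (Even p) * D1 Y J)
          + sg ((rpar Z + par K) * (a' + par J)) *\<^sub>R (P w J * (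
             (if Z = Y \<and> K = Even p then D1 Y J else 0)
             + sg ((rpar Z + par K) * rpar Y) *\<^sub>R (xc Y (Even p) * D2 Z K Y J))))))"
    (is "_ = sg r *\<^sub>R (_ - (\<Sum>Y\<in>R. \<Sum>J\<in>S. ?t Y J))")
proof -
  let ?c = "crd Z K"
  let ?h = "\<lambda>Y J x. cfun (crd Y (Even p)) x * sderiv (crd Y J) L x"
  let ?g = "\<lambda>Y J x. sg (rpar Y * par J) *\<^sub>R (pairing n m w J x * ?h Y J x)"
  note o = open_form_dom[of m q s]
  note ss = smooth_sfun_scaleR smooth_sfun_diff smooth_sfun_sum smooth_sfun_pairing_mult
        smooth_sfun_cfun_mult smooth_L smooth_DL o
  have wp: "\<And>A. A \<in> dimset n m \<Longrightarrow> w A \<noteq> 0 \<Longrightarrow> par A = a'" using v by (simp add: w_def)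
  have "sderiv ?c (e_vec n m p q r s e v L) x
    = sderiv ?c (\<lambda>x. sg r *\<^sub>R (pairing n m w (Even p) x * L x - (\<Sum>Y\<in>R. \<Sum>J\<in>S. ?g Y J x))) x"
    by (rule sderiv_cong[OF o x]) (simp add: e_vec_eq w_def)
  also have "\<dots> = sg r *\<^sub>R sderiv ?c (\<lambda>x. pairing n m w (Even p) x * L x - (\<Sum>Y\<in>R. \<Sum>J\<in>S. ?g Y J x)) x"
    by (intro sderiv_scaleR[OF _ o x] ss)
  also have "sderiv ?c (\<lambda>x. pairing n m w (Even p) x * L x - (\<Sum>Y\<in>R. \<Sum>J\<in>S. ?g Y J x)) x
    = sderiv ?c (\<lambda>x. pairing n m w (Even p) x * L x) x - sderiv ?c (\<lambda>x. \<Sum>Y\<in>R. \<Sum>J\<in>S. ?g Y J x) x"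
    by (intro sderiv_diff[OF _ _ o x] ss)
  also have "sderiv ?c (\<lambda>x. \<Sum>Y\<in>R. \<Sum>J\<in>S. ?g Y J x) x = (\<Sum>Y\<in>R. sderiv ?c (\<lambda>x. \<Sum>J\<in>S. ?g Y J x) x)"
    by (intro sderiv_sum[OF o x] ss)
  also have "\<dots> = (\<Sum>Y\<in>R. \<Sum>J\<in>S. sderiv ?c (?g Y J) x)"
    by (intro sum.cong refl sderiv_sum[OF o x] ss)
  also have "\<dots> = (\<Sum>Y\<in>R. \<Sum>J\<in>S. ?t Y J)"
  proof (intro sum.cong refl)
    fix Y J
    have "sderiv ?c (?g Y J) x = sg (rpar Y * par J) *\<^sub>R sderiv ?c (\<lambda>x. pairing n m w J x * ?h Y J x) x"
      by (intro sderiv_scaleR[OF _ o x] ss)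
    also have "sderiv ?c (\<lambda>x. pairing n m w J x * ?h Y J x) x
      = (if K = J then rval w Z else 0) *\<^sub>R (xc Y (Even p) * D1 Y J)
          + sg ((rpar Z + par K) * (a' + par J)) *\<^sub>R (P w J * sderiv ?c (?h Y J) x)"
      by (rule sderiv_pairing_mult[OF _ o x Z wp]) (intro ss)
    also have "sderiv ?c (?h Y J) x = (if ?c = crd Y (Even p) then D1 Y J else 0)
        + sg (cpar ?c * cpar (crd Y (Even p))) *\<^sub>R (xc Y (Even p) * D2 Z K Y J)"
      by (rule sderiv_cfun_mult[OF smooth_DL o x])
    also have "sg (cpar ?c * cpar (crd Y (Even p))) = sg ((rpar Z + par K) * rpar Y)"
      by (rule sg_cong) simp
    finally show "sderiv ?c (?g Y J) x = ?t Y J" by simp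
  qed
  also have "sderiv ?c (\<lambda>x. pairing n m w (Even p) x * L x) x
    = (if K = Even p then rval w Z else 0) *\<^sub>R L x + sg ((rpar Z + par K) * (a' + par (Even p))) *\<^sub>R (P w (Even p) * D1 Z K)"
    by (rule sderiv_pairing_mult[OF smooth_L o x Z wp])
  finally show ?thesis by simp
qed

text \<open>In the additional column only explicit coordinates are differentiated: the pairing
  yields the component of \<open>v\<close>, and the coefficient \<open>xc Y (Even p)\<close> leaves
  the row \<open>Y = Z\<close> alone.\<close>

lemma sderiv_e_vec_new:
  assumes v: "homog (vcomp n m e v) a'" and Z: "Z \<in> R"
  defines "w \<equiv> vcomp n m e v"
  shows "sderiv (crd Z (Even p)) (e_vec n m p q r s e v L) x
    = sg r *\<^sub>R (rval w Z *\<^sub>R L x - (\<Sum>J\<in>S. sg (rpar Z * a') *\<^sub>R (P w J * D1 Z J)))"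
proof -
  have "(\<Sum>Y\<in>R. \<Sum>J\<in>S. sg (rpar Y * par J) *\<^sub>R (
          (if Even p = J then rval w Z else 0) *\<^sub>R (xc Y (Even p) * D1 Y J)
          + sg ((rpar Z + par (Even p)) * (a' + par J)) *\<^sub>R (P w J * (
             (if Z = Y \<and> Even p = Even p then D1 Y J else 0)
             + sg ((rpar Z + par (Even p)) * rpar Y) *\<^sub>R (xc Y (Even p) * D2 Z (Even p) Y J)))))
    = (\<Sum>Y\<in>R. if Y = Z then \<Sum>J\<in>S. sg (rpar Z * a') *\<^sub>R (P w J * D1 Z J) else 0)"
  proof (rule sum.cong)
    fix Y
    have "sg (rpar Z * par J) *\<^sub>R (sg (rpar Z * (a' + par J)) *\<^sub>R W) = sg (rpar Z * a') *\<^sub>R W" for J and W :: "coord grass"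
      unfolding sg_scaleR by (rule sg_scaleR_cong) (simp only: even_add even_mult_iff, blast)
    moreover have "Even p \<noteq> J" if "J \<in> S" for J using that Even_notin_dimset by blast
    ultimately show "(\<Sum>J\<in>S. sg (rpar Y * par J) *\<^sub>R (
          (if Even p = J then rval w Z else 0) *\<^sub>R (xc Y (Even p) * D1 Y J)
          + sg ((rpar Z + par (Even p)) * (a' + par J)) *\<^sub>R (P w J * (
             (if Z = Y \<and> Even p = Even p then D1 Y J else 0)
             + sg ((rpar Z + par (Even p)) * rpar Y) *\<^sub>R (xc Y (Even p) * D2 Z (Even p) Y J)))))
      = (if Y = Z then \<Sum>J\<in>S. sg (rpar Z * a') *\<^sub>R (P w J * D1 Z J) else 0)"
      by (auto simp: D2_outside intro!: sum.cong sum.neutral)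
  qed simp
  also have "\<dots> = (\<Sum>J\<in>S. sg (rpar Z * a') *\<^sub>R (P w J * D1 Z J))"
    using Z by simp
  finally show ?thesis
    unfolding sderiv_e_vec[OF v Z] w_def[symmetric] by (simp add: D1_outside)
qed

lemma sderiv_e_vec_old:
  assumes v: "homog (vcomp n m e v) a'" and Z: "Z \<in> R" and K: "K \<in> S"
  defines "w \<equiv> vcomp n m e v"
  shows "sderiv (crd Z K) (e_vec n m p q r s e v L) x
    = sg r *\<^sub>R (sg ((rpar Z + par K) * a') *\<^sub>R (P w (Even p) * D1 Z K)
       - (\<Sum>Y\<in>R. sg (rpar Y * par K) *\<^sub>R (rval w Z *\<^sub>R (xc Y (Even p) * D1 Y K)))
       - (\<Sum>Y\<in>R. \<Sum>J\<in>S. sg (rpar Y * par J + (rpar Z + par K) * (a' + par J + rpar Y)) *\<^sub>R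
            (P w J * (xc Y (Even p) * D2 Z K Y J))))"
proof -
  have ne: "K \<noteq> Even p" using K Even_notin_dimset by blast
  have "(\<Sum>Y\<in>R. \<Sum>J\<in>S. sg (rpar Y * par J) *\<^sub>R (
          (if K = J then rval w Z else 0) *\<^sub>R (xc Y (Even p) * D1 Y J)
          + sg ((rpar Z + par K) * (a' + par J)) *\<^sub>R (P w J * (
             (if Z = Y \<and> K = Even p then D1 Y J else 0)
             + sg ((rpar Z + par K) * rpar Y) *\<^sub>R (xc Y (Even p) * D2 Z K Y J)))))
   = (\<Sum>Y\<in>R. \<Sum>J\<in>S. (if J = K then sg (rpar Y * par K) *\<^sub>R (rval w Z *\<^sub>R (xc Y (Even p) * D1 Y K)) else 0)
        + sg (rpar Y * par J + (rpar Z + par K) * (a' + par J + rpar Y)) *\<^sub>R (P w J * (xc Y (Even p) * D2 Z K Y J)))"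
  proof (intro sum.cong refl)
    fix Y J
    have "sg (rpar Y * par J) *\<^sub>R (sg ((rpar Z + par K) * (a' + par J)) *\<^sub>R (sg ((rpar Z + par K) * rpar Y) *\<^sub>R W))
      = sg (rpar Y * par J + (rpar Z + par K) * (a' + par J + rpar Y)) *\<^sub>R W" for W :: "coord grass"
      unfolding sg_scaleR by (rule sg_scaleR_cong) (simp only: even_add even_mult_iff, blast)
    then show "sg (rpar Y * par J) *\<^sub>R (
          (if K = J then rval w Z else 0) *\<^sub>R (xc Y (Even p) * D1 Y J)
          + sg ((rpar Z + par K) * (a' + par J)) *\<^sub>R (P w J * (
             (if Z = Y \<and> K = Even p then D1 Y J else 0)
             + sg ((rpar Z + par K) * rpar Y) *\<^sub>R (xc Y (Even p) * D2 Z K Y J))))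
      = (if J = K then sg (rpar Y * par K) *\<^sub>R (rval w Z *\<^sub>R (xc Y (Even p) * D1 Y K)) else 0)
        + sg (rpar Y * par J + (rpar Z + par K) * (a' + par J + rpar Y)) *\<^sub>R (P w J * (xc Y (Even p) * D2 Z K Y J))"
      using ne by (simp only: scaleR_add_right mult_scaleR_right if_False add_0 simp_thms) simp
  qed
  also have "\<dots> = (\<Sum>Y\<in>R. sg (rpar Y * par K) *\<^sub>R (rval w Z *\<^sub>R (xc Y (Even p) * D1 Y K)))
     + (\<Sum>Y\<in>R. \<Sum>J\<in>S. sg (rpar Y * par J + (rpar Z + par K) * (a' + par J + rpar Y)) *\<^sub>R (P w J * (xc Y (Even p) * D2 Z K Y J)))"
    using K by (simp add: sum.distrib)
  finally show ?thesis
    unfolding sderiv_e_vec[OF v Z] w_def[symmetric] using ne by (simp add: diff_diff_add)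
qed

text \<open>First-order part of e(w), with a free number \<open>j\<close> for the additional column.
  In a composition either vector can be paired with either of the two additional columns, so both
  \<open>p\<close> and \<open>Suc p\<close> occur.\<close>

definition DD :: "(idx \<Rightarrow> real) \<Rightarrow> nat \<Rightarrow> coord grass" where
  "DD w j = (\<Sum>X\<in>R. \<Sum>K\<in>S. sg (rpar X * par K) *\<^sub>R (P w K * (xc X (Even j) * D1 X K)))"

definition QQ :: "(idx \<Rightarrow> real) \<Rightarrow> (idx \<Rightarrow> real) \<Rightarrow> nat \<Rightarrow> coord grass" where
  "QQ u v a' = (\<Sum>X\<in>R. \<Sum>K\<in>S. \<Sum>Y\<in>R. \<Sum>J\<in>S.
     sg (rpar X * par K + (rpar Y * par J + (rpar X + par K) * (a' + par J + rpar Y))) *\<^sub>R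
       (P u K * (xc X (Even (Suc p)) * (P v J * (xc Y (Even p) * D2 X K Y J)))))"

lemma e_vec_L: "e_vec n m p q r s e v L x = sg r *\<^sub>R (P (vcomp n m e v) (Even p) * L x - DD (vcomp n m e v) p)"
  using e_vec_eq[OF x] by (simp add: DD_def)

text \<open>The terms of order at most one are arranged so that each meets its negative when
  \<open>u\<close> and \<open>v\<close> are exchanged: the first and third, the second and sixth,
  the fourth and fifth. What remains of the anticommutator is \<open>QQ\<close>.\<close>

lemma e_vec_e_vec:
  assumes hu: "homog (vcomp n m e u) a" and hv: "homog (vcomp n m e v) a'"
  defines "u' \<equiv> vcomp n m e u" and "v' \<equiv> vcomp n m e v"
  shows "e_vec n m (Suc p) q r s e u (e_vec n m p q r s e v L) x
    = P u' (Even (Suc p)) * (P v' (Even p) * L x) - P u' (Even (Suc p)) * DD v' p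
      - P u' (Even p) * (P v' (Even (Suc p)) * L x) + P u' (Even p) * DD v' (Suc p)
      - sg (a * a') *\<^sub>R (P v' (Even p) * DD u' (Suc p)) + sg (a * a') *\<^sub>R (P v' (Even (Suc p)) * DD u' p)
      + QQ u' v' a'"
proof -
  let ?N = "e_vec n m p q r s e v L" and ?q = "Even (Suc p)" and ?p = "Even p"
  \<comment> \<open>The factor absorbed here is the sign of the outer operator; it cancels that of
    the inner one, since \<open>r\<close> is the same for both.\<close>
  define N0 where "N0 = (\<lambda>X K. sg r *\<^sub>R sderiv (crd X K) ?N x)"
  have hu': "homog u' a" and hv': "homog v' a'" using hu hv by (simp_all add: u'_def v'_def)
  have new: "N0 X ?p = rval v' X *\<^sub>R L x - (\<Sum>J\<in>S. sg (rpar X * a') *\<^sub>R (P v' J * D1 X J))" if "X \<in> R" for X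
    unfolding N0_def sderiv_e_vec_new[OF hv that] v'_def[symmetric] by simp
  have old: "N0 X K = sg ((rpar X + par K) * a') *\<^sub>R (P v' ?p * D1 X K)
       - (\<Sum>Y\<in>R. sg (rpar Y * par K) *\<^sub>R (rval v' X *\<^sub>R (xc Y ?p * D1 Y K)))
       - (\<Sum>Y\<in>R. \<Sum>J\<in>S. sg (rpar Y * par J + (rpar X + par K) * (a' + par J + rpar Y)) *\<^sub>R
            (P v' J * (xc Y ?p * D2 X K Y J)))" if "X \<in> R" "K \<in> S" for X K
    unfolding N0_def sderiv_e_vec_old[OF hv that] v'_def[symmetric] by simp
  \<comment> \<open>The additional column of the inner operator is an ordinary column for the outer
    one; this is its contribution.\<close>
  have A: "(\<Sum>X\<in>R. P u' ?p * (xc X ?q * N0 X ?p)) = P u' ?p * (P v' ?q * L x) - P u' ?p * DD v' (Suc p)"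
  proof -
    have "(\<Sum>X\<in>R. xc X ?q * N0 X ?p) = (\<Sum>X\<in>R. rval v' X *\<^sub>R (xc X ?q * L x)
        - (\<Sum>J\<in>S. sg (rpar X * par J) *\<^sub>R (P v' J * (xc X ?q * D1 X J))))"
    proof (rule sum.cong)
      fix X assume X: "X \<in> R"
      have "xc X ?q * (sg (rpar X * a') *\<^sub>R (P v' J * D1 X J)) = sg (rpar X * par J) *\<^sub>R (P v' J * (xc X ?q * D1 X J))" for J
        unfolding mult_scaleR_right ghom_swap[OF chi_hom P_hom[OF hv']] sg_scaleR
        by (rule sg_scaleR_cong) (simp only: even_add even_mult_iff, blast)
      then show "xc X ?q * N0 X ?p = rval v' X *\<^sub>R (xc X ?q * L x)
        - (\<Sum>J\<in>S. sg (rpar X * par J) *\<^sub>R (P v' J * (xc X ?q * D1 X J)))"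
        unfolding new[OF X] by (simp add: right_diff_distrib sum_distrib_left)
    qed simp
    also have "\<dots> = P v' ?q * L x - DD v' (Suc p)"
      by (simp add: sum_subtractf DD_def pairing_rows[of n m v' _ _ r s] sum_distrib_right)
    finally show ?thesis by (simp add: sum_distrib_left[symmetric] right_diff_distrib)
  qed
  have B1: "(\<Sum>X\<in>R. \<Sum>K\<in>S. sg (rpar X * par K) *\<^sub>R (P u' K * (xc X ?q * (sg ((rpar X + par K) * a') *\<^sub>R (P v' ?p * D1 X K)))))
     = sg (a * a') *\<^sub>R (P v' ?p * DD u' (Suc p))"
    unfolding DD_def sum_distrib_left scaleR_sum_right
  proof (intro sum.cong refl)
    fix X K
    have m: "P u' K * (xc X ?q * (P v' ?p * D1 X K)) = sg (rpar X * a' + (a + par K) * a') *\<^sub>R (P v' ?p * (P u' K * (xc X ?q * D1 X K)))"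
      using ghom_swap[OF chi_hom P_hom[OF hv', of ?p], of X "Suc p"] ghom_swap[OF P_hom[OF hu', of K] P_hom[OF hv', of ?p]]
      by (simp add: power_add)
    show "sg (rpar X * par K) *\<^sub>R (P u' K * (xc X ?q * (sg ((rpar X + par K) * a') *\<^sub>R (P v' ?p * D1 X K))))
      = sg (a * a') *\<^sub>R (P v' ?p * (sg (rpar X * par K) *\<^sub>R (P u' K * (xc X ?q * D1 X K))))"
      unfolding mult_scaleR_right m sg_scaleR by (rule sg_scaleR_cong) (simp only: even_add even_mult_iff, blast)
  qed
  \<comment> \<open>The outer derivative hits the pairing of \<open>v\<close> in an old column.
    Summed over \<open>X\<close> against the entries of the column \<open>?q\<close>, the resulting
    components of \<open>v\<close> form the pairing in that column.\<close>
  have B2: "(\<Sum>X\<in>R. \<Sum>K\<in>S. sg (rpar X * par K) *\<^sub>R (P u' K * (xc X ?q *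
       (\<Sum>Y\<in>R. sg (rpar Y * par K) *\<^sub>R (rval v' X *\<^sub>R (xc Y ?p * D1 Y K))))))
     = sg (a * a') *\<^sub>R (P v' ?q * DD u' p)"
  proof -
    have "(\<Sum>X\<in>R. \<Sum>K\<in>S. sg (rpar X * par K) *\<^sub>R (P u' K * (xc X ?q *
       (\<Sum>Y\<in>R. sg (rpar Y * par K) *\<^sub>R (rval v' X *\<^sub>R (xc Y ?p * D1 Y K))))))
      = (\<Sum>X\<in>R. \<Sum>K\<in>S. \<Sum>Y\<in>R. sg (a * a') *\<^sub>R (rval v' X *\<^sub>R (xc X ?q * (sg (rpar Y * par K) *\<^sub>R (P u' K * (xc Y ?p * D1 Y K))))))"
      unfolding sum_distrib_left scaleR_sum_right
    proof (intro sum.cong refl)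
      fix X K Y assume X: "X \<in> R"
      show "sg (rpar X * par K) *\<^sub>R (P u' K * (xc X ?q * (sg (rpar Y * par K) *\<^sub>R (rval v' X *\<^sub>R (xc Y ?p * D1 Y K)))))
        = sg (a * a') *\<^sub>R (rval v' X *\<^sub>R (xc X ?q * (sg (rpar Y * par K) *\<^sub>R (P u' K * (xc Y ?p * D1 Y K)))))"
      proof (cases "rval v' X = 0")
        case False
        then have a': "rpar X = a'" using rval_hom[OF hv' X] by blast
        have "P u' K * (xc X ?q * W) = sg ((a + par K) * a') *\<^sub>R (xc X ?q * (P u' K * W))" for W
          using ghom_swap[OF P_hom[OF hu', of K] chi_hom[of X "Suc p"]] a' by simp
        then have "sg (rpar X * par K) *\<^sub>R (P u' K * (xc X ?q * (sg (rpar Y * par K) *\<^sub>R (rval v' X *\<^sub>R (xc Y ?p * D1 Y K)))))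
          = sg (a' * par K) *\<^sub>R (sg ((a + par K) * a') *\<^sub>R (sg (rpar Y * par K) *\<^sub>R (rval v' X *\<^sub>R (xc X ?q * (P u' K * (xc Y ?p * D1 Y K))))))"
          by (simp add: a')
        also have "\<dots> = sg (a * a') *\<^sub>R (sg (rpar Y * par K) *\<^sub>R (rval v' X *\<^sub>R (xc X ?q * (P u' K * (xc Y ?p * D1 Y K)))))"
          unfolding sg_scaleR by (rule sg_scaleR_cong) (simp only: even_add even_mult_iff, blast)
        finally show ?thesis by (simp add: mult.commute mult.left_commute)
      qed simp
    qed
    also have "\<dots> = (\<Sum>X\<in>R. \<Sum>Y\<in>R. \<Sum>K\<in>S. sg (a * a') *\<^sub>R (rval v' X *\<^sub>R (xc X ?q * (sg (rpar Y * par K) *\<^sub>R (P u' K * (xc Y ?p * D1 Y K))))))"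
      by (intro sum.cong refl sum.swap)
    also have "\<dots> = sg (a * a') *\<^sub>R (P v' ?q * DD u' p)"
      unfolding pairing_rows[of n m v' _ _ r s] DD_def sum_distrib_right
      by (simp only: sum_distrib_left scaleR_sum_right mult_scaleR_left)
    finally show ?thesis .
  qed
  have B: "(\<Sum>X\<in>R. \<Sum>K\<in>S. sg (rpar X * par K) *\<^sub>R (P u' K * (xc X ?q * N0 X K)))
     = sg (a * a') *\<^sub>R (P v' ?p * DD u' (Suc p)) - sg (a * a') *\<^sub>R (P v' ?q * DD u' p) - QQ u' v' a'"
    unfolding B1[symmetric] B2[symmetric] QQ_def sum_subtractf[symmetric]
    by (intro sum.cong refl)
       (simp only: old right_diff_distrib scaleR_diff_right sum_distrib_left scaleR_sum_right mult_scaleR_right sg_scaleR)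
  have "e_vec n m (Suc p) q r s e u ?N x = sg r *\<^sub>R (P u' ?q * ?N x)
     - (\<Sum>X\<in>R. \<Sum>K\<in>dimset (Suc p) q. sg (rpar X * par K) *\<^sub>R (P u' K * (xc X ?q * N0 X K)))"
    unfolding e_vec_eq[OF x] u'_def[symmetric] N0_def
    by (simp add: scaleR_diff_right scaleR_sum_right mult.commute)
  also have "(\<Sum>X\<in>R. \<Sum>K\<in>dimset (Suc p) q. sg (rpar X * par K) *\<^sub>R (P u' K * (xc X ?q * N0 X K)))
     = (\<Sum>X\<in>R. P u' ?p * (xc X ?q * N0 X ?p)) + (\<Sum>X\<in>R. \<Sum>K\<in>S. sg (rpar X * par K) *\<^sub>R (P u' K * (xc X ?q * N0 X K)))"
    by (simp add: dimset_Suc sum.distrib)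
  also have "sg r *\<^sub>R (P u' ?q * ?N x) = P u' ?q * (P v' ?p * L x) - P u' ?q * DD v' p"
    unfolding e_vec_L v'_def[symmetric] by (simp add: right_diff_distrib)
  finally show ?thesis unfolding A B by simp
qed

text \<open>After \<open>K\<close> and \<open>J\<close> are renamed in \<open>QQ v u a\<close>, the
  summands differ from those of \<open>QQ u v a'\<close> by an exchange of the columns in the second
  derivative. \<open>pde_col\<close> undoes it at the price of a minus sign; the other signs come
  from reordering the pairings.\<close>

lemma QQ_anti:
  assumes hu: "homog u a" and hv: "homog v a'"
  shows "QQ u v a' + sg (a * a') *\<^sub>R QQ v u a = 0"
proof -
  let ?q = "Even (Suc p)" and ?p = "Even p"
  have "sg (a * a') *\<^sub>R QQ v u a = (\<Sum>X\<in>R. \<Sum>K\<in>S. \<Sum>Y\<in>R. \<Sum>J\<in>S. sg (a * a') *\<^sub>R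
     (sg (rpar X * par K + (rpar Y * par J + (rpar X + par K) * (a + par J + rpar Y))) *\<^sub>R
       (P v K * (xc X ?q * (P u J * (xc Y ?p * D2 X K Y J))))))"
    by (simp only: QQ_def scaleR_sum_right)
  also have "\<dots> = (\<Sum>X\<in>R. \<Sum>K\<in>S. \<Sum>Y\<in>R. \<Sum>J\<in>S. sg (a * a') *\<^sub>R
     (sg (rpar X * par J + (rpar Y * par K + (rpar X + par J) * (a + par K + rpar Y))) *\<^sub>R
       (P v J * (xc X ?q * (P u K * (xc Y ?p * D2 X J Y K))))))"
    by (intro sum.cong refl sum3_swap)
  also have "\<dots> = (\<Sum>X\<in>R. \<Sum>K\<in>S. \<Sum>Y\<in>R. \<Sum>J\<in>S.
     - (sg (rpar X * par K + (rpar Y * par J + (rpar X + par K) * (a' + par J + rpar Y))) *\<^sub>R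
       (P u K * (xc X ?q * (P v J * (xc Y ?p * D2 X K Y J))))))"
  proof (intro sum.cong refl)
    fix X K Y J assume i: "X \<in> R" "K \<in> S" "Y \<in> R" "J \<in> S"
    have 1: "P v J * (xc X ?q * (P u K * W)) = sg (rpar X * (a + par K) + (a' + par J) * (a + par K)) *\<^sub>R (P u K * (P v J * (xc X ?q * W)))" for W
      using ghom_swap[OF chi_hom P_hom[OF hu, of K], of X "Suc p"] ghom_swap[OF P_hom[OF hv, of J] P_hom[OF hu, of K]]
      by (simp add: power_add)
    have 2: "P u K * (xc X ?q * (P v J * W)) = sg (rpar X * (a' + par J)) *\<^sub>R (P u K * (P v J * (xc X ?q * W)))" for W
      using ghom_swap[OF chi_hom P_hom[OF hv, of J], of X "Suc p"] by simp
    show "sg (a * a') *\<^sub>R (sg (rpar X * par J + (rpar Y * par K + (rpar X + par J) * (a + par K + rpar Y))) *\<^sub>R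
       (P v J * (xc X ?q * (P u K * (xc Y ?p * D2 X J Y K)))))
      = - (sg (rpar X * par K + (rpar Y * par J + (rpar X + par K) * (a' + par J + rpar Y))) *\<^sub>R
       (P u K * (xc X ?q * (P v J * (xc Y ?p * D2 X K Y J)))))"
      unfolding pde_col[OF i(1,3,2,4) x] 1 2 scaleR_minus_left mult_minus_right scaleR_minus_right minus_minus mult_scaleR_right sg_scaleR
      by (rule sg_scaleR_cong) (simp only: even_add even_mult_iff, blast)
  qed
  also have "\<dots> = - QQ u v a'" by (simp only: QQ_def sum_negf)
  finally show ?thesis by simp
qed

lemma e_vec_anticommute:
  assumes hu: "homog (vcomp n m e u) a" and hv: "homog (vcomp n m e v) a'"
  shows "e_vec n m (Suc p) q r s e u (e_vec n m p q r s e v L) x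
    + sg (a * a') *\<^sub>R e_vec n m (Suc p) q r s e v (e_vec n m p q r s e u L) x = 0"
proof -
  let ?u = "vcomp n m e u" and ?v = "vcomp n m e v"
  have sq: "sg (a * a') * sg (a' * a) = 1"
    by (simp add: mult.commute flip: power_add power_mult_distrib)
  have sw: "P ?u (Even i) * (P ?v (Even j) * W) = sg (a * a') *\<^sub>R (P ?v (Even j) * (P ?u (Even i) * W))" for i j W
    using ghom_swap[OF P_hom[OF hu, of "Even i"] P_hom[OF hv, of "Even j"]] by simp
  have "QQ ?u ?v a' = - (sg (a * a') *\<^sub>R QQ ?v ?u a)"
    using QQ_anti[OF hu hv] by (simp add: add_eq_0_iff2)
  then show ?thesis
    unfolding e_vec_e_vec[OF hu hv] e_vec_e_vec[OF hv hu] sw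
    by (simp add: scaleR_add_right scaleR_diff_right sq)
qed

end

section \<open>Operators of covectors\<close>

lemma sum4_swap:
  "(\<Sum>X\<in>R. \<Sum>K\<in>S. \<Sum>C\<in>A. \<Sum>J\<in>T. F X K C J) = (\<Sum>C\<in>A. \<Sum>J\<in>T. \<Sum>X\<in>R. \<Sum>K\<in>S. F X K C J)"
proof -
  have "(\<Sum>X\<in>R. \<Sum>K\<in>S. \<Sum>C\<in>A. \<Sum>J\<in>T. F X K C J) = (\<Sum>X\<in>R. \<Sum>C\<in>A. \<Sum>K\<in>S. \<Sum>J\<in>T. F X K C J)"
    by (intro sum.cong refl sum.swap)
  also have "\<dots> = (\<Sum>X\<in>R. \<Sum>C\<in>A. \<Sum>J\<in>T. \<Sum>K\<in>S. F X K C J)"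
    by (intro sum.cong refl sum.swap)
  also have "\<dots> = (\<Sum>C\<in>A. \<Sum>X\<in>R. \<Sum>J\<in>T. \<Sum>K\<in>S. F X K C J)" by (rule sum.swap)
  also have "\<dots> = (\<Sum>C\<in>A. \<Sum>J\<in>T. \<Sum>X\<in>R. \<Sum>K\<in>S. F X K C J)"
    by (intro sum.cong refl sum.swap)
  finally show ?thesis .
qed

definition ccomp :: "(idx \<Rightarrow> 'v) \<Rightarrow> nat \<Rightarrow> ('v \<Rightarrow> real) \<Rightarrow> idx \<Rightarrow> real" where
  "ccomp e b \<alpha> A = \<alpha> (e A) * sg (b * par A)"

context mform_pt
begin


lemma e_covec_eq: "y \<in> U \<Longrightarrow> e_covec n m p' q r' s e b \<alpha> f y = sg r' *\<^sub>R
    (\<Sum>A\<in>dimset n m. \<Sum>K\<in>dimset p' q. ccomp e b \<alpha> A *\<^sub>R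
       (cfun (crd (Inr (Even r')) K) y * sderiv (crd (Inl A) K) f y))"
  by (simp add: e_covec_def restr_def ccomp_def)

lemma sderiv_e_covec:
  fixes e :: "idx \<Rightarrow> 'v::real_vector" and b :: nat and \<alpha> :: "'v \<Rightarrow> real"
  defines "al \<equiv> ccomp e b \<alpha>"
  shows "sderiv (crd Z K) (e_covec n m p q r s e b \<alpha> L) x = sg r *\<^sub>R (\<Sum>B\<in>dimset n m. \<Sum>J\<in>S. al B *\<^sub>R (
      (if Z = wr \<and> K = J then D1 (Inl B) J else 0)
      + sg ((rpar Z + par K) * par J) *\<^sub>R (xc wr J * D2 Z K (Inl B) J)))"
    (is "_ = sg r *\<^sub>R (\<Sum>B\<in>?A. \<Sum>J\<in>S. ?t B J)")
proof -
  let ?c = "crd Z K"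
  let ?h = "\<lambda>B J x. cfun (crd wr J) x * sderiv (crd (Inl B) J) L x"
  note o = open_form_dom[of m q s]
  note ss = smooth_sfun_scaleR smooth_sfun_sum smooth_sfun_cfun_mult smooth_DL o
  have "sderiv ?c (e_covec n m p q r s e b \<alpha> L) x
    = sderiv ?c (\<lambda>x. sg r *\<^sub>R (\<Sum>B\<in>?A. \<Sum>J\<in>S. al B *\<^sub>R ?h B J x)) x"
    by (rule sderiv_cong[OF o x]) (simp only: e_covec_eq al_def)
  also have "\<dots> = sg r *\<^sub>R sderiv ?c (\<lambda>x. \<Sum>B\<in>?A. \<Sum>J\<in>S. al B *\<^sub>R ?h B J x) x"
    by (intro sderiv_scaleR[OF _ o x] ss)
  also have "sderiv ?c (\<lambda>x. \<Sum>B\<in>?A. \<Sum>J\<in>S. al B *\<^sub>R ?h B J x) x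
    = (\<Sum>B\<in>?A. sderiv ?c (\<lambda>x. \<Sum>J\<in>S. al B *\<^sub>R ?h B J x) x)"
    by (intro sderiv_sum[OF o x] ss)
  also have "\<dots> = (\<Sum>B\<in>?A. \<Sum>J\<in>S. sderiv ?c (\<lambda>x. al B *\<^sub>R ?h B J x) x)"
    by (intro sum.cong refl sderiv_sum[OF o x] ss)
  also have "\<dots> = (\<Sum>B\<in>?A. \<Sum>J\<in>S. ?t B J)"
  proof (intro sum.cong refl)
    fix B J
    have "sderiv ?c (\<lambda>x. al B *\<^sub>R ?h B J x) x = al B *\<^sub>R sderiv ?c (?h B J) x"
      by (intro sderiv_scaleR[OF _ o x] ss)
    also have "sderiv ?c (?h B J) x = (if ?c = crd wr J then D1 (Inl B) J else 0)
        + sg (cpar ?c * cpar (crd wr J)) *\<^sub>R (xc wr J * D2 Z K (Inl B) J)"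
      by (rule sderiv_cfun_mult[OF smooth_DL o x])
    also have "sg (cpar ?c * cpar (crd wr J)) = sg ((rpar Z + par K) * par J)"
      by (rule sg_cong) simp
    finally show "sderiv ?c (\<lambda>x. al B *\<^sub>R ?h B J x) x = ?t B J" by (simp only: crd_eq)
  qed
  finally show ?thesis .
qed

lemma sderiv_e_covec_old:
  assumes "Z \<in> R"
  shows "sderiv (crd Z K) (e_covec n m p q r s e b \<alpha> L) x = sg r *\<^sub>R (\<Sum>B\<in>dimset n m. \<Sum>J\<in>S.
      ccomp e b \<alpha> B *\<^sub>R (sg ((rpar Z + par K) * par J) *\<^sub>R (xc wr J * D2 Z K (Inl B) J)))"
proof -
  have "Z \<noteq> wr" using assms Inr_notin_rows by blast
  then show ?thesis unfolding sderiv_e_covec by simp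
qed

lemma sderiv_e_covec_new:
  assumes K: "K \<in> S"
  shows "sderiv (crd wr K) (e_covec n m p q r s e b \<alpha> L) x = sg r *\<^sub>R (\<Sum>B\<in>dimset n m. ccomp e b \<alpha> B *\<^sub>R D1 (Inl B) K)"
proof -
  have "(\<Sum>J\<in>S. ccomp e b \<alpha> B *\<^sub>R ((if wr = wr \<and> K = J then D1 (Inl B) J else 0)
      + sg ((rpar wr + par K) * par J) *\<^sub>R (xc wr J * D2 wr K (Inl B) J)))
    = (\<Sum>J\<in>S. if J = K then ccomp e b \<alpha> B *\<^sub>R D1 (Inl B) K else 0)" for B
  proof (rule sum.cong)
    fix J
    have "D2 wr K (Inl B) J = 0" by (rule D2_outside) (use Inr_notin_rows in blast)
    then show "ccomp e b \<alpha> B *\<^sub>R ((if wr = wr \<and> K = J then D1 (Inl B) J else 0)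
      + sg ((rpar wr + par K) * par J) *\<^sub>R (xc wr J * D2 wr K (Inl B) J))
      = (if J = K then ccomp e b \<alpha> B *\<^sub>R D1 (Inl B) K else 0)"
      by (simp del: crd.simps)
  qed simp
  then show ?thesis unfolding sderiv_e_covec using K by simp
qed

lemma wr_hom: "ghomogeneous (par K) (cfun (crd (Inr (Even j)) K) x)"
  using ghom_cfun_crd[of "Inr (Even j)" K x] by simp

text \<open>The outer derivatives are in rows of p, whereas the coefficients of the inner operator
  are entries of w. So there are only second-order terms, and the minus sign stems from the factors
  with exponents \<open>r\<close> and \<open>Suc r\<close>.\<close>

lemma e_covec_e_covec:
  "e_covec n m p q (Suc r) s e b \<alpha> (e_covec n m p q r s e b' \<beta> L) x
   = - (\<Sum>A\<in>dimset n m. \<Sum>K\<in>S. \<Sum>B\<in>dimset n m. \<Sum>J\<in>S. (ccomp e b \<alpha> A * ccomp e b' \<beta> B) *\<^sub>R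
       (sg ((par A + par K) * par J) *\<^sub>R
        (xc (Inr (Even (Suc r))) K * (xc wr J * D2 (Inl A) K (Inl B) J))))"
proof -
  have "sderiv (crd (Inl A) K) (e_covec n m p q r s e b' \<beta> L) x = sg r *\<^sub>R (\<Sum>B\<in>dimset n m. \<Sum>J\<in>S.
      ccomp e b' \<beta> B *\<^sub>R (sg ((par A + par K) * par J) *\<^sub>R (xc wr J * D2 (Inl A) K (Inl B) J)))"
    if "A \<in> dimset n m" for A K
  proof -
    have "Inl A \<in> R" using that by (auto simp: rows_def)
    from sderiv_e_covec_old[OF this] show ?thesis by (simp only: rpar.simps)
  qed
  then have "e_covec n m p q (Suc r) s e b \<alpha> (e_covec n m p q r s e b' \<beta> L) x = sg (Suc r) *\<^sub>R
    (\<Sum>A\<in>dimset n m. \<Sum>K\<in>S. ccomp e b \<alpha> A *\<^sub>R (xc (Inr (Even (Suc r))) K * (sg r *\<^sub>R (\<Sum>B\<in>dimset n m. \<Sum>J\<in>S.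
      ccomp e b' \<beta> B *\<^sub>R (sg ((par A + par K) * par J) *\<^sub>R (xc wr J * D2 (Inl A) K (Inl B) J))))))"
    unfolding e_covec_eq[OF x] by simp
  also have "\<dots> = sg (Suc r) *\<^sub>R (sg r *\<^sub>R (\<Sum>A\<in>dimset n m. \<Sum>K\<in>S. \<Sum>B\<in>dimset n m. \<Sum>J\<in>S. (ccomp e b \<alpha> A * ccomp e b' \<beta> B) *\<^sub>R
       (sg ((par A + par K) * par J) *\<^sub>R
        (xc (Inr (Even (Suc r))) K * (xc wr J * D2 (Inl A) K (Inl B) J)))))"
    by (simp add: sum_distrib_left scaleR_sum_right mult_ac)
  also have "\<dots> = - (\<Sum>A\<in>dimset n m. \<Sum>K\<in>S. \<Sum>B\<in>dimset n m. \<Sum>J\<in>S. (ccomp e b \<alpha> A * ccomp e b' \<beta> B) *\<^sub>R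
       (sg ((par A + par K) * par J) *\<^sub>R
        (xc (Inr (Even (Suc r))) K * (xc wr J * D2 (Inl A) K (Inl B) J))))"
    by simp
  finally show ?thesis .
qed

text \<open>Exchanging the two covectors exchanges the rows \<open>A\<close> and \<open>B\<close>
  and leaves the columns tied to the two additional rows of w. Hence the row version
  \<open>pde\<close> applies directly.\<close>

lemma e_covec_anticommute:
  assumes ha: "homog (ccomp e b \<alpha>) b" and hb: "homog (ccomp e b' \<beta>) b'"
  shows "e_covec n m p q (Suc r) s e b \<alpha> (e_covec n m p q r s e b' \<beta> L) x
    + sg (b * b') *\<^sub>R e_covec n m p q (Suc r) s e b' \<beta> (e_covec n m p q r s e b \<alpha> L) x = 0"
proof -
  let ?A = "dimset n m" and ?al = "ccomp e b \<alpha>" and ?be = "ccomp e b' \<beta>" and ?w = "Inr (Even (Suc r)) :: idx + idx"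
  have "(\<Sum>A\<in>?A. \<Sum>K\<in>S. \<Sum>B\<in>?A. \<Sum>J\<in>S. (?be A * ?al B) *\<^sub>R
       (sg ((par A + par K) * par J) *\<^sub>R (xc ?w K * (xc wr J * D2 (Inl A) K (Inl B) J))))
     = (\<Sum>A\<in>?A. \<Sum>K\<in>S. \<Sum>B\<in>?A. \<Sum>J\<in>S. (?be B * ?al A) *\<^sub>R
       (sg ((par B + par K) * par J) *\<^sub>R (xc ?w K * (xc wr J * D2 (Inl B) K (Inl A) J))))"
    by (rule sum3_swap)
  then have "sg (b * b') *\<^sub>R (\<Sum>A\<in>?A. \<Sum>K\<in>S. \<Sum>B\<in>?A. \<Sum>J\<in>S. (?be A * ?al B) *\<^sub>R
       (sg ((par A + par K) * par J) *\<^sub>R (xc ?w K * (xc wr J * D2 (Inl A) K (Inl B) J))))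
     = (\<Sum>A\<in>?A. \<Sum>K\<in>S. \<Sum>B\<in>?A. \<Sum>J\<in>S. sg (b * b') *\<^sub>R ((?be B * ?al A) *\<^sub>R
       (sg ((par B + par K) * par J) *\<^sub>R (xc ?w K * (xc wr J * D2 (Inl B) K (Inl A) J)))))"
    by (simp only: scaleR_sum_right)
  also have "\<dots> = (\<Sum>A\<in>?A. \<Sum>K\<in>S. \<Sum>B\<in>?A. \<Sum>J\<in>S. - ((?al A * ?be B) *\<^sub>R
       (sg ((par A + par K) * par J) *\<^sub>R (xc ?w K * (xc wr J * D2 (Inl A) K (Inl B) J)))))"
  proof (intro sum.cong refl)
    fix A K B J assume i: "A \<in> ?A" "K \<in> S" "B \<in> ?A" "J \<in> S"
    show "sg (b * b') *\<^sub>R ((?be B * ?al A) *\<^sub>R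
       (sg ((par B + par K) * par J) *\<^sub>R (xc ?w K * (xc wr J * D2 (Inl B) K (Inl A) J))))
      = - ((?al A * ?be B) *\<^sub>R
       (sg ((par A + par K) * par J) *\<^sub>R (xc ?w K * (xc wr J * D2 (Inl A) K (Inl B) J))))"
    proof (cases "?al A = 0 \<or> ?be B = 0")
      case False
      then have pA: "b = par A" and pB: "b' = par B" using ha hb i by auto
      have AB: "Inl A \<in> R" "Inl B \<in> R" using i by (auto simp: rows_def)
      have D: "D2 (Inl A) K (Inl B) J = - (sg (par A * par B + (par A + par B) * par J) *\<^sub>R D2 (Inl B) K (Inl A) J)"
        using pde[OF AB i(2,4) x] by (simp add: add_eq_0_iff2)
      let ?W = "xc ?w K * (xc wr J * D2 (Inl B) K (Inl A) J)"
      have "sg (par A * par B) *\<^sub>R (sg ((par B + par K) * par J) *\<^sub>R ?W)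
         = sg ((par A + par K) * par J) *\<^sub>R (sg (par A * par B + (par A + par B) * par J) *\<^sub>R ?W)"
        unfolding sg_scaleR by (rule sg_scaleR_cong) (simp only: even_add even_mult_iff, blast)
      then have "(?al A * ?be B) *\<^sub>R (sg (par A * par B) *\<^sub>R (sg ((par B + par K) * par J) *\<^sub>R ?W))
         = (?al A * ?be B) *\<^sub>R (sg ((par A + par K) * par J) *\<^sub>R (sg (par A * par B + (par A + par B) * par J) *\<^sub>R ?W))"
        by (rule arg_cong)
      then show ?thesis unfolding D pA[symmetric] pB[symmetric]
        by (simp only: mult_minus_right scaleR_minus_right minus_minus mult_scaleR_right)
           (simp only: scaleR_scaleR mult.commute mult.left_commute)
    qed auto
  qed
  also have "\<dots> = - (\<Sum>A\<in>?A. \<Sum>K\<in>S. \<Sum>B\<in>?A. \<Sum>J\<in>S. (?al A * ?be B) *\<^sub>R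
       (sg ((par A + par K) * par J) *\<^sub>R (xc ?w K * (xc wr J * D2 (Inl A) K (Inl B) J))))"
    by (simp only: sum_negf)
  finally show ?thesis unfolding e_covec_e_covec scaleR_minus_right by simp
qed

section \<open>The mixed relation\<close>

definition sigma_val :: "coord grass" where
  "sigma_val = xc wr (Even p) * L x
     - (\<Sum>Y\<in>R. \<Sum>K\<in>S. sg (rpar Y * par K) *\<^sub>R (xc wr K * (xc Y (Even p) * D1 Y K)))"

text \<open>e(u) carries one more sign after e(\<alpha>) than before it, because \<open>r\<close>
  has grown. The terms common to both compositions therefore cancel in the sum; those that survive
  have the derivative of e(\<alpha>) acting on a pairing with \<open>u\<close>.\<close>

lemma e_vec_e_covec:
  assumes hu: "homog (vcomp n m e u) a" and ha: "homog (ccomp e b \<alpha>) b"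
  shows "e_vec n m p q (Suc r) s e u (e_covec n m p q r s e b \<alpha> L) x
    + sg (b * a) *\<^sub>R e_covec n m (Suc p) q r s e b \<alpha> (e_vec n m p q r s e u L) x
    = (\<Sum>C\<in>dimset n m. vcomp n m e u C * \<alpha> (e C)) *\<^sub>R sigma_val"
proof -
  let ?A = "dimset n m" and ?p = "Even p"
  define al where "al = ccomp e b \<alpha>"
  define w where "w = vcomp n m e u"
  have hu': "homog w a" and ha': "homog al b" using hu ha by (simp_all add: w_def al_def)
  let ?cov = "e_covec n m p q r s e b \<alpha> L" and ?vec = "e_vec n m p q r s e u L"
  \<comment> \<open>\<open>a1\<close>, \<open>a2\<close> and \<open>a3\<close> stem from the
    multiplication in e(u), from derivatives in the original rows, and from derivatives in the
    additional row. Their partners in the other composition are \<open>b3\<close>, \<open>b5\<close>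
    and \<open>b2\<close>.\<close>
  define a1 where "a1 = P w ?p * (\<Sum>C\<in>?A. \<Sum>J\<in>S. al C *\<^sub>R (xc wr J * D1 (Inl C) J))"
  define a2 where "a2 = (\<Sum>X\<in>R. \<Sum>K\<in>S. \<Sum>C\<in>?A. \<Sum>J\<in>S. sg (rpar X * par K) *\<^sub>R (P w K * (xc X ?p *
       (al C *\<^sub>R (sg ((rpar X + par K) * par J) *\<^sub>R (xc wr J * D2 X K (Inl C) J))))))"
  define a3 where "a3 = (\<Sum>K\<in>S. \<Sum>C\<in>?A. P w K * (xc wr ?p * (al C *\<^sub>R D1 (Inl C) K)))"
  have T1: "e_vec n m p q (Suc r) s e u ?cov x = - a1 + a2 + a3"
  proof -
    have "sg (Suc r) *\<^sub>R (P w ?p * ?cov x) = - a1"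
      unfolding e_covec_eq[OF x] a1_def al_def[symmetric] by simp
    moreover have "sg (Suc r) *\<^sub>R (\<Sum>X\<in>R. \<Sum>K\<in>S. sg (rpar X * par K) *\<^sub>R (P w K * (xc X ?p * sderiv (crd X K) ?cov x))) = - a2"
    proof -
      have "(\<Sum>X\<in>R. \<Sum>K\<in>S. sg (rpar X * par K) *\<^sub>R (P w K * (xc X ?p * sderiv (crd X K) ?cov x)))
        = (\<Sum>X\<in>R. \<Sum>K\<in>S. sg r *\<^sub>R (\<Sum>C\<in>?A. \<Sum>J\<in>S. sg (rpar X * par K) *\<^sub>R (P w K * (xc X ?p *
         (al C *\<^sub>R (sg ((rpar X + par K) * par J) *\<^sub>R (xc wr J * D2 X K (Inl C) J)))))))"
      proof (intro sum.cong refl)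
        fix X K assume X: "X \<in> R"
        show "sg (rpar X * par K) *\<^sub>R (P w K * (xc X ?p * sderiv (crd X K) ?cov x))
          = sg r *\<^sub>R (\<Sum>C\<in>?A. \<Sum>J\<in>S. sg (rpar X * par K) *\<^sub>R (P w K * (xc X ?p *
         (al C *\<^sub>R (sg ((rpar X + par K) * par J) *\<^sub>R (xc wr J * D2 X K (Inl C) J))))))"
          unfolding sderiv_e_covec_old[OF X] al_def[symmetric] mult_scaleR_right sum_distrib_left scaleR_sum_right
          by (simp add: mult_ac)
      qed
      then show ?thesis by (simp add: a2_def scaleR_sum_right[symmetric])
    qed
    moreover have "sg (Suc r) *\<^sub>R (\<Sum>K\<in>S. sg (rpar wr * par K) *\<^sub>R (P w K * (xc wr ?p * sderiv (crd wr K) ?cov x))) = - a3"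
    proof -
      have "(\<Sum>K\<in>S. sg (rpar wr * par K) *\<^sub>R (P w K * (xc wr ?p * sderiv (crd wr K) ?cov x)))
        = (\<Sum>K\<in>S. sg r *\<^sub>R (\<Sum>C\<in>?A. P w K * (xc wr ?p * (al C *\<^sub>R D1 (Inl C) K))))"
      proof (intro sum.cong refl)
        fix K assume K: "K \<in> S"
        show "sg (rpar wr * par K) *\<^sub>R (P w K * (xc wr ?p * sderiv (crd wr K) ?cov x))
          = sg r *\<^sub>R (\<Sum>C\<in>?A. P w K * (xc wr ?p * (al C *\<^sub>R D1 (Inl C) K)))"
          unfolding sderiv_e_covec_new[OF K] al_def[symmetric] mult_scaleR_right sum_distrib_left by simp
      qed
      then show ?thesis by (simp add: a3_def scaleR_sum_right[symmetric])
    qed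
    moreover have "e_vec n m p q (Suc r) s e u ?cov x = sg (Suc r) *\<^sub>R (P w ?p * ?cov x)
      - (sg (Suc r) *\<^sub>R (\<Sum>K\<in>S. sg (rpar wr * par K) *\<^sub>R (P w K * (xc wr ?p * sderiv (crd wr K) ?cov x)))
        + sg (Suc r) *\<^sub>R (\<Sum>X\<in>R. \<Sum>K\<in>S. sg (rpar X * par K) *\<^sub>R (P w K * (xc X ?p * sderiv (crd X K) ?cov x))))"
      unfolding e_vec_eq[OF x] w_def[symmetric] rows_Suc
        sum.insert[OF finite_rows Inr_notin_rows] scaleR_diff_right scaleR_add_right ..
    ultimately show ?thesis by simp
  qed
  \<comment> \<open>Collects the components of \<open>u\<close> produced by differentiating the
    pairings. Up to the sign settled in \<open>E0\<close> it is the value of the covector on the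
    vector.\<close>
  define \<kappa> where "\<kappa> = (\<Sum>C\<in>?A. al C * w C)"
  define b2 where "b2 = (\<Sum>C\<in>?A. \<Sum>J\<in>S. al C *\<^sub>R (xc wr ?p * (sg (par C * a) *\<^sub>R (P w J * D1 (Inl C) J))))"
  define b3 where "b3 = (\<Sum>C\<in>?A. \<Sum>K\<in>S. al C *\<^sub>R (xc wr K * (sg ((par C + par K) * a) *\<^sub>R (P w ?p * D1 (Inl C) K))))"
  define M4 where "M4 = (\<Sum>Y\<in>R. \<Sum>K\<in>S. sg (rpar Y * par K) *\<^sub>R (xc wr K * (xc Y ?p * D1 Y K)))"
  define b5 where "b5 = (\<Sum>C\<in>?A. \<Sum>K\<in>S. \<Sum>Y\<in>R. \<Sum>J\<in>S. al C *\<^sub>R (xc wr K *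
       (sg (rpar Y * par J + (par C + par K) * (a + par J + rpar Y)) *\<^sub>R (P w J * (xc Y ?p * D2 (Inl C) K Y J)))))"
  have T2: "e_covec n m (Suc p) q r s e b \<alpha> ?vec x = \<kappa> *\<^sub>R (xc wr ?p * L x) - b2 + b3 - \<kappa> *\<^sub>R M4 - b5"
  proof -
    define N0 where "N0 = (\<lambda>C K. sg r *\<^sub>R sderiv (crd (Inl C) K) ?vec x)"
    have new: "N0 C ?p = w C *\<^sub>R L x - (\<Sum>J\<in>S. sg (par C * a) *\<^sub>R (P w J * D1 (Inl C) J))" if "C \<in> ?A" for C
    proof -
      have "Inl C \<in> R" using that by (auto simp: rows_def)
      from sderiv_e_vec_new[OF hu this] show ?thesis by (simp add: N0_def w_def rval_def)
    qed
    have old: "N0 C K = sg ((par C + par K) * a) *\<^sub>R (P w ?p * D1 (Inl C) K)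
       - (\<Sum>Y\<in>R. sg (rpar Y * par K) *\<^sub>R (w C *\<^sub>R (xc Y ?p * D1 Y K)))
       - (\<Sum>Y\<in>R. \<Sum>J\<in>S. sg (rpar Y * par J + (par C + par K) * (a + par J + rpar Y)) *\<^sub>R
            (P w J * (xc Y ?p * D2 (Inl C) K Y J)))" if "C \<in> ?A" "K \<in> S" for C K
    proof -
      have "Inl C \<in> R" using that by (auto simp: rows_def)
      from sderiv_e_vec_old[OF hu this that(2)] show ?thesis by (simp add: N0_def w_def rval_def)
    qed
    have A: "(\<Sum>C\<in>?A. al C *\<^sub>R (xc wr ?p * N0 C ?p)) = \<kappa> *\<^sub>R (xc wr ?p * L x) - b2"
    proof -
      have "(\<Sum>C\<in>?A. al C *\<^sub>R (xc wr ?p * N0 C ?p)) = (\<Sum>C\<in>?A. (al C * w C) *\<^sub>R (xc wr ?p * L x)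
         - (\<Sum>J\<in>S. al C *\<^sub>R (xc wr ?p * (sg (par C * a) *\<^sub>R (P w J * D1 (Inl C) J)))))"
        by (rule sum.cong) (simp_all only: new right_diff_distrib scaleR_diff_right mult_scaleR_right scaleR_scaleR sum_distrib_left scaleR_sum_right)
      then show ?thesis by (simp only: sum_subtractf b2_def \<kappa>_def scaleR_sum_left)
    qed
    have B4: "(\<Sum>C\<in>?A. \<Sum>K\<in>S. al C *\<^sub>R (xc wr K * (\<Sum>Y\<in>R. sg (rpar Y * par K) *\<^sub>R (w C *\<^sub>R (xc Y ?p * D1 Y K))))) = \<kappa> *\<^sub>R M4"
    proof -
      have "(\<Sum>K\<in>S. al C *\<^sub>R (xc wr K * (\<Sum>Y\<in>R. sg (rpar Y * par K) *\<^sub>R (w C *\<^sub>R (xc Y ?p * D1 Y K)))))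
        = (al C * w C) *\<^sub>R M4" for C
      proof -
        have "(\<Sum>K\<in>S. al C *\<^sub>R (xc wr K * (\<Sum>Y\<in>R. sg (rpar Y * par K) *\<^sub>R (w C *\<^sub>R (xc Y ?p * D1 Y K)))))
          = (\<Sum>K\<in>S. \<Sum>Y\<in>R. (al C * w C) *\<^sub>R (sg (rpar Y * par K) *\<^sub>R (xc wr K * (xc Y ?p * D1 Y K))))"
          by (simp add: sum_distrib_left scaleR_sum_right mult_ac)
        also have "\<dots> = (\<Sum>Y\<in>R. \<Sum>K\<in>S. (al C * w C) *\<^sub>R (sg (rpar Y * par K) *\<^sub>R (xc wr K * (xc Y ?p * D1 Y K))))"
          by (rule sum.swap)
        finally show ?thesis by (simp only: M4_def scaleR_sum_right)
      qed
      then show ?thesis by (simp only: \<kappa>_def scaleR_sum_left)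
    qed
    have B: "(\<Sum>C\<in>?A. \<Sum>K\<in>S. al C *\<^sub>R (xc wr K * N0 C K)) = b3 - \<kappa> *\<^sub>R M4 - b5"
      unfolding B4[symmetric] b3_def b5_def sum_subtractf[symmetric]
      by (intro sum.cong refl) (simp only: old right_diff_distrib scaleR_diff_right sum_distrib_left scaleR_sum_right)
    have "e_covec n m (Suc p) q r s e b \<alpha> ?vec x
      = (\<Sum>C\<in>?A. \<Sum>K\<in>dimset (Suc p) q. al C *\<^sub>R (xc wr K * N0 C K))"
      unfolding e_covec_eq[OF x] N0_def al_def[symmetric] by (simp add: scaleR_sum_right mult_ac)
    also have "\<dots> = (\<Sum>C\<in>?A. al C *\<^sub>R (xc wr ?p * N0 C ?p)) + (\<Sum>C\<in>?A. \<Sum>K\<in>S. al C *\<^sub>R (xc wr K * N0 C K))"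
      by (simp add: dimset_Suc sum.distrib)
    finally show ?thesis unfolding A B by simp
  qed
  have wpe: "xc wr ?p * W = W * xc wr ?p" for W
    using ghom_even_commute[of "xc wr ?p" W] wr_hom[of ?p r] by simp
  have E1: "sg (b * a) *\<^sub>R b3 = a1"
    unfolding b3_def a1_def sum_distrib_left scaleR_sum_right
  proof (intro sum.cong refl)
    fix C K assume C: "C \<in> ?A"
    show "sg (b * a) *\<^sub>R (al C *\<^sub>R (xc wr K * (sg ((par C + par K) * a) *\<^sub>R (P w ?p * D1 (Inl C) K))))
      = P w ?p * (al C *\<^sub>R (xc wr K * D1 (Inl C) K))"
    proof (cases "al C = 0")
      case False
      then have b: "b = par C" using ha' C by auto
      let ?W = "P w ?p * (xc wr K * D1 (Inl C) K)"
      have "xc wr K * (P w ?p * D1 (Inl C) K) = sg (par K * a) *\<^sub>R ?W"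
        using ghom_swap[OF wr_hom[of K r] P_hom[OF hu', of ?p]] by simp
      moreover have "sg (b * a) *\<^sub>R (sg ((par C + par K) * a) *\<^sub>R (sg (par K * a) *\<^sub>R ?W)) = sg 0 *\<^sub>R ?W"
        unfolding sg_scaleR b by (rule sg_scaleR_cong) (simp only: even_add even_mult_iff even_zero, blast)
      ultimately show ?thesis
        by (simp only: mult_scaleR_right scaleR_left_commute[of _ "al C"] power_0 scaleR_one)
    qed simp
  qed
  have E2: "sg (b * a) *\<^sub>R b2 = a3"
  proof -
    have "sg (b * a) *\<^sub>R b2 = (\<Sum>C\<in>?A. \<Sum>K\<in>S. P w K * (xc wr ?p * (al C *\<^sub>R D1 (Inl C) K)))"
      unfolding b2_def scaleR_sum_right
    proof (intro sum.cong refl)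
      fix C K assume C: "C \<in> ?A"
      show "sg (b * a) *\<^sub>R (al C *\<^sub>R (xc wr ?p * (sg (par C * a) *\<^sub>R (P w K * D1 (Inl C) K))))
        = P w K * (xc wr ?p * (al C *\<^sub>R D1 (Inl C) K))"
      proof (cases "al C = 0")
        case False
        then have b: "b = par C" using ha' C by auto
        let ?W = "P w K * (xc wr ?p * D1 (Inl C) K)"
        have "xc wr ?p * (P w K * D1 (Inl C) K) = ?W"
          using wpe[of "P w K"] by (simp add: mult.assoc[symmetric])
        moreover have "sg (b * a) *\<^sub>R (sg (par C * a) *\<^sub>R ?W) = sg 0 *\<^sub>R ?W"
          unfolding sg_scaleR b by (rule sg_scaleR_cong) (simp only: even_add even_mult_iff even_zero, blast)
        ultimately show ?thesis
          by (simp only: mult_scaleR_right scaleR_left_commute[of _ "al C"] power_0 scaleR_one)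
      qed simp
    qed
    also have "\<dots> = a3" unfolding a3_def by (rule sum.swap)
    finally show ?thesis .
  qed
  have E5: "sg (b * a) *\<^sub>R b5 = a2"
    unfolding a2_def sum4_swap[where R = R] b5_def scaleR_sum_right
  proof (intro sum.cong refl)
    fix C J X K assume C: "C \<in> ?A"
    show "sg (b * a) *\<^sub>R (al C *\<^sub>R (xc wr J *
         (sg (rpar X * par K + (par C + par J) * (a + par K + rpar X)) *\<^sub>R (P w K * (xc X ?p * D2 (Inl C) J X K)))))
      = sg (rpar X * par K) *\<^sub>R (P w K * (xc X ?p *
       (al C *\<^sub>R (sg ((rpar X + par K) * par J) *\<^sub>R (xc wr J * D2 X K (Inl C) J)))))"
    proof (cases "al C = 0")
      case False
      then have b: "b = par C" using ha' C by auto
      let ?W = "P w K * (xc X ?p * (xc wr J * D2 (Inl C) J X K))"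
      have D: "D2 X K (Inl C) J = sg ((rpar X + par K) * (par C + par J)) *\<^sub>R D2 (Inl C) J X K"
      proof -
        have "sg (cpar (crd X K) * cpar (crd (Inl C) J)) = sg ((rpar X + par K) * (par C + par J))"
          by (rule sg_cong) simp
        then show ?thesis using sderiv_commute[OF smooth_L open_form_dom x, of "crd X K" "crd (Inl C) J"] by simp
      qed
      have "xc wr J * (P w K * (xc X ?p * D2 (Inl C) J X K)) = sg (par J * (a + par K) + par J * rpar X) *\<^sub>R ?W"
        using ghom_swap[OF wr_hom[of J r] P_hom[OF hu', of K]] ghom_swap[OF wr_hom[of J r] chi_hom[of X p]]
        by (simp add: power_add)
      moreover have "sg (b * a) *\<^sub>R (sg (rpar X * par K + (par C + par J) * (a + par K + rpar X)) *\<^sub>R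
            (sg (par J * (a + par K) + par J * rpar X) *\<^sub>R ?W))
         = sg (rpar X * par K) *\<^sub>R (sg ((rpar X + par K) * par J) *\<^sub>R (sg ((rpar X + par K) * (par C + par J)) *\<^sub>R ?W))"
        unfolding sg_scaleR b by (rule sg_scaleR_cong) (simp only: even_add even_mult_iff, blast)
      ultimately show ?thesis unfolding D
        by (simp only: mult_scaleR_right scaleR_left_commute[of _ "al C"])
    qed simp
  qed
  \<comment> \<open>Where both components are nonzero, \<open>a\<close> and \<open>b\<close> both
    equal \<open>par C\<close>, so the sign of the supercommutator cancels the one in
    \<open>ccomp\<close>.\<close>
  have E0: "sg (b * a) * \<kappa> = (\<Sum>C\<in>?A. w C * \<alpha> (e C))"
    unfolding \<kappa>_def sum_distrib_left
  proof (intro sum.cong refl)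
    fix C assume C: "C \<in> ?A"
    show "sg (b * a) * (al C * w C) = w C * \<alpha> (e C)"
    proof (cases "al C = 0 \<or> w C = 0")
      case True
      then show ?thesis by (auto simp: al_def ccomp_def)
    next
      case False
      then have "b = par C" "a = par C" using ha' hu' C by auto
      moreover have "sg k * sg k = 1" for k by (simp flip: power_add)
      ultimately show ?thesis by (simp add: al_def ccomp_def)
    qed
  qed
  have "e_vec n m p q (Suc r) s e u ?cov x + sg (b * a) *\<^sub>R e_covec n m (Suc p) q r s e b \<alpha> ?vec x
    = (sg (b * a) * \<kappa>) *\<^sub>R sigma_val"
    unfolding T1 T2 sigma_val_def M4_def[symmetric] scaleR_diff_right scaleR_add_right E1 E2 E5
    by simp
  then show ?thesis unfolding E0 w_def .
qed

end

section \<open>The stability isomorphism\<close>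

lemma local_add: "local_on C f \<Longrightarrow> local_on C g \<Longrightarrow> local_on C (\<lambda>x. f x + g x)"
proof -
  assume f: "local_on C f" and g: "local_on C g"
  have "I \<subseteq> odds C" if "gcoeff (f x + g x) I \<noteq> 0" for x I
  proof (rule ccontr)
    assume "\<not> I \<subseteq> odds C"
    then have "gcoeff (f x) I = 0" "gcoeff (g x) I = 0" using local_support f g by blast+
    then show False using that by simp
  qed
  then show ?thesis using f g unfolding local_on_def by metis
qed

lemma local_scaleR: "local_on C f \<Longrightarrow> local_on C (\<lambda>x. k *\<^sub>R f x)"
  unfolding local_on_def by (metis gcoeff_scaleR mult_zero_right)

lemma local_diff: "local_on C f \<Longrightarrow> local_on C g \<Longrightarrow> local_on C (\<lambda>x. f x - g x)"
  using local_add[of C f "\<lambda>x. (-1) *\<^sub>R g x"] local_scaleR[of C g "-1"] by simp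

lemma local_0: "local_on C (\<lambda>_. 0)" by (simp add: local_on_def)

lemma local_sum: "(\<And>i. i \<in> S \<Longrightarrow> local_on C (f i)) \<Longrightarrow> local_on C (\<lambda>x. \<Sum>i\<in>S. f i x)"
  by (induction S rule: infinite_finite_induct) (auto intro: local_0 local_add)

lemma local_cfun_mult:
  assumes f: "local_on C f" and c: "c \<in> C"
  shows "local_on C (\<lambda>x. cfun c x * f x)"
  unfolding local_on_def
proof (intro conjI allI impI)
  fix x y :: "coord \<Rightarrow> real" assume xy: "\<forall>c\<in>evens C. x c = y c"
  have "cfun c x = cfun c y" using xy c by (auto simp: cfun_def evens_def)
  moreover have "f x = f y" using local_dep[OF f] xy by blast
  ultimately show "cfun c x * f x = cfun c y * f y" by simp
next
  fix x I assume nz: "gcoeff (cfun c x * f x) I \<noteq> 0"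
  show "I \<subseteq> odds C"
  proof (cases "cpar c = 0")
    case True
    then have "gcoeff (f x) I \<noteq> 0" using nz by (simp add: gcoeff_cfun_mult)
    then show ?thesis by (rule local_support[OF f])
  next
    case False
    then have "c \<in> odds C" using c by (simp add: odds_def)
    moreover have "gcoeff (f x) (I - {c}) \<noteq> 0" using nz False by (auto simp: gcoeff_cfun_mult split: if_splits)
    then have "I - {c} \<subseteq> odds C" by (rule local_support[OF f])
    ultimately show ?thesis by blast
  qed
qed

lemma local_sderiv:
  assumes f: "local_on C f" and sm: "smooth_sfun U f"
  shows "local_on C (sderiv c f)"
proof (cases "cpar c = 0")
  case True
  have dep: "gcoeff (f x) I = gcoeff (f y) I" if "\<And>c. c \<in> evens C \<Longrightarrow> x c = y c" for x y I
    using local_dep[OF f that] by simp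
  show ?thesis unfolding local_on_def
  proof (intro conjI allI impI)
    fix x y :: "coord \<Rightarrow> real" assume xy: "\<forall>c\<in>evens C. x c = y c"
    have "pdiff c (\<lambda>y. gcoeff (f y) I) x = pdiff c (\<lambda>y. gcoeff (f y) I) y" for I
      by (rule pdiff_indep(2)[OF dep]) (use xy in auto)
    then show "sderiv c f x = sderiv c f y" using True by (simp add: sderiv_def)
  next
    fix x I assume nz: "gcoeff (sderiv c f x) I \<noteq> 0"
    show "I \<subseteq> odds C"
    proof (rule ccontr)
      assume "\<not> I \<subseteq> odds C"
      then have "(\<lambda>y. gcoeff (f y) I) = (\<lambda>_. 0)" using local_support[OF f] by blast
      then show False using nz by (simp add: gcoeff_sderiv[OF sm True] pdiff_def)
    qed
  qed
next
  case False
  then have c: "cpar c = 1" by simp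
  show ?thesis unfolding local_on_def
  proof (intro conjI allI impI)
    fix x y :: "coord \<Rightarrow> real" assume "\<forall>c\<in>evens C. x c = y c"
    then show "sderiv c f x = sderiv c f y" using local_dep[OF f, of x y] by (simp add: sderiv_odd[OF c])
  next
    fix x I assume "gcoeff (sderiv c f x) I \<noteq> 0"
    then have "gcoeff (f x) (insert c I) \<noteq> 0" by (auto simp: sderiv_odd[OF c] gcoeff_gderiv split: if_splits)
    then show "I \<subseteq> odds C" using local_support[OF f] by blast
  qed
qed

lemma local_mono: "local_on C f \<Longrightarrow> C \<subseteq> C' \<Longrightarrow> local_on C' f"
proof -
  assume f: "local_on C f" and "C \<subseteq> C'"
  then have "evens C \<subseteq> evens C'" "odds C \<subseteq> odds C'" by (auto simp: evens_def odds_def)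
  then show ?thesis using f unfolding local_on_def by (meson subset_iff subset_trans)
qed

lemma form_dom_dep:
  assumes "\<And>c. c \<in> evens (coords n m p q r s) \<Longrightarrow> x c = y c"
  shows "x \<in> form_dom m q s \<longleftrightarrow> y \<in> form_dom m q s"
  by (rule form_dom_cong; rule assms) (auto simp: evens_def coords_def dimset_def)

lemma local_restr:
  assumes "local_on (coords n m p q r s) f"
  shows "local_on (coords n m p q r s) (restr (form_dom m q s) f)"
  unfolding local_on_def
proof (intro conjI allI impI)
  fix x y :: "coord \<Rightarrow> real" assume xy: "\<forall>c\<in>evens (coords n m p q r s). x c = y c"
  then have "x \<in> form_dom m q s \<longleftrightarrow> y \<in> form_dom m q s" by (intro form_dom_dep) blast
  then show "restr (form_dom m q s) f x = restr (form_dom m q s) f y"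
    using local_dep[OF assms, of x y] xy by (simp add: restr_def)
next
  fix x I assume "gcoeff (restr (form_dom m q s) f x) I \<noteq> 0"
  then have "gcoeff (f x) I \<noteq> 0" by (auto simp: restr_def split: if_splits)
  then show "I \<subseteq> odds (coords n m p q r s)" by (rule local_support[OF assms])
qed

lemma sfunsI:
  assumes "local_on C f" "smooth_sfun U f" "\<And>x. x \<notin> U \<Longrightarrow> f x = 0"
  shows "f \<in> sfuns C U"
proof -
  have "smooth_fun (evens C) U (\<lambda>x. gcoeff (f x) I)" for I
    by (rule smooth_mono[OF smooth_sfun_coeff[OF assms(2)]]) (auto simp: evens_def)
  then show ?thesis using assms(1,3) unfolding sfuns_def local_on_def mem_Collect_eq
    by (elim conjE, intro conjI allI impI) simp_all
qed

lemma eval_point_admissible: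
  assumes "admissible n m p q r s P W"
  shows "eval_point (coords n m p q r s) (form_dom m q s) (point P W)"
proof
  show "ghomogeneous (cpar c) (point P W c)" if "c \<in> coords n m p q r s" for c
  proof -
    have m: "ghomogeneous (k mod 2) a \<longleftrightarrow> ghomogeneous k a" for k and a :: "nat grass"
      by (rule ghom_cong) simp
    show ?thesis
    proof (cases c)
      case (Pc A K)
      then have "ghomogeneous (par A + par K) (P A K)"
        using assms that by (auto simp: admissible_def even_mat_def coords_def)
      then show ?thesis using Pc by (simp add: m)
    next
      case (Wc F K)
      then have "ghomogeneous (par F + par K) (W F K)"
        using assms that by (auto simp: admissible_def even_mat_def coords_def)
      then show ?thesis using Wc by (simp add: m)
    qed
  qed
qed (use assms open_form_dom in \<open>auto simp: admissible_def\<close>)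

lemma coords_mono: "coords n m p q r s \<subseteq> coords n m (Suc p) q (Suc r) s"
  by (auto simp: coords_def dimset_Suc)

section \<open>The explicit form of the stability isomorphism\<close>

context mform
begin

abbreviation "C0 \<equiv> coords n m p q r s"
abbreviation "C1 \<equiv> coords n m (Suc p) q (Suc r) s"

text \<open>The first-order expansion of L along the shift, multiplied by \<open>w_22\<close>. The
  inverse of \<open>w_22\<close> has cancelled, so the expression makes sense on the whole domain
  and is the extension that \<sigma> requires.\<close>

definition sigma_form :: sfun where
  "sigma_form = restr U (\<lambda>x. cfun (crd wr (Even p)) x * L x
     - (\<Sum>Y\<in>R. \<Sum>K\<in>S. sg (rpar Y * par K) *\<^sub>R
         (cfun (crd wr K) x * (cfun (crd Y (Even p)) x * sderiv (crd Y K) L x))))"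

lemma new_coords: "crd wr (Even p) \<in> C1" "K \<in> S \<Longrightarrow> crd wr K \<in> C1" "Y \<in> R \<Longrightarrow> crd Y (Even p) \<in> C1"
  unfolding crd_coords dimset_Suc rows_Suc by auto

lemma local_L: "local_on C0 L" by (rule sfuns_local[OF L_sfuns])
lemma local_DL: "local_on C0 (sderiv c L)" by (rule local_sderiv[OF local_L smooth_L])

lemma sigma_form_sfuns: "sigma_form \<in> sfuns C1 U"
proof (rule sfunsI)
  show "local_on C1 sigma_form" unfolding sigma_form_def
    by (intro local_restr local_diff local_sum local_scaleR local_cfun_mult new_coords
        local_mono[OF local_L coords_mono] local_mono[OF local_DL coords_mono])
  show "smooth_sfun U sigma_form" unfolding sigma_form_def
    by (intro smooth_sfun_restr smooth_sfun_diff smooth_sfun_sum smooth_sfun_scaleR smooth_sfun_cfun_mult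
        smooth_L smooth_DL open_form_dom)
qed (simp add: sigma_form_def restr_def)

lemma seval_sigma_form:
  assumes "eval_point C1 U z"
  shows "seval C1 sigma_form z = z (crd wr (Even p)) * seval C1 L z
     - (\<Sum>Y\<in>R. \<Sum>K\<in>S. sg (rpar Y * par K) *\<^sub>R
         (z (crd wr K) * (z (crd Y (Even p)) * seval C1 (sderiv (crd Y K) L) z)))"
proof -
  interpret eval_point C1 U z by fact
  note ss = smooth_sfun_diff smooth_sfun_sum smooth_sfun_scaleR smooth_sfun_cfun_mult
        smooth_L smooth_DL open_form_dom
  let ?t = "\<lambda>Y K x. cfun (crd wr K) x * (cfun (crd Y (Even p)) x * sderiv (crd Y K) L x)"
  have "seval C1 sigma_form z = seval C1 (\<lambda>x. cfun (crd wr (Even p)) x * L x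
     - (\<Sum>Y\<in>R. \<Sum>K\<in>S. sg (rpar Y * par K) *\<^sub>R ?t Y K x)) z"
    by (rule seval_cong) (simp add: sigma_form_def restr_def)
  also have "\<dots> = seval C1 (\<lambda>x. cfun (crd wr (Even p)) x * L x) z
     - seval C1 (\<lambda>x. \<Sum>Y\<in>R. \<Sum>K\<in>S. sg (rpar Y * par K) *\<^sub>R ?t Y K x) z"
    by (intro seval_diff ss)
  also have "seval C1 (\<lambda>x. \<Sum>Y\<in>R. \<Sum>K\<in>S. sg (rpar Y * par K) *\<^sub>R ?t Y K x) z
    = (\<Sum>Y\<in>R. seval C1 (\<lambda>x. \<Sum>K\<in>S. sg (rpar Y * par K) *\<^sub>R ?t Y K x) z)"
    by (intro seval_sum ss)
  also have "\<dots> = (\<Sum>Y\<in>R. \<Sum>K\<in>S. seval C1 (\<lambda>x. sg (rpar Y * par K) *\<^sub>R ?t Y K x) z)"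
    by (intro sum.cong refl seval_sum ss)
  also have "\<dots> = (\<Sum>Y\<in>R. \<Sum>K\<in>S. sg (rpar Y * par K) *\<^sub>R
         (z (crd wr K) * (z (crd Y (Even p)) * seval C1 (sderiv (crd Y K) L) z)))"
  proof (intro sum.cong refl)
    fix Y K assume YK: "Y \<in> R" "K \<in> S"
    have "seval C1 (\<lambda>x. sg (rpar Y * par K) *\<^sub>R ?t Y K x) z = sg (rpar Y * par K) *\<^sub>R seval C1 (?t Y K) z"
      by (intro seval_scaleR ss)
    also have "seval C1 (?t Y K) z = z (crd wr K) * seval C1 (\<lambda>x. cfun (crd Y (Even p)) x * sderiv (crd Y K) L x) z"
      by (intro seval_cfun_mult ss new_coords YK)
    also have "seval C1 (\<lambda>x. cfun (crd Y (Even p)) x * sderiv (crd Y K) L x) z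
      = z (crd Y (Even p)) * seval C1 (sderiv (crd Y K) L) z"
      by (intro seval_cfun_mult ss new_coords YK)
    finally show "seval C1 (\<lambda>x. sg (rpar Y * par K) *\<^sub>R ?t Y K x) z
      = sg (rpar Y * par K) *\<^sub>R (z (crd wr K) * (z (crd Y (Even p)) * seval C1 (sderiv (crd Y K) L) z))" .
  qed
  also have "seval C1 (\<lambda>x. cfun (crd wr (Even p)) x * L x) z = z (crd wr (Even p)) * seval C1 L z"
    by (intro seval_cfun_mult ss new_coords)
  finally show ?thesis .
qed

text \<open>Within an even column the equation of the form and the commutation of derivatives give
  opposite signs to the same exchange of rows, so twice the second derivative is zero.\<close>

lemma pde_same_column:
  assumes "X \<in> R" "Y \<in> R" "K \<in> S" "par K = 0" "x \<in> U"
  shows "sderiv (crd X K) (sderiv (crd Y K) L) x = 0"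
proof -
  have "sg (cpar (crd Y K) * cpar (crd X K)) = sg (rpar X * rpar Y)"
    by (rule sg_cong) (simp add: assms(4), blast)
  then have "sderiv (crd Y K) (sderiv (crd X K) L) x = sg (rpar X * rpar Y) *\<^sub>R sderiv (crd X K) (sderiv (crd Y K) L) x"
    using sderiv_commute[OF smooth_L open_form_dom assms(5), of "crd Y K" "crd X K"] by simp
  then have "sg (rpar X * rpar Y + (rpar X + rpar Y) * par K) *\<^sub>R sderiv (crd Y K) (sderiv (crd X K) L) x
      = sg 0 *\<^sub>R sderiv (crd X K) (sderiv (crd Y K) L) x"
    unfolding assms(4) by (simp only: sg_scaleR) (rule sg_scaleR_cong, simp)
  then have "sderiv (crd X K) (sderiv (crd Y K) L) x + sderiv (crd X K) (sderiv (crd Y K) L) x = 0"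
    using pde[OF assms(1,2,3,3,5)] by simp
  then show ?thesis by (metis real_vector.scale_eq_0_iff scaleR_2 zero_neq_numeral)
qed

text \<open>Here \<nu> stands for the inverse of \<open>w_22\<close>. The increments are products of
  a factor depending on the row and a factor depending on the column, and this rank-one shape makes
  all higher-order terms vanish.\<close>

lemma seval_shift:
  assumes pt: "eval_point C1 U z" and \<nu>: "ghomogeneous 0 \<nu>"
  defines "h \<equiv> \<lambda>c. case c of Pc A K \<Rightarrow> - (z (Pc A (Even p)) * (\<nu> * z (Wc (Even r) K)))
      | Wc F K \<Rightarrow> - (z (Wc F (Even p)) * (\<nu> * z (Wc (Even r) K)))"
  assumes pt': "eval_point C0 U z'" and z': "\<And>c. c \<in> C0 \<Longrightarrow> z' c = z c + h c"
  shows "seval C0 L z' = seval C1 L z - (\<Sum>K\<in>S. \<Sum>Y\<in>R.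
    z (crd Y (Even p)) * (\<nu> * z (crd wr K)) * seval C1 (sderiv (crd Y K) L) z)"
proof -
  interpret p1: eval_point C1 U z by fact
  have pt0: "eval_point C0 U z"
    by unfold_locales (use p1.body p1.par coords_mono[THEN subsetD] open_form_dom in auto)
  have h: "h (crd X K) = - (z (crd X (Even p)) * (\<nu> * z (crd wr K)))" for X K
    by (cases X) (simp_all add: h_def)
  have zhom: "ghomogeneous (rpar X + par K) (z (crd X K))" if "crd X K \<in> C1" for X K
    using p1.par[OF that] by (rule ghom_cpar_crd[THEN iffD1])
  have yh: "ghomogeneous (rpar X) (z (crd X (Even p)))" if "X \<in> R" for X
    using zhom[OF new_coords(3)[OF that]] by simp
  have eh: "ghomogeneous (par K) (\<nu> * z (crd wr K))" if "K \<in> S" for K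
    using ghom_mult[OF \<nu> zhom[OF new_coords(2)[OF that]]] by simp
  have hh: "ghomogeneous (rpar X + par K) (h (crd X K))" if "X \<in> R" "K \<in> S" for X K
    unfolding h by (intro ghom_uminus ghom_mult yh eh that)
  \<comment> \<open>Otherwise one of the two factors of the increment is odd and has no body.
    Increments with a body thus occur only in even columns, where complete lines are
    available.\<close>
  have hzero: "gbody (h (crd X K)) = 0" if "X \<in> R" "K \<in> S" "par K = 1 \<or> rpar X = 1" for X K
  proof -
    have "gbody (z (crd X (Even p))) = 0 \<or> gbody (\<nu> * z (crd wr K)) = 0"
      using that yh[OF that(1)] eh[OF that(2)] gbody_odd by metis
    moreover have "gbody (- a) = - gbody a" for a :: "nat grass" by (simp add: gbody_def)
    ultimately show ?thesis unfolding h by (auto simp: gbody_mult)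
  qed
  have par01: "par K = 0 \<or> par K = 1" for K by (cases K) auto
  have lines: "y(crd X K := t) \<in> U" if "y \<in> U" "par K = 0" for y X K t
  proof -
    have "K \<noteq> Odd j" for j using that(2) by auto
    then have "y(crd X K := t) \<in> U \<longleftrightarrow> y \<in> U"
      by (intro form_dom_cong) (cases X; auto)+
    then show ?thesis using that by simp
  qed
  have C0E: "\<exists>X\<in>R. \<exists>K\<in>S. c = crd X K" if "c \<in> C0" for c
    using that unfolding coords_rows by auto
  interpret sh: eval_shift C0 U h
  proof
    fix c assume c: "c \<in> C0"
    then obtain X K where XK: "X \<in> R" "K \<in> S" "c = crd X K" using C0E by blast
    show "ghomogeneous (cpar c) (h c)"
      unfolding XK(3) ghom_cpar_crd by (rule hh[OF XK(1,2)])
    show "x(c := t) \<in> U" if "gbody (h c) \<noteq> 0" "x \<in> U" for x t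
    proof -
      have "par K = 0" using that(1) hzero[OF XK(1,2)] XK(3) par01[of K] by auto
      then show ?thesis using lines[OF that(2)] XK(3) by blast
    qed
  qed (simp_all add: open_form_dom)
  define D where "D = (\<lambda>K. (\<lambda>X. crd X K) ` R)"
  \<comment> \<open>All increments in an odd column contain the same odd factor \<open>?e\<close>.
    In a product of two of them its copies can be brought together, and
    \<open>?e * ?e = 0\<close>.\<close>
  have odd_prod: "h (crd X K) * h (crd Y K) = 0" if "X \<in> R" "Y \<in> R" "K \<in> S" "par K = 1" for X Y K
  proof -
    let ?e = "\<nu> * z (crd wr K)"
    have e: "ghomogeneous 1 ?e" using eh[OF that(3)] that(4) by simp
    have "?e * (z (crd Y (Even p)) * ?e) = sg (1 * rpar Y) *\<^sub>R (z (crd Y (Even p)) * (?e * ?e))"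
      by (rule ghom_swap[OF e yh[OF that(2)]])
    then have "?e * (z (crd Y (Even p)) * ?e) = 0" using ghom_odd_sq[OF e] by simp
    then show ?thesis unfolding h by (simp only: mult.assoc minus_mult_minus mult_zero_right)
  qed
  have col: "sh.col_cond L (D K)" if K: "K \<in> S" for K
    unfolding sh.col_cond_def
  proof (intro conjI ballI impI)
    fix c assume "c \<in> D K"
    then obtain X where X: "X \<in> R" "c = crd X K" by (auto simp: D_def)
    show "sh.shift_cond L c"
    proof (cases "par K = 0")
      case True
      then show ?thesis unfolding sh.shift_cond_def X(2) using pde_same_column[OF X(1) X(1) K True] lines by blast
    next
      case False
      then have "par K = 1" using par01[of K] by simp
      then show ?thesis unfolding sh.shift_cond_def X(2) using odd_prod[OF X(1) X(1) K] hzero[OF X(1) K] by blast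
    qed
  next
    fix c d assume "c \<in> D K" "d \<in> D K"
    then obtain X Y where XY: "X \<in> R" "c = crd X K" "Y \<in> R" "d = crd Y K" by (auto simp: D_def)
    show "h d * h c = 0 \<or> (\<forall>y\<in>U. sderiv c (sderiv d L) y = 0)"
    proof (cases "par K = 0")
      case True
      then show ?thesis using pde_same_column[OF XY(1,3) K True] XY by blast
    next
      case False
      then have "par K = 1" using par01[of K] by simp
      then show ?thesis using odd_prod[OF XY(3,1) K] XY by blast
    qed
  qed
  \<comment> \<open>Exchanging the rows \<open>X\<close> and \<open>Y\<close> gives a minus sign
    from \<open>pde\<close>; its remaining sign is compensated by reordering the factors of the
    increments. So \<open>t\<close> is antisymmetric, and its sum over all pairs of rows
    vanishes.\<close>
  have cross: "(\<Sum>c\<in>D K. \<Sum>d\<in>D J. h c * (h d * seval C0 (sderiv d (sderiv c L)) y)) = 0"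
    if K: "K \<in> S" and J: "J \<in> S" and y: "sh.pt y" for K J y
  proof -
    interpret py: eval_point C0 U y by fact
    define t where "t = (\<lambda>X Y. h (crd X K) * (h (crd Y J) * seval C0 (sderiv (crd Y J) (sderiv (crd X K) L)) y))"
    have anti: "t X Y = - t Y X" if X: "X \<in> R" and Y: "Y \<in> R" for X Y
    proof -
      let ?G = "seval C0 (sderiv (crd X J) (sderiv (crd Y K) L)) y"
      have "seval C0 (sderiv (crd Y J) (sderiv (crd X K) L)) y
         = seval C0 (\<lambda>x. (- sg (rpar Y * rpar X + (rpar Y + rpar X) * par K)) *\<^sub>R sderiv (crd X J) (sderiv (crd Y K) L) x) y"
        by (rule py.seval_cong) (use pde[OF Y X J K] in \<open>simp add: add_eq_0_iff2\<close>)
      also have "\<dots> = (- sg (rpar Y * rpar X + (rpar Y + rpar X) * par K)) *\<^sub>R ?G"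
        by (intro py.seval_scaleR smooth_sfun_sderiv smooth_L open_form_dom)
      finally have G: "seval C0 (sderiv (crd Y J) (sderiv (crd X K) L)) y
         = - (sg (rpar Y * rpar X + (rpar Y + rpar X) * par K) *\<^sub>R ?G)" by simp
      let ?yX = "z (crd X (Even p))" and ?yY = "z (crd Y (Even p))"
        and ?eK = "\<nu> * z (crd wr K)" and ?eJ = "\<nu> * z (crd wr J)"
      have n: "- a * (- b * c) = a * (b * c)" for a b c :: "nat grass" by simp
      have 1: "h (crd X K) * (h (crd Y J) * ?G) = sg (par K * rpar Y) *\<^sub>R (?yX * (?yY * (?eK * (?eJ * ?G))))"
        unfolding h n using ghom_swap[OF eh[OF K] yh[OF Y]] by (simp only: mult.assoc mult_scaleR_right)
      have 2: "h (crd Y K) * (h (crd X J) * ?G) = sg (par K * rpar X + rpar Y * rpar X) *\<^sub>R (?yX * (?yY * (?eK * (?eJ * ?G))))"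
        unfolding h n using ghom_swap[OF eh[OF K] yh[OF X]] ghom_swap[OF yh[OF Y] yh[OF X]]
        by (simp only: mult.assoc mult_scaleR_right sg_scaleR)
      show ?thesis unfolding t_def G mult_minus_right mult_scaleR_right 1 2 sg_scaleR
        by (rule arg_cong[where f = uminus], rule sg_scaleR_cong) (simp only: even_add even_mult_iff, blast)
    qed
    have inj: "inj_on (\<lambda>X. crd X K) R" for K by (auto simp: inj_on_def)
    have "(\<Sum>c\<in>D K. \<Sum>d\<in>D J. h c * (h d * seval C0 (sderiv d (sderiv c L)) y)) = (\<Sum>X\<in>R. \<Sum>Y\<in>R. t X Y)"
      unfolding D_def sum.reindex[OF inj] by (simp add: t_def)
    moreover have "(\<Sum>X\<in>R. \<Sum>Y\<in>R. t X Y) = - (\<Sum>X\<in>R. \<Sum>Y\<in>R. t X Y)"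
    proof -
      have "(\<Sum>X\<in>R. \<Sum>Y\<in>R. t X Y) = (\<Sum>X\<in>R. \<Sum>Y\<in>R. - t Y X)" by (intro sum.cong refl anti)
      also have "\<dots> = - (\<Sum>X\<in>R. \<Sum>Y\<in>R. t Y X)" by (simp only: sum_negf)
      also have "(\<Sum>X\<in>R. \<Sum>Y\<in>R. t Y X) = (\<Sum>X\<in>R. \<Sum>Y\<in>R. t X Y)" by (rule sum.swap)
      finally show ?thesis .
    qed
    moreover have "W = - W \<Longrightarrow> W = 0" for W :: "nat grass"
      by (metis real_vector.scale_eq_0_iff add_eq_0_iff scaleR_2 zero_neq_numeral)
    ultimately show ?thesis by simp
  qed
  have DC: "(\<Union>K\<in>S. D K) = C0" unfolding D_def coords_rows ..
  have "seval C0 L (sh.move (\<Union>K\<in>S. D K) z) = seval C0 L z + (\<Sum>K\<in>S. \<Sum>c\<in>D K. h c * seval C0 (sderiv c L) z)"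
  proof (rule sh.seval_move_columns)
    show "D K \<inter> D J = {}" if "K \<noteq> J" for K J using that by (auto simp: D_def)
    show "D K \<subseteq> C0" if "K \<in> S" for K using that DC by blast
  qed (use col cross pt0 smooth_L in \<open>auto simp: D_def\<close>)
  \<comment> \<open>\<open>z'\<close> is prescribed on \<open>C0\<close> only, so it need not
    coincide with the moved point elsewhere; \<open>seval_more_coords\<close> with equal coordinate
    sets bridges this.\<close>
  moreover have "seval C0 L z' = seval C0 L (sh.move (\<Union>K\<in>S. D K) z)"
    unfolding DC
    by (rule seval_more_coords[OF local_L sh.pt_move[OF finite_coords order_refl pt0] pt'])
       (use z' in \<open>auto simp: sh.move_def\<close>)
  moreover have "seval C1 L z = seval C0 L z"
    by (rule seval_more_coords[OF local_L pt0 pt coords_mono refl])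
  moreover have "seval C1 (sderiv c L) z = seval C0 (sderiv c L) z" for c
    by (rule seval_more_coords[OF local_DL pt0 pt coords_mono refl])
  moreover have "(\<Sum>c\<in>D K. h c * seval C0 (sderiv c L) z) = (\<Sum>Y\<in>R. - (z (crd Y (Even p)) * (\<nu> * z (crd wr K)) * seval C0 (sderiv (crd Y K) L) z))" for K
  proof -
    have inj: "inj_on (\<lambda>X. crd X K) R" by (auto simp: inj_on_def)
    show ?thesis unfolding D_def sum.reindex[OF inj] by (simp add: h)
  qed
  ultimately show ?thesis by (simp add: sum_negf)
qed

end

subsection \<open>Uniqueness of the extension\<close>

lemma gcoeff_prod_ggen:
  "sorted l \<Longrightarrow> distinct l \<Longrightarrow> gcoeff (prod_list (map ggen l)) J = (if J = set l then 1 else 0)"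
proof (induction l arbitrary: J)
  case Nil
  then show ?case by (simp add: gcoeff_1)
next
  case (Cons c l)
  have IH: "gcoeff (prod_list (map ggen l)) (J - {c}) = (if J - {c} = set l then 1 else 0)"
    using Cons by simp
  have "{j \<in> set l. j < c} = {}" using Cons.prems by auto
  then have "card {j \<in> set l. j < c} = 0" by (simp only: card.empty)
  then have g: "gsign {c} (set l) = 1" unfolding gsign_singleton by (simp only: power_0)
  have "(c \<in> J \<and> J - {c} = set l) \<longleftrightarrow> J = set (c # l)" using Cons.prems(2) by auto
  moreover have "gcoeff (prod_list (map ggen (c # l))) J
      = (if c \<in> J \<and> J - {c} = set l then gsign {c} (set l) else 0)"
    unfolding list.map prod_list.Cons gcoeff_ggen_mult IH by simp
  ultimately show ?case unfolding g by presburger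
qed

text \<open>With independent generators as odd coordinates, the value of a superfunction determines its
  coefficients.\<close>

definition generic_point :: "(coord \<Rightarrow> real) \<Rightarrow> coord \<Rightarrow> nat grass" where
  "generic_point x c = (if cpar c = 0 then of_real (x c) else ggen (coord_code c))"

text \<open>The even coordinates have no souls, so each Taylor series reduces to its constant term.
  \<open>coord_code\<close> preserves the order, so distinct monomials in the odd coordinates go to
  distinct monomials in the generators without any sign.\<close>

lemma gcoeff_seval_generic:
  assumes pt: "eval_point C U (generic_point x)" and f: "local_on C f" and I: "I \<subseteq> odds C"
  shows "gcoeff (seval C f (generic_point x)) (coord_code ` I) = gcoeff (f x) I"
proof -
  interpret eval_point C U "generic_point x" by fact
  let ?z = "generic_point x"
  have soul: "gsoul (?z c) = 0" if "c \<in> evens C" for c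
    using that by (simp add: evens_def generic_point_def gsoul_def gbody_def gcoeff_of_real)
  have T0: "T \<phi> N = 0" if "N \<noteq> 0" for \<phi> N
  proof -
    obtain M where "N = Suc M" using \<open>N \<noteq> 0\<close> not0_implies_Suc by blast
    then show ?thesis using T_Suc[of M \<phi>] by (simp add: soul)
  qed
  have b: "f (\<lambda>c. gbody (?z c)) = f x"
    by (rule local_dep[OF f]) (simp add: evens_def generic_point_def gbody_def gcoeff_of_real)
  have tay: "tay (\<lambda>y. gcoeff (f y) J) = of_real (gcoeff (f x) J)" for J
  proof -
    have "tay (\<lambda>y. gcoeff (f y) J) = (\<Sum>N<1. T (\<lambda>y. gcoeff (f y) J) N)"
      by (rule taylor_eq_sum) (simp add: T0)
    then show ?thesis by (simp add: taylor_term_0 b)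
  qed
  have inj: "inj_on coord_code A" for A by (auto simp: inj_on_def)
  have prod: "gcoeff (odd_prod J) (coord_code ` I) = (if J = I then 1 else 0)" if J: "J \<subseteq> odds C" for J
  proof -
    have fJ: "finite J" using J fin_odds finite_subset by blast
    define l where "l = sorted_list_of_set J"
    have l: "sorted l" "distinct l" "set l = J" using fJ by (simp_all add: l_def)
    have z: "map ?z l = map ggen (map coord_code l)"
      using l(3) J by (auto simp: generic_point_def odds_def)
    have "sorted (map coord_code l)"
      using l(1) unfolding sorted_map by (rule sorted_wrt_mono_rel[rotated]) (simp add: less_eq_coord_def)
    moreover have "distinct (map coord_code l)" using l(2) inj by (simp add: distinct_map)
    ultimately have "gcoeff (prod_list (map ?z l)) (coord_code ` I) = (if coord_code ` I = coord_code ` J then 1 else 0)"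
      unfolding z using gcoeff_prod_ggen[of "map coord_code l"] l(3) by simp
    moreover have "coord_code ` I = coord_code ` J \<longleftrightarrow> I = J"
      by (rule inj_image_eq_iff) (simp add: inj_on_def)
    ultimately show ?thesis by (auto simp: l_def)
  qed
  have "gcoeff (seval C f ?z) (coord_code ` I) = (\<Sum>J\<in>Pow (odds C). if J = I then gcoeff (f x) I else 0)"
    unfolding seval_eq gcoeff_sum
  proof (rule sum.cong)
    fix J assume "J \<in> Pow (odds C)"
    then show "gcoeff (tay (\<lambda>x. gcoeff (f x) J) * odd_prod J) (coord_code ` I) = (if J = I then gcoeff (f x) I else 0)"
      using prod[of J] by (simp add: tay of_real_def)
  qed simp
  also have "\<dots> = gcoeff (f x) I" using I fin_odds by simp
  finally show ?thesis .
qed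

lemma dimset_1_0 [simp]: "dimset 1 0 = {Even 0}" "dimset (Suc 0) 0 = {Even 0}" by (auto simp: dimset_def)

text \<open>The odd-odd block is empty: its determinant is an empty product, and the correction to
  the even block is an empty sum.\<close>

lemma Ber_1_0: "Ber 1 0 W = W (Even 0) (Even 0)"
proof -
  have p1: "{\<pi>. \<pi> permutes {..<1::nat}} = {id}"
    by (auto simp: lessThan_Suc permutes_sing)
  have p0: "{\<pi>. \<pi> permutes {..<0::nat}} = {id}" by auto
  have g1: "gdet 1 M = M 0 0" for M :: "nat \<Rightarrow> nat \<Rightarrow> nat grass"
    unfolding gdet_def p1 by simp
  have g0: "gdet 0 M = 1" for M :: "nat \<Rightarrow> nat \<Rightarrow> nat grass"
    unfolding gdet_def p0 by simp
  have "ginv (1 :: nat grass) = 1" unfolding ginv_def by (rule the_equality) auto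
  then show ?thesis unfolding Ber_def Let_def g1 g0 by (simp add: mat_mult_def)
qed

lemma GL_1_0: "W \<in> GL 1 0 \<longleftrightarrow> ghomogeneous 0 (W (Even 0) (Even 0)) \<and>
    (\<exists>v. W (Even 0) (Even 0) * v = 1 \<and> v * W (Even 0) (Even 0) = 1)" (is "?l \<longleftrightarrow> ?r")
proof
  assume ?l
  then show ?r by (auto simp: GL_def even_mat_def is_mat_inverse_def mat_mult_def)
next
  assume r: ?r
  then obtain v where "W (Even 0) (Even 0) * v = 1 \<and> v * W (Even 0) (Even 0) = 1" by blast
  then have "is_mat_inverse {Even 0} W (\<lambda>i j. v)" by (simp add: is_mat_inverse_def mat_mult_def)
  then show ?l using r by (auto simp: GL_def even_mat_def)
qed

section \<open>Identification of the explicit form with the stability isomorphism\<close>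

context mform
begin

text \<open>Where the coordinate \<open>w_22\<close> is nonzero, the generic point is admissible
  with invertible \<open>w_22\<close>, and its value determines all coefficients. Other points are
  reached by continuity along the line of that coordinate, which stays in the domain since the entry
  is even-even.\<close>

lemma form_ext:
  assumes f: "f \<in> sfuns C1 U" and g: "g \<in> sfuns C1 U"
    and eq: "\<And>P W. admissible n m (Suc p) q (Suc r) s P W \<Longrightarrow>
      (\<lambda>i j. W (shift r s i) (shift p q j)) \<in> GL 1 0 \<Longrightarrow>
      form_at n m (Suc p) q (Suc r) s f P W = form_at n m (Suc p) q (Suc r) s g P W"
  shows "f = g"
proof -
  let ?w = "Wc (Even r) (Even p)"
  have gen: "gcoeff (f x) I = gcoeff (g x) I" if x: "x \<in> U" and nz: "x ?w \<noteq> 0" for x I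
  proof -
    define P where "P = (\<lambda>A K. generic_point x (Pc A K))"
    define W where "W = (\<lambda>A K. generic_point x (Wc A K))"
    have pt: "point P W = generic_point x"
    proof
      show "point P W c = generic_point x c" for c by (cases c) (simp_all add: P_def W_def)
    qed
    have gb: "gbody (generic_point x c) = (if cpar c = 0 then x c else 0)" for c
      using gbody_odd[OF ghom_ggen[of "coord_code c"]] by (simp add: generic_point_def) (simp add: gbody_def gcoeff_of_real)
    have dom: "(\<lambda>c. gbody (generic_point x c)) \<in> U"
    proof -
      have "(\<lambda>c. gbody (generic_point x c)) \<in> U \<longleftrightarrow> x \<in> U"
        by (rule form_dom_cong) (simp_all add: gb)
      then show ?thesis using x by simp
    qed
    have hom: "ghomogeneous k (generic_point x c)" if "k mod 2 = cpar c" for c k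
    proof -
      have "ghomogeneous (cpar c) (generic_point x c)"
        using ghom_ggen ghom_of_real cpar_cases[of c] by (auto simp: generic_point_def)
      moreover have "cpar c mod 2 = k mod 2" using that by (metis mod_mod_trivial)
      ultimately show ?thesis using ghom_cong by blast
    qed
    have adm: "admissible n m (Suc p) q (Suc r) s P W"
      unfolding admissible_def even_mat_def pt
      using dom by (auto simp: P_def W_def intro!: hom)
    have "W (Even r) (Even p) = of_real (x ?w)" by (simp add: W_def generic_point_def)
    then have "(\<lambda>i j. W (shift r s i) (shift p q j)) \<in> GL 1 0"
      unfolding GL_1_0 using nz
      by (auto simp: ghom_of_real of_real_mult[symmetric] simp del: of_real_mult intro!: exI[of _ "of_real (1 / x ?w)"])
    then have "form_at n m (Suc p) q (Suc r) s f P W = form_at n m (Suc p) q (Suc r) s g P W"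
      by (rule eq[OF adm])
    then have sev: "seval C1 f (generic_point x) = seval C1 g (generic_point x)"
      by (simp add: form_at_def pt)
    have ep: "eval_point C1 U (generic_point x)" using eval_point_admissible[OF adm] by (simp add: pt)
    show ?thesis
    proof (cases "I \<subseteq> odds C1")
      case True
      then show ?thesis
        using gcoeff_seval_generic[OF ep sfuns_local[OF f]] gcoeff_seval_generic[OF ep sfuns_local[OF g]] sev by metis
    next
      case False
      then show ?thesis using local_support[OF sfuns_local[OF f]] local_support[OF sfuns_local[OF g]] by metis
    qed
  qed
  have "gcoeff (f x) I = gcoeff (g x) I" if x: "x \<in> U" for x I
  proof (cases "x ?w = 0")
    case True
    have line: "x(?w := t) \<in> U" for t
    proof -
      have "x(?w := t) \<in> U \<longleftrightarrow> x \<in> U" by (rule form_dom_cong) simp_all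
      then show ?thesis using x by simp
    qed
    \<comment> \<open>Smoothness provides differentiability along this line; continuity along it is
      all that the limit needs.\<close>
    have lim: "((\<lambda>t. gcoeff (k (x(?w := t))) I) \<longlongrightarrow> gcoeff (k x) I) (at 0)" if k: "k \<in> sfuns C1 U" for k
    proof -
      have "(\<lambda>t. gcoeff (k (x(?w := t))) I) differentiable (at (x ?w))"
        by (rule smooth_differentiable[OF smooth_sfun_coeff[OF sfuns_smooth_sfun[OF k finite_coords open_form_dom]] _ x]) simp
      then have "isCont (\<lambda>t. gcoeff (k (x(?w := t))) I) (x ?w)"
        by (rule differentiable_imp_continuous_within)
      then show ?thesis unfolding isCont_def True using True by (simp add: fun_upd_idem)
    qed
    have "((\<lambda>t. gcoeff (f (x(?w := t))) I) \<longlongrightarrow> gcoeff (g x) I) (at 0)"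
    proof (rule Lim_transform_eventually[OF lim[OF g]])
      show "\<forall>\<^sub>F t in at 0. gcoeff (g (x(?w := t))) I = gcoeff (f (x(?w := t))) I"
        using gen[OF line] by (auto simp: eventually_at_filter)
    qed
    then show ?thesis using tendsto_unique[OF _ lim[OF f]] by simp
  next
    case False
    then show ?thesis by (rule gen[OF x])
  qed
  moreover have "f x = 0 \<and> g x = 0" if "x \<notin> U" for x
  proof -
    have "\<forall>x. x \<notin> U \<longrightarrow> f x = 0" "\<forall>x. x \<notin> U \<longrightarrow> g x = 0" using f g by (simp_all add: sfuns_def)
    then show ?thesis using that by simp
  qed
  ultimately show ?thesis by (metis ext grass_eqI)
qed

text \<open>Multiplying the expansion from \<open>seval_shift\<close> by \<omega> cancels \<nu> in
  every summand. The sign in \<open>sigma_form\<close> arises from moving the entry of the last row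
  of w in front of the entry of the last column.\<close>

lemma sigma_form_eval:
  assumes adm: "admissible n m (Suc p) q (Suc r) s P W"
    and GL: "(\<lambda>i j. W (shift r s i) (shift p q j)) \<in> GL 1 0"
  defines "W22 \<equiv> (\<lambda>i j. W (shift r s i) (shift p q j))"
  defines "Z \<equiv> mat_mult {Even 0} (mat_inverse {Even 0} W22) (\<lambda>i K. W (shift r s i) K)"
  shows "form_at n m (Suc p) q (Suc r) s sigma_form P W
    = form_at n m p q r s L (\<lambda>A K. P A K - mat_mult {Even 0} (\<lambda>A j. P A (shift p q j)) Z A K)
        (\<lambda>F K. W F K - mat_mult {Even 0} (\<lambda>F j. W F (shift p q j)) Z F K) * Ber 1 0 W22"
proof -
  let ?z = "point P W"
  define \<omega> where "\<omega> = W (Even r) (Even p)"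
  define \<nu> where "\<nu> = mat_inverse {Even 0} W22 (Even 0) (Even 0)"
  have ep: "eval_point C1 U ?z" by (rule eval_point_admissible[OF adm])
  interpret p1: eval_point C1 U ?z by (rule ep)
  have "\<exists>N. is_mat_inverse {Even 0} W22 N" using GL by (simp add: GL_def W22_def)
  then have "is_mat_inverse {Even 0} W22 (mat_inverse {Even 0} W22)"
    unfolding mat_inverse_def by (rule someI_ex)
  then have inv: "\<omega> * \<nu> = 1" "\<nu> * \<omega> = 1"
    by (simp_all add: is_mat_inverse_def mat_mult_def \<omega>_def \<nu>_def W22_def)
  have \<omega>: "ghomogeneous 0 \<omega>" using GL unfolding GL_1_0 by (simp add: \<omega>_def)
  have \<nu>: "ghomogeneous 0 \<nu>" by (rule ghom_inverse[OF \<omega> inv])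
  have Z: "Z i K = \<nu> * W (Even r) K" if "i = Even 0" for i K using that by (simp add: Z_def mat_mult_def \<nu>_def)
  define P' where "P' = (\<lambda>A K. P A K - mat_mult {Even 0} (\<lambda>A j. P A (shift p q j)) Z A K)"
  define W' where "W' = (\<lambda>F K. W F K - mat_mult {Even 0} (\<lambda>F j. W F (shift p q j)) Z F K)"
  have P': "P' A K = P A K - P A (Even p) * (\<nu> * W (Even r) K)" for A K
    by (simp add: P'_def mat_mult_def Z)
  have W': "W' F K = W F K - W F (Even p) * (\<nu> * W (Even r) K)" for F K
    by (simp add: W'_def mat_mult_def Z)
  have zhom: "ghomogeneous (rpar X + par K) (?z (crd X K))" if "crd X K \<in> C1" for X K
    using p1.par[OF that] by (rule ghom_cpar_crd[THEN iffD1])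
  have z': "point P' W' (crd X K) = ?z (crd X K) - ?z (crd X (Even p)) * (\<nu> * ?z (crd wr K))" for X K
    by (cases X) (simp_all add: P' W')
  have par': "ghomogeneous (rpar X + par K) (?z (crd X (Even p)) * (\<nu> * ?z (crd wr K)))" if "X \<in> R" "K \<in> S" for X K
    using ghom_mult[OF zhom[OF new_coords(3)[OF that(1)]] ghom_mult[OF \<nu> zhom[OF new_coords(2)[OF that(2)]]]] by simp
  have ep': "eval_point C0 U (point P' W')"
  proof
    \<comment> \<open>In an odd row the entry of the additional column is odd and has no body. The
      bodies of the odd-odd entries, and with them the domain condition, are therefore unaffected by
      the shift.\<close>
    have odd_body: "gbody (point P' W' (crd X (Odd j))) = gbody (?z (crd X (Odd j)))"
      if "X \<in> R" "rpar X = 1" "Odd j \<in> S" for X j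
    proof -
      have "gbody (?z (crd X (Even p))) = 0"
        using gbody_odd zhom[OF new_coords(3)[OF that(1)]] that(2) by simp
      then show ?thesis unfolding z' by (simp add: gbody_def gcoeff_mult)
    qed
    have "(\<lambda>c. gbody (point P' W' c)) \<in> U \<longleftrightarrow> (\<lambda>c. gbody (?z c)) \<in> U"
    proof (rule form_dom_cong)
      show "gbody (point P' W' (Pc (Odd a) (Odd j))) = gbody (?z (Pc (Odd a) (Odd j)))" if "a < m" "j < q" for a j
      proof -
        have "Inl (Odd a) \<in> R" "Odd j \<in> S" using that by (auto simp: rows_def dimset_def)
        then show ?thesis using odd_body[of "Inl (Odd a)" j] by (simp only: rpar.simps par.simps crd.simps simp_thms)
      qed
      show "gbody (point P' W' (Wc (Odd a) (Odd j))) = gbody (?z (Wc (Odd a) (Odd j)))" if "a < s" "j < q" for a j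
      proof -
        have "Inr (Odd a) \<in> R" "Odd j \<in> S" using that by (auto simp: rows_def dimset_def)
        then show ?thesis using odd_body[of "Inr (Odd a)" j] by (simp only: rpar.simps par.simps crd.simps simp_thms)
      qed
    qed
    then show "(\<lambda>c. gbody (point P' W' c)) \<in> U" using p1.body by simp
    fix c assume "c \<in> C0"
    then obtain X K where c: "X \<in> R" "K \<in> S" "c = crd X K" unfolding coords_rows by auto
    have "crd X K \<in> C1" using c coords_mono \<open>c \<in> C0\<close> by blast
    then show "ghomogeneous (cpar c) (point P' W' c)"
      unfolding c(3) ghom_cpar_crd z' by (intro ghom_diff zhom par' c)
  qed (simp_all add: open_form_dom)
  have \<omega>c: "\<omega> * a = a * \<omega>" for a by (rule ghom_even_commute[OF \<omega>])
  have sh: "seval C0 L (point P' W') = seval C1 L ?z - (\<Sum>K\<in>S. \<Sum>Y\<in>R.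
    ?z (crd Y (Even p)) * (\<nu> * ?z (crd wr K)) * seval C1 (sderiv (crd Y K) L) ?z)"
  proof (rule seval_shift[OF ep \<nu> ep'])
    fix c
    show "point P' W' c = ?z c + (case c of Pc A K \<Rightarrow> - (?z (Pc A (Even p)) * (\<nu> * ?z (Wc (Even r) K)))
      | Wc F K \<Rightarrow> - (?z (Wc F (Even p)) * (\<nu> * ?z (Wc (Even r) K))))"
      by (cases c) (simp_all add: P' W')
  qed
  have summand: "\<omega> * (?z (crd Y (Even p)) * (\<nu> * ?z (crd wr K)) * D)
     = sg (rpar Y * par K) *\<^sub>R (?z (crd wr K) * (?z (crd Y (Even p)) * D))" if "Y \<in> R" "K \<in> S" for Y K D
  proof -
    have "\<omega> * (?z (crd Y (Even p)) * (\<nu> * ?z (crd wr K)) * D) = ?z (crd Y (Even p)) * ((\<omega> * \<nu>) * (?z (crd wr K) * D))"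
      using \<omega>c[of "?z (crd Y (Even p))"] by (metis mult.assoc)
    also have "\<dots> = ?z (crd Y (Even p)) * (?z (crd wr K) * D)" by (simp add: inv)
    also have "\<dots> = sg (rpar Y * par K) *\<^sub>R (?z (crd wr K) * (?z (crd Y (Even p)) * D))"
      using ghom_swap[OF zhom[OF new_coords(3)[OF that(1)]] zhom[OF new_coords(2)[OF that(2)]]] by simp
    finally show ?thesis .
  qed
  have "seval C1 sigma_form ?z = \<omega> * seval C0 L (point P' W')"
  proof -
    have "\<omega> * seval C0 L (point P' W') = \<omega> * seval C1 L ?z - (\<Sum>K\<in>S. \<Sum>Y\<in>R.
      \<omega> * (?z (crd Y (Even p)) * (\<nu> * ?z (crd wr K)) * seval C1 (sderiv (crd Y K) L) ?z))"
      unfolding sh by (simp only: right_diff_distrib sum_distrib_left)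
    also have "(\<Sum>K\<in>S. \<Sum>Y\<in>R. \<omega> * (?z (crd Y (Even p)) * (\<nu> * ?z (crd wr K)) * seval C1 (sderiv (crd Y K) L) ?z))
      = (\<Sum>K\<in>S. \<Sum>Y\<in>R. sg (rpar Y * par K) *\<^sub>R (?z (crd wr K) * (?z (crd Y (Even p)) * seval C1 (sderiv (crd Y K) L) ?z)))"
      by (intro sum.cong refl summand)
    also have "\<dots> = (\<Sum>Y\<in>R. \<Sum>K\<in>S. sg (rpar Y * par K) *\<^sub>R (?z (crd wr K) * (?z (crd Y (Even p)) * seval C1 (sderiv (crd Y K) L) ?z)))"
      by (rule sum.swap)
    finally show ?thesis unfolding seval_sigma_form[OF ep] by (simp add: \<omega>_def)
  qed
  then show ?thesis
    unfolding form_at_def Ber_1_0 P'_def[symmetric] W'_def[symmetric] by (simp add: \<omega>c) (simp add: \<omega>_def W22_def)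
qed

lemma stab_eq: "stab 1 0 n m p q r s L = sigma_form"
  unfolding stab_def Let_def dimset_1_0(1) add_0_right Suc_eq_plus1[symmetric]
proof (rule the_equality, goal_cases)
  case 1
  show ?case using sigma_form_sfuns sigma_form_eval by blast
next
  case (2 M)
  show "M = sigma_form"
  proof (rule form_ext)
    show "M \<in> sfuns C1 U" using 2 by blast
    show "sigma_form \<in> sfuns C1 U" by (rule sigma_form_sfuns)
    fix P W assume a: "admissible n m (Suc p) q (Suc r) s P W" and g: "(\<lambda>i j. W (shift r s i) (shift p q j)) \<in> GL 1 0"
    show "form_at n m (Suc p) q (Suc r) s M P W = form_at n m (Suc p) q (Suc r) s sigma_form P W"
      unfolding sigma_form_eval[OF a g] using 2 a g by blast
  qed
qed

end

section \<open>The relations\<close>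

text \<open>The part of \<open>u\<close> spanned by basis vectors of the other parity is the
  difference of \<open>u\<close> and the rest, so it lies in both \<open>V a\<close> and
  \<open>V (1 - a)\<close> and vanishes. Independence then kills its components.\<close>

lemma vcomp_hom:
  assumes V: "superspace V" and B: "super_basis n m V e" and a: "a \<in> {0, 1}" and u: "u \<in> V a"
    and A: "A \<in> dimset n m" "vcomp n m e u A \<noteq> 0"
  shows "par A = a"
proof (rule ccontr)
  assume ne: "par A \<noteq> a"
  let ?B = "dimset n m" and ?u = "vcomp n m e u"
  have sub: "subspace (V 0) \<and> subspace (V 1) \<and> V 0 \<inter> V 1 = {0}"
    using V unfolding superspace_def by (elim conjE, intro conjI)
  have subV: "subspace (V (1 - a))" "subspace (V a)" "V a \<inter> V (1 - a) = {0}"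
  proof -
    have "V 1 \<inter> V 0 = {0}" using sub by (simp only: Int_commute)
    moreover have "a = 0 \<and> 1 - a = 1 \<or> a = 1 \<and> 1 - a = 0" using a by auto
    ultimately show "subspace (V (1 - a))" "subspace (V a)" "V a \<inter> V (1 - a) = {0}"
      using sub by metis+
  qed
  have B': "inj_on e ?B" "independent (e ` ?B)" "span (e ` ?B) = UNIV" "\<And>A. A \<in> ?B \<Longrightarrow> e A \<in> V (par A)"
    using B by (auto simp: super_basis_def)
  have par01: "par A = a \<or> par A = 1 - a" for A using a by (cases A) auto
  have sum: "u = (\<Sum>A\<in>?B. ?u A *\<^sub>R e A)"
  proof -
    have "u = (\<Sum>b\<in>e ` ?B. representation (e ` ?B) u b *\<^sub>R b)"
      using B' by (intro real_vector.sum_representation_eq[symmetric]) auto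
    then show ?thesis by (simp add: sum.reindex[OF B'(1)] vcomp_def)
  qed
  let ?s = "\<lambda>c. \<Sum>A\<in>{A \<in> ?B. par A = c}. ?u A *\<^sub>R e A"
  have split: "u = ?s a + ?s (1 - a)"
  proof -
    have "?B = {A \<in> ?B. par A = a} \<union> {A \<in> ?B. par A = 1 - a}" using par01 by auto
    moreover have "{A \<in> ?B. par A = a} \<inter> {A \<in> ?B. par A = 1 - a} = {}" using a by auto
    ultimately show ?thesis using sum sum.union_disjoint[of "{A \<in> ?B. par A = a}" "{A \<in> ?B. par A = 1 - a}"]
      by (metis (no_types, lifting) finite_Un finite_dimset)
  qed
  have sV: "?s c \<in> V c" if "subspace (V c)" for c
    using that B'(4) by (intro subspace_sum subspace_scale) auto
  have diff: "?s (1 - a) = u - ?s a"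
    by (rule add_implies_diff) (subst add.commute, rule split[symmetric])
  have "?s (1 - a) \<in> V a"
    unfolding diff by (rule subspace_diff[OF subV(2) u sV[OF subV(2)]])
  then have zero: "?s (1 - a) = 0" using sV[OF subV(1)] subV(3) by blast
  let ?T = "{A \<in> ?B. par A = 1 - a}"
  have inj: "inj_on e ?T" using B'(1) by (rule inj_on_subset) auto
  \<comment> \<open>Linear independence concerns coefficients indexed by vectors;
    \<open>inv_into\<close> transports them from the indices.\<close>
  have "(\<Sum>b\<in>e ` ?T. ?u (inv_into ?T e b) *\<^sub>R b) = (\<Sum>A\<in>?T. ?u A *\<^sub>R e A)"
    unfolding sum.reindex[OF inj] by (rule sum.cong) (simp_all only: o_apply inv_into_f_f[OF inj])
  then have "(\<Sum>b\<in>e ` ?T. ?u (inv_into ?T e b) *\<^sub>R b) = 0" using zero by simp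
  moreover have "independent (e ` ?T)" using B'(2) by (rule real_vector.independent_mono) auto
  moreover have AT: "A \<in> ?T" using A(1) ne par01 by auto
  ultimately have "?u (inv_into ?T e (e A)) = 0"
    using real_vector.independentD[of "e ` ?T" "e ` ?T" "\<lambda>b. ?u (inv_into ?T e b)" "e A"] by auto
  then show False using A(2) inv_into_f_f[OF inj AT] by simp
qed

lemma vcomp_pairing:
  assumes B: "super_basis n m V e" and "linear \<alpha>"
  shows "(\<Sum>A\<in>dimset n m. vcomp n m e u A * \<alpha> (e A)) = \<alpha> u"
proof -
  let ?B = "dimset n m"
  have B': "inj_on e ?B" "independent (e ` ?B)" "span (e ` ?B) = UNIV"
    using B by (auto simp: super_basis_def)
  have "u = (\<Sum>b\<in>e ` ?B. representation (e ` ?B) u b *\<^sub>R b)"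
    using B' by (intro real_vector.sum_representation_eq[symmetric]) auto
  then have "u = (\<Sum>A\<in>?B. vcomp n m e u A *\<^sub>R e A)" by (simp add: sum.reindex[OF B'(1)] vcomp_def)
  then have "\<alpha> u = (\<Sum>A\<in>?B. \<alpha> (vcomp n m e u A *\<^sub>R e A))" using linear_sum[OF assms(2)] by metis
  then show ?thesis by (simp add: linear_scale[OF assms(2)])
qed

lemma ccomp_hom:
  assumes B: "super_basis n m V e" and b: "b \<in> {0, 1}" and \<alpha>: "\<alpha> \<in> covectors V b"
    and A: "A \<in> dimset n m" "ccomp e b \<alpha> A \<noteq> 0"
  shows "par A = b"
proof (rule ccontr)
  assume "par A \<noteq> b"
  then have "par A = 1 - b" using b by (cases A) auto
  moreover have "e A \<in> V (par A)" using B A(1) by (simp add: super_basis_def)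
  ultimately have "\<alpha> (e A) = 0" using \<alpha> by (simp add: covectors_def)
  then show False using A(2) by (simp add: ccomp_def)
qed

theorem theorem1p4:
  fixes V :: "nat \<Rightarrow> 'v::real_vector set" and e :: "idx \<Rightarrow> 'v"
    and n m p q r s a a' b b' :: nat
    and u v :: 'v and \<alpha> \<beta> :: "'v \<Rightarrow> real" and L :: sfun
  assumes "superspace V" and "super_basis n m V e"
    and "a \<in> {0, 1}" and "a' \<in> {0, 1}" and "b \<in> {0, 1}" and "b' \<in> {0, 1}"
    and "u \<in> V a" and "v \<in> V a'"
    and "\<alpha> \<in> covectors V b" and "\<beta> \<in> covectors V b'"
    and "L \<in> mixed_forms n m p q r s"
  shows "(\<forall>x. e_vec n m (p + 1) q r s e u (e_vec n m p q r s e v L) x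
           + (- 1) ^ (a * a') *\<^sub>R e_vec n m (p + 1) q r s e v (e_vec n m p q r s e u L) x = 0)
    \<and> (\<forall>x. e_covec n m p q (r + 1) s e b \<alpha> (e_covec n m p q r s e b' \<beta> L) x
           + (- 1) ^ (b * b') *\<^sub>R
             e_covec n m p q (r + 1) s e b' \<beta> (e_covec n m p q r s e b \<alpha> L) x = 0)
    \<and> (\<forall>x. e_vec n m p q (r + 1) s e u (e_covec n m p q r s e b \<alpha> L) x
           + (- 1) ^ (b * a) *\<^sub>R e_covec n m (p + 1) q r s e b \<alpha> (e_vec n m p q r s e u L) x
           = \<alpha> u *\<^sub>R stab 1 0 n m p q r s L x)"
proof -
  interpret mform n m p q r s L by unfold_locales (rule assms)
  have hu: "\<forall>A\<in>dimset n m. vcomp n m e u A \<noteq> 0 \<longrightarrow> par A = a"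
    using vcomp_hom[OF assms(1,2,3,7)] by blast
  have hv: "\<forall>A\<in>dimset n m. vcomp n m e v A \<noteq> 0 \<longrightarrow> par A = a'"
    using vcomp_hom[OF assms(1,2,4,8)] by blast
  have ha: "\<forall>A\<in>dimset n m. ccomp e b \<alpha> A \<noteq> 0 \<longrightarrow> par A = b"
    using ccomp_hom[OF assms(2,5,9)] by blast
  have hb: "\<forall>A\<in>dimset n m. ccomp e b' \<beta> A \<noteq> 0 \<longrightarrow> par A = b'"
    using ccomp_hom[OF assms(2,6,10)] by blast
  have lin: "linear \<alpha>" using assms(9) by (simp add: covectors_def)
  \<comment> \<open>Outside the domain superfunctions are set to zero; with \<open>stab_eq\<close>
    all three relations are trivial there.\<close>
  have off: "e_vec n m k q l s e y f x = 0" "e_covec n m k q l s e c \<gamma> f x = 0"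
    if "x \<notin> form_dom m q s" for k l y f x c \<gamma>
    using that by (simp_all add: e_vec_def e_covec_def restr_def)
  have "e_vec n m (Suc p) q r s e u (e_vec n m p q r s e v L) x
      + (- 1) ^ (a * a') *\<^sub>R e_vec n m (Suc p) q r s e v (e_vec n m p q r s e u L) x = 0 \<and>
    e_covec n m p q (Suc r) s e b \<alpha> (e_covec n m p q r s e b' \<beta> L) x
      + (- 1) ^ (b * b') *\<^sub>R e_covec n m p q (Suc r) s e b' \<beta> (e_covec n m p q r s e b \<alpha> L) x = 0 \<and>
    e_vec n m p q (Suc r) s e u (e_covec n m p q r s e b \<alpha> L) x
      + (- 1) ^ (b * a) *\<^sub>R e_covec n m (Suc p) q r s e b \<alpha> (e_vec n m p q r s e u L) x
      = \<alpha> u *\<^sub>R stab 1 0 n m p q r s L x" for x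
  proof (cases "x \<in> form_dom m q s")
    case True
    interpret mform_pt n m p q r s L x by unfold_locales (rule True)
    have "sigma_form x = sigma_val" using True by (simp only: sigma_form_def restr_def sigma_val_def if_True)
    then show ?thesis
      using e_vec_anticommute[OF hu hv] e_covec_anticommute[OF ha hb] e_vec_e_covec[OF hu ha]
      by (simp only: stab_eq vcomp_pairing[OF assms(2) lin] simp_thms)
  next
    case False
    then have "sigma_form x = 0" by (simp add: sigma_form_def restr_def)
    then show ?thesis using False by (simp only: off stab_eq scaleR_zero_right add_0_right simp_thms)
  qed
  then show ?thesis by (simp only: Suc_eq_plus1 simp_thms)
qed

end
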